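(* Let $n\ge2$ and let the tensor $\mathbb A$ satisfy the relaxed ellipticity condition with constant $C_{\mathbb A}>0$. Let $\mathbf U\in\mathbf C^\infty_{\#\sigma}$. (i) For any $(\mathbf f,g)\in\dot{\mathbf H}_\#^{s-2}\times\dot H_\#^{s-1}$, $s\ge1$, the anisotropic Oseen system $$-\boldsymbol{\mathfrak L}\mathbf u+\nabla p+(\mathbf U\cdot\nabla)\mathbf u=\mathbf f,\qquad\mathrm{div}\,\mathbf u=g$$ has a unique solution $(\mathbf u,p)\in\dot{\mathbf H}_\#^s\times\dot H_\#^{s-1}$. In addition, there exists a constant $C_s=C_s(C_{\mathbb A},\|\mathbb A\|,n,\mathbf U,s)>0$ such that $$\|\mathbf u\|_{\dot{\mathbf H}_\#^s}+\|p\|_{\dot H_\#^{s-1}}\le C_s\left(\|\mathbf f\|_{\dot{\mathbf H}_\#^{s-2}}+\|g\|_{\dot H_\#^{s-1}}\right),$$ and the operator $$S_U:\dot{\mathbf H}_\#^s\times\dot H_\#^{s-1}\to\dot{\mathbf H}_\#^{s-2}\times\dot H_\#^{s-1},\qquad S_U(\mathbf u,p)=(-\boldsymbol{\mathfrak L}\mathbf u+\nabla p+(\mathbf U\cdot\nabla)\mathbf u,\ \mathrm{div}\,\mathbf u),$$ is an isomorphism. (ii) Moreover, if $(\mathbf f,g)\in\dot{\mathbf C}^\infty_\#\times\dot{\mathcal C}^\infty_\#$ then $(\mathbf u,p)\in\dot{\mathbf C}^\infty_\#\times\dot{\mathcal C}^\infty_\#$.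
   Context: Repeated indices are summed from $1$ to $n$; $\partial_j=\partial/\partial x_j$. All functions and distributions are real-valued. $\mathbb A=(a_{kj}^{\alpha\beta})_{1\le k,j,\alpha,\beta\le n}$ is a tensor of real constants with the symmetry $a_{kj}^{\alpha\beta}=a_{\alpha j}^{k\beta}=a_{k\beta}^{\alpha j}$ (standing assumption). Relaxed ellipticity condition: there is a constant $C_{\mathbb A}>0$ such that $C_{\mathbb A}a_{kj}^{\alpha\beta}\zeta_{k\alpha}\zeta_{j\beta}\ge|\boldsymbol\zeta|^2:=\zeta_{k\alpha}\zeta_{k\alpha}$ for all $\boldsymbol\zeta\in\mathbb R^{n\times n}$ with $\boldsymbol\zeta=\boldsymbol\zeta^\top$ and $\sum_k\zeta_{kk}=0$. Norm: $\|\mathbb A\|:=\max|a_{kj}^{\alpha\beta}|$. $(\boldsymbol{\mathfrak L}\mathbf u)_k:=\partial_\alpha(a_{kj}^{\alpha\beta}E_{j\beta}(\mathbf u))=\partial_\alpha(a_{kj}^{\alpha\beta}\partial_\beta u_j)$ with $E_{j\beta}(\mathbf u)=\frac12(\partial_ju_\beta+\partial_\beta u_j)$. $((\mathbf U\cdot\nabla)\mathbf u)_k=U_j\partial_ju_k$. $\mathbb T=[0,1)^n$ is the flat torus; functions/distributions on it are identified with $1$-periodic ones on $\mathbb R^n$. $\mathcal C^\infty_\#$ denotes the $1$-periodic functions in $\mathcal C^\infty(\mathbb R^n)$. Fourier coefficients: $\hat g(\boldsymbol\xi)=\int_{\mathbb T}e^{-2\pi i\mathbf x\cdot\boldsymbol\xi}g(\mathbf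 x)d\mathbf x$, $\boldsymbol\xi\in\mathbb Z^n$, extended to periodic distributions. $H^s_\#$ is the space of periodic distributions with finite norm $\|g\|_{H^s_\#}=\big(\sum_{\boldsymbol\xi\in\mathbb Z^n}(1+|\boldsymbol\xi|^2)^s|\hat g(\boldsymbol\xi)|^2\big)^{1/2}$; $\dot H^s_\#=\{g\in H^s_\#:\hat g(\mathbf 0)=0\}$ with the same norm; $\dot{\mathcal C}^\infty_\#=\{g\in\mathcal C^\infty_\#:\int_{\mathbb T}g=0\}$. Bold symbols denote $n$-component vector versions; $\mathbf C^\infty_{\#\sigma}=\{\mathbf w\in\mathbf C^\infty_\#:\mathrm{div}\,\mathbf w=0\}$. Equations are understood in the sense of (periodic) distributions. *)

theory Defs
  imports "HOL-Analysis.Analysis"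
begin

section \<open>Smooth periodic functions\<close>

definition partial :: "'n::finite \<Rightarrow> (real^'n \<Rightarrow> real) \<Rightarrow> real^'n \<Rightarrow> real"
  where "partial j f = (\<lambda>x. frechet_derivative f (at x) (axis j 1))"

abbreviation partials :: "'n::finite list \<Rightarrow> (real^'n \<Rightarrow> real) \<Rightarrow> real^'n \<Rightarrow> real"
  where "partials js f \<equiv> foldr partial js f"

text \<open>Infinite differentiability: all iterated partial derivatives are differentiable.\<close>

definition Cinf_per :: "(real^'n::finite \<Rightarrow> real) set"
  where "Cinf_per = {f. (\<forall>js x. partials js f differentiable (at x)) \<and>
                        (\<forall>j x. f (x + axis j 1) = f x)}"

definition torus :: "(real^'n::finite) set"
  where "torus = {x. \<forall>i. 0 \<le> x $ i \<and> x $ i < 1}"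

definition Cinf_per_dot :: "(real^'n::finite \<Rightarrow> real) set"
  where "Cinf_per_dot = {f \<in> Cinf_per. (LINT x:torus|lborel. f x) = 0}"

definition Cinf_per_sigma :: "(real^'n::finite \<Rightarrow> real^'n) set"
  where "Cinf_per_sigma = {w. (\<forall>k. (\<lambda>x. w x $ k) \<in> Cinf_per) \<and>
                              (\<forall>x. (\<Sum>k\<in>UNIV. partial k (\<lambda>y. w y $ k) x) = 0)}"

text \<open>Convergence to \<open>0\<close> in the (metrizable) topology of the test function space.\<close>

definition null_seq :: "(nat \<Rightarrow> real^'n::finite \<Rightarrow> real) \<Rightarrow> bool"
  where "null_seq \<phi> \<longleftrightarrow> (\<forall>m. \<phi> m \<in> Cinf_per) \<and>
           (\<forall>js. uniform_limit UNIV (\<lambda>m. partials js (\<phi> m)) (\<lambda>_. 0) sequentially)"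

lemma Cinf_per_differentiable: "f \<in> Cinf_per \<Longrightarrow> partials js f differentiable (at x)"
  by (auto simp: Cinf_per_def)

lemma Cinf_per_differentiable0: "f \<in> Cinf_per \<Longrightarrow> f differentiable (at x)"
  using Cinf_per_differentiable[of f "[]"] by simp

lemma Cinf_per_period: "f \<in> Cinf_per \<Longrightarrow> f (x + axis j 1) = f x"
  by (auto simp: Cinf_per_def)

lemma Cinf_per_continuous: "f \<in> Cinf_per \<Longrightarrow> continuous_on S f"
  by (meson Cinf_per_differentiable0 continuous_at_imp_continuous_on
      differentiable_imp_continuous_within)

lemma partial_eqI:
  assumes "(f has_derivative D) (at x)"
  shows "partial j f x = D (axis j 1)"
  using frechet_derivative_at[OF assms] by (simp add: partial_def)

lemma partial_lincomb:
  assumes "f differentiable (at x)" "g differentiable (at x)"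
  shows "partial j (\<lambda>x. a * f x + b * g x) x = a * partial j f x + b * partial j g x"
proof -
  have "((\<lambda>x. a * f x + b * g x) has_derivative
      (\<lambda>h. a * frechet_derivative f (at x) h + b * frechet_derivative g (at x) h)) (at x)"
    using assms unfolding frechet_derivative_works by (intro derivative_intros)
  from partial_eqI[OF this] show ?thesis by (simp add: partial_def)
qed

lemma partial_mult:
  assumes "f differentiable (at x)" "g differentiable (at x)"
  shows "partial j (\<lambda>x. f x * g x) x = partial j f x * g x + f x * partial j g x"
proof -
  have "((\<lambda>x. f x * g x) has_derivative
      (\<lambda>h. f x * frechet_derivative g (at x) h + frechet_derivative f (at x) h * g x)) (at x)"
    using assms unfolding frechet_derivative_works by (rule has_derivative_mult)
  from partial_eqI[OF this] show ?thesis by (simp add: partial_def)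
qed

lemma partials_lincomb:
  assumes "f \<in> Cinf_per" "g \<in> Cinf_per"
  shows "partials js (\<lambda>x. a * f x + b * g x) = (\<lambda>x. a * partials js f x + b * partials js g x)"
proof (induction js)
  case (Cons j js)
  show ?case
    by (rule ext) (simp add: Cons partial_lincomb Cinf_per_differentiable assms)
qed simp

lemma Cinf_per_lincomb:
  assumes "f \<in> Cinf_per" "g \<in> Cinf_per"
  shows "(\<lambda>x. a * f x + b * g x) \<in> Cinf_per"
  using Cinf_per_differentiable[OF assms(1)] Cinf_per_differentiable[OF assms(2)]
  by (auto simp: Cinf_per_def partials_lincomb[OF assms] Cinf_per_period[OF assms(1)]
      Cinf_per_period[OF assms(2)])

lemma Cinf_per_partial:
  assumes "f \<in> Cinf_per"
  shows "partial j f \<in> Cinf_per"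
proof -
  have "partials js (partial j f) differentiable (at x)" for js x
    using Cinf_per_differentiable[OF assms, of "js @ [j]"] by simp
  moreover have "partial j f (x + axis i 1) = partial j f x" for i x
  proof -
    have "(f has_derivative frechet_derivative f (at (x + axis i 1))) (at (x + axis i 1))"
      using Cinf_per_differentiable0[OF assms] frechet_derivative_works by blast
    hence "((\<lambda>y. f (y + axis i 1)) has_derivative frechet_derivative f (at (x + axis i 1))) (at x)"
      by (rule has_derivative_compose[where f = "\<lambda>y. y + axis i 1" and s = UNIV, rotated])
        (auto intro!: derivative_eq_intros)
    hence "(f has_derivative frechet_derivative f (at (x + axis i 1))) (at x)"
      by (simp add: Cinf_per_period[OF assms])
    from partial_eqI[OF this] show ?thesis by (simp add: partial_def)
  qed
  ultimately show ?thesis by (simp add: Cinf_per_def)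
qed

inductive_set prod_sums :: "(real^'n::finite \<Rightarrow> real) set" where
  prod: "f \<in> Cinf_per \<Longrightarrow> g \<in> Cinf_per \<Longrightarrow> (\<lambda>x. f x * g x) \<in> prod_sums"
| sum: "h \<in> prod_sums \<Longrightarrow> k \<in> prod_sums \<Longrightarrow> (\<lambda>x. h x + k x) \<in> prod_sums"

lemma prod_sums_differentiable: "h \<in> prod_sums \<Longrightarrow> h differentiable (at x)"
  by (induction rule: prod_sums.induct)
    (auto intro: differentiable_mult differentiable_add Cinf_per_differentiable0)

lemma prod_sums_partial: "h \<in> prod_sums \<Longrightarrow> partial j h \<in> prod_sums"
proof (induction rule: prod_sums.induct)
  case (prod f g)
  have "partial j (\<lambda>x. f x * g x) = (\<lambda>x. partial j f x * g x + f x * partial j g x)"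
    by (rule ext) (simp add: partial_mult Cinf_per_differentiable0 prod)
  then show ?case by (simp add: prod prod_sums.intros Cinf_per_partial)
next
  case (sum h k)
  have "partial j (\<lambda>x. h x + k x) = (\<lambda>x. partial j h x + partial j k x)"
    using partial_lincomb[of h _ k j 1 1] sum by (intro ext) (simp add: prod_sums_differentiable)
  then show ?case by (simp add: sum prod_sums.intros)
qed

lemma prod_sums_partials: "h \<in> prod_sums \<Longrightarrow> partials js h \<in> prod_sums"
  by (induction js) (auto simp: prod_sums_partial)

lemma Cinf_per_mult:
  assumes "f \<in> Cinf_per" "g \<in> Cinf_per"
  shows "(\<lambda>x. f x * g x) \<in> Cinf_per"
proof -
  have "partials js (\<lambda>x. f x * g x) differentiable (at x)" for js x
    by (intro prod_sums_differentiable prod_sums_partials prod_sums.prod assms)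
  moreover have "f (x + axis j 1) * g (x + axis j 1) = f x * g x" for j x
    by (simp only: assms Cinf_per_period)
  ultimately show ?thesis unfolding Cinf_per_def by blast
qed

lemma zero_Cinf_per: "(\<lambda>x::real^'n::finite. 0) \<in> Cinf_per"
proof -
  have "partials js (\<lambda>x::real^'n. 0) = (\<lambda>x. 0)" for js :: "'n list"
    by (induction js) (auto simp: partial_def)
  then show ?thesis by (simp add: Cinf_per_def)
qed

lemma Cinf_per_translate_int:
  assumes "f \<in> Cinf_per"
  shows "f (x + of_int m *\<^sub>R axis j 1) = f x"
proof -
  have nat: "f (x + of_nat k *\<^sub>R axis j 1) = f x" for k x
  proof (induction k)
    case (Suc k)
    have "x + of_nat (Suc k) *\<^sub>R axis j 1 = (x + of_nat k *\<^sub>R axis j 1) + axis j 1"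
      by (simp add: algebra_simps)
    then show ?case using Suc Cinf_per_period[OF assms] by metis
  qed simp
  show ?thesis
  proof (cases "m \<ge> 0")
    case True
    then show ?thesis using nat[of x "nat m"] by simp
  next
    case False
    then show ?thesis
      using nat[of "x + of_int m *\<^sub>R axis j 1" "nat (-m)"] by (simp add: algebra_simps)
  qed
qed

lemma Cinf_per_attained:
  assumes "f \<in> Cinf_per"
  shows "\<exists>y\<in>torus. f y = f x"
proof -
  define y where "y = (\<lambda>S. x + (\<Sum>i\<in>S. of_int (- \<lfloor>x $ i\<rfloor>) *\<^sub>R axis i 1))"
  have "f (y S) = f x" if "finite S" for S
    using that
  proof (induction S)
    case (insert i S)
    have "y (insert i S) = y S + of_int (- \<lfloor>x $ i\<rfloor>) *\<^sub>R axis i 1"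
      using insert by (simp add: y_def algebra_simps)
    then show ?case using insert Cinf_per_translate_int[OF assms] by metis
  qed (simp add: y_def)
  moreover have "y UNIV \<in> torus"
  proof -
    have "y UNIV $ k = frac (x $ k)" for k
      by (simp add: y_def frac_def axis_def if_distrib if_distribR sum.delta cong: if_cong)
    then show ?thesis by (simp add: torus_def frac_lt_1)
  qed
  ultimately show ?thesis by (metis finite)
qed

lemma torus_subset: "torus \<subseteq> cbox 0 (\<chi> i. 1)"
  by (auto simp: torus_def mem_box_cart less_imp_le)

lemma Cinf_per_bounded:
  assumes "f \<in> Cinf_per"
  obtains B where "B > 0" "\<And>x. \<bar>f x\<bar> \<le> B"
proof -
  have "compact (f ` cbox 0 (\<chi> i. 1))"
    by (intro compact_continuous_image Cinf_per_continuous assms compact_cbox)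
  then obtain B where B: "B > 0" "\<And>y. y \<in> cbox 0 (\<chi> i. 1) \<Longrightarrow> \<bar>f y\<bar> \<le> B"
    by (auto dest!: compact_imp_bounded simp: bounded_pos)
  have "\<bar>f x\<bar> \<le> B" for x
  proof -
    obtain y where "y \<in> torus" "f y = f x" using Cinf_per_attained[OF assms] by blast
    then show ?thesis using B(2)[of y] torus_subset by auto
  qed
  with B(1) show ?thesis by (rule that)
qed

lemma null_seq_partial: "null_seq \<phi> \<Longrightarrow> null_seq (\<lambda>m. partial j (\<phi> m))"
  unfolding null_seq_def
proof (intro conjI allI; elim conjE)
  fix js
  assume "\<forall>js. uniform_limit UNIV (\<lambda>m. partials js (\<phi> m)) (\<lambda>_. 0) sequentially"
  from spec[OF this, of "js @ [j]"]
  show "uniform_limit UNIV (\<lambda>m. partials js (partial j (\<phi> m))) (\<lambda>_. 0) sequentially"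
    by simp
qed (simp add: Cinf_per_partial)

lemma null_seq_mult:
  assumes "f \<in> Cinf_per" "null_seq \<phi>"
  shows "null_seq (\<lambda>m x. f x * \<phi> m x)"
proof -
  have "uniform_limit UNIV (\<lambda>m. partials js (\<lambda>x. f x * \<phi> m x)) (\<lambda>_. 0) sequentially" for js
    using assms
  proof (induction js arbitrary: f \<phi> rule: rev_induct)
    case Nil
    from Nil(1) obtain B where B: "B > 0" "\<And>x. \<bar>f x\<bar> \<le> B" using Cinf_per_bounded by blast
    have "uniform_limit UNIV (\<lambda>m. partials [] (\<phi> m)) (\<lambda>_. 0) sequentially"
      using Nil(2) unfolding null_seq_def by blast
    hence lim: "uniform_limit UNIV \<phi> (\<lambda>_. 0) sequentially" by simp
    show ?case
    proof (rule uniform_limitI)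
      fix e :: real assume "e > 0"
      hence "\<forall>\<^sub>F m in sequentially. \<forall>x\<in>UNIV. dist (\<phi> m x) 0 < e / B"
        using B by (intro uniform_limitD[OF lim]) auto
      then show "\<forall>\<^sub>F m in sequentially. \<forall>x\<in>UNIV. dist (partials [] (\<lambda>x. f x * \<phi> m x) x) 0 < e"
      proof eventually_elim
        case (elim m)
        have "\<bar>f x\<bar> * \<bar>\<phi> m x\<bar> < e" for x
        proof -
          have "\<bar>f x\<bar> * \<bar>\<phi> m x\<bar> \<le> B * \<bar>\<phi> m x\<bar>" by (intro mult_right_mono B) auto
          also have "\<dots> < e" using elim B(1) by (auto simp: field_simps)
          finally show ?thesis .
        qed
        then show ?case by (simp add: abs_mult)
      qed
    qed
  next
    case (snoc j js)
    have \<phi>: "\<phi> m \<in> Cinf_per" for m using snoc.prems by (simp add: null_seq_def)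
    have *: "partials (js @ [j]) (\<lambda>x. f x * \<phi> m x) =
      (\<lambda>x. partials js (\<lambda>x. partial j f x * \<phi> m x) x + partials js (\<lambda>x. f x * partial j (\<phi> m) x) x)" for m
    proof -
      have "partial j (\<lambda>x. f x * \<phi> m x) =
          (\<lambda>x. 1 * (partial j f x * \<phi> m x) + 1 * (f x * partial j (\<phi> m) x))"
        by (rule ext) (simp add: partial_mult Cinf_per_differentiable0 snoc.prems \<phi>)
      then show ?thesis
        using partials_lincomb[of "\<lambda>x. partial j f x * \<phi> m x" "\<lambda>x. f x * partial j (\<phi> m) x" js 1 1]
        by (simp add: Cinf_per_mult Cinf_per_partial snoc.prems \<phi>)
    qed
    have "uniform_limit UNIV
        (\<lambda>m x. partials js (\<lambda>x. partial j f x * \<phi> m x) x + partials js (\<lambda>x. f x * partial j (\<phi> m) x) x)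
        (\<lambda>_. 0 + 0) sequentially"
      by (intro uniform_limit_add snoc.IH Cinf_per_partial null_seq_partial snoc.prems)
    then show ?case unfolding * by simp
  qed
  then show ?thesis
    using assms by (simp add: null_seq_def Cinf_per_mult)
qed

lemma torus_lborel:
  "(torus :: (real^'n::finite) set) \<in> sets lborel"
  "emeasure lborel (torus :: (real^'n) set) < \<infinity>"
proof -
  have "torus = (\<Inter>i. {x::real^'n. 0 \<le> x $ i \<and> x $ i < 1})" by (auto simp: torus_def)
  moreover have "{x::real^'n. 0 \<le> x $ i \<and> x $ i < 1} \<in> sets borel" for i
    by measurable
  hence "(\<Inter>i. {x::real^'n. 0 \<le> x $ i \<and> x $ i < 1}) \<in> sets borel"
    by (intro sets.finite_INT) auto
  ultimately show "(torus :: (real^'n) set) \<in> sets lborel" by simp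
  have "emeasure lborel (torus :: (real^'n) set) \<le> emeasure lborel (cbox (0::real^'n) (\<chi> i. 1))"
    by (intro emeasure_mono torus_subset) simp
  also have "\<dots> < \<infinity>" by (rule emeasure_lborel_cbox_finite)
  finally show "emeasure lborel (torus :: (real^'n) set) < \<infinity>" .
qed

lemma Cinf_per_integrable:
  assumes "f \<in> Cinf_per"
  shows "set_integrable lborel torus f"
proof -
  obtain B where B: "\<And>x. \<bar>f x\<bar> \<le> B" using Cinf_per_bounded[OF assms] by blast
  have "f \<in> borel_measurable borel"
    using Cinf_per_continuous[OF assms] by (rule borel_measurable_continuous_onI)
  then show ?thesis
    unfolding set_integrable_def using torus_lborel B
    by (intro integrableI_bounded_set_indicator[where B = B]) auto
qed


section \<open>Periodic distributions\<close>

text \<open>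
  Real-valued periodic distributions: continuous linear functionals on the test function space.
  Functionals are extended by \<open>0\<close> outside it, so that equality is equality on test functions.
\<close>

typedef (overloaded) 'n pdistr =
  "{T :: (real^'n::finite \<Rightarrow> real) \<Rightarrow> real.
      (\<forall>\<phi>. \<phi> \<notin> Cinf_per \<longrightarrow> T \<phi> = 0) \<and>
      (\<forall>\<phi>\<in>Cinf_per. \<forall>\<psi>\<in>Cinf_per. \<forall>a b. T (\<lambda>x. a * \<phi> x + b * \<psi> x) = a * T \<phi> + b * T \<psi>) \<and>
      (\<forall>\<phi>. null_seq \<phi> \<longrightarrow> (\<lambda>m. T (\<phi> m)) \<longlonglongrightarrow> 0)}"
  morphisms pairing Abs_pdistr
  by (rule exI[of _ "\<lambda>_. 0"]) simp

setup_lifting type_definition_pdistr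

instantiation pdistr :: (finite) real_vector
begin

lift_definition zero_pdistr :: "'a pdistr" is "\<lambda>_. 0" by simp

lift_definition plus_pdistr :: "'a pdistr \<Rightarrow> 'a pdistr \<Rightarrow> 'a pdistr" is "\<lambda>S T \<phi>. S \<phi> + T \<phi>"
  by (auto simp: algebra_simps intro!: tendsto_eq_intros)

lift_definition minus_pdistr :: "'a pdistr \<Rightarrow> 'a pdistr \<Rightarrow> 'a pdistr" is "\<lambda>S T \<phi>. S \<phi> - T \<phi>"
  by (auto simp: algebra_simps intro!: tendsto_eq_intros)

lift_definition uminus_pdistr :: "'a pdistr \<Rightarrow> 'a pdistr" is "\<lambda>T \<phi>. - T \<phi>"
  by (auto simp: algebra_simps intro!: tendsto_eq_intros)

lift_definition scaleR_pdistr :: "real \<Rightarrow> 'a pdistr \<Rightarrow> 'a pdistr" is "\<lambda>c T \<phi>. c * T \<phi>"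
  by (auto simp: algebra_simps intro!: tendsto_eq_intros)

instance
  by standard (transfer; auto simp: algebra_simps)+

end

text \<open>
  \<open>of_fun f\<close>, \<open>dpartial j T\<close> and \<open>dmult f T\<close> are the usual distributional operations; the case
  distinctions only implement the extension by \<open>0\<close>, and \<open>of_fun\<close> and \<open>dmult\<close> are meaningful for
  \<open>f \<in> Cinf_per\<close> only.
\<close>

lift_definition of_fun :: "(real^'n::finite \<Rightarrow> real) \<Rightarrow> 'n pdistr"
  is "\<lambda>f \<phi>. if f \<in> Cinf_per \<and> \<phi> \<in> Cinf_per then LINT x:torus|lborel. f x * \<phi> x else 0"
proof -
  fix f :: "real^'n \<Rightarrow> real"
  let ?T = "\<lambda>\<phi>. if f \<in> Cinf_per \<and> \<phi> \<in> Cinf_per then LINT x:torus|lborel. f x * \<phi> x else 0"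
  have "?T (\<lambda>x. a * \<phi> x + b * \<psi> x) = a * ?T \<phi> + b * ?T \<psi>"
    if "\<phi> \<in> Cinf_per" "\<psi> \<in> Cinf_per" for \<phi> \<psi> a b
  proof (cases "f \<in> Cinf_per")
    case True
    have "(LINT x:torus|lborel. a * (f x * \<phi> x) + b * (f x * \<psi> x)) =
        a * (LINT x:torus|lborel. f x * \<phi> x) + b * (LINT x:torus|lborel. f x * \<psi> x)"
      using True that
      by (subst set_integral_add) (auto intro!: Cinf_per_integrable set_integrable_mult_right Cinf_per_mult)
    then show ?thesis using True that by (simp add: Cinf_per_lincomb algebra_simps)
  qed simp
  moreover have "(\<lambda>m. ?T (\<phi> m)) \<longlonglongrightarrow> 0" if "null_seq \<phi>" for \<phi>
  proof (cases "f \<in> Cinf_per")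
    case True
    let ?\<mu> = "measure lborel (torus :: (real^'n) set)"
    have \<phi>: "\<phi> m \<in> Cinf_per" for m using that by (simp add: null_seq_def)
    have "null_seq (\<lambda>m x. f x * \<phi> m x)" using True that by (rule null_seq_mult)
    hence "uniform_limit UNIV (\<lambda>m. partials [] (\<lambda>x. f x * \<phi> m x)) (\<lambda>_. 0) sequentially"
      unfolding null_seq_def by blast
    hence lim: "uniform_limit UNIV (\<lambda>m x. f x * \<phi> m x) (\<lambda>_. 0) sequentially" by simp
    show ?thesis
    proof (rule LIMSEQ_I)
      fix e :: real assume e: "e > 0"
      define d where "d = e / (?\<mu> + 1)"
      have d: "d > 0" using e by (simp add: d_def add_nonneg_pos)
      obtain M where M: "\<And>m x. m \<ge> M \<Longrightarrow> \<bar>f x * \<phi> m x\<bar> < d"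
        using uniform_limitD[OF lim d] by (auto simp: eventually_sequentially)
      have "norm (?T (\<phi> m) - 0) < e" if "m \<ge> M" for m
      proof -
        have int: "set_integrable lborel torus (\<lambda>x. f x * \<phi> m x)"
          by (intro Cinf_per_integrable Cinf_per_mult True \<phi>)
        have dint: "set_integrable lborel (torus :: (real^'n) set) (\<lambda>x. d)"
          using torus_lborel by (auto simp: set_integrable_def)
        have "\<bar>LINT x:torus|lborel. f x * \<phi> m x\<bar> \<le> (LINT x:torus|lborel. \<bar>f x * \<phi> m x\<bar>)"
          using set_integral_norm_bound[OF int] by simp
        also have "\<dots> \<le> (LINT x:(torus :: (real^'n) set)|lborel. d)"
          using M[OF that] by (intro set_integral_mono set_integrable_abs int dint) (simp add: less_imp_le)
        also have "\<dots> = ?\<mu> * d"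
          using torus_lborel by (simp add: set_lebesgue_integral_def)
        also have "\<dots> < (?\<mu> + 1) * d" using d by simp
        also have "\<dots> = e" by (simp add: d_def add_nonneg_pos less_imp_neq[symmetric])
        finally show ?thesis using True \<phi> by simp
      qed
      then show "\<exists>no. \<forall>m\<ge>no. norm (?T (\<phi> m) - 0) < e" by blast
    qed
  qed simp
  ultimately show "(\<forall>\<phi>. \<phi> \<notin> Cinf_per \<longrightarrow> ?T \<phi> = 0) \<and>
      (\<forall>\<phi>\<in>Cinf_per. \<forall>\<psi>\<in>Cinf_per. \<forall>a b. ?T (\<lambda>x. a * \<phi> x + b * \<psi> x) = a * ?T \<phi> + b * ?T \<psi>) \<and>
      (\<forall>\<phi>. null_seq \<phi> \<longrightarrow> (\<lambda>m. ?T (\<phi> m)) \<longlonglongrightarrow> 0)"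
    by simp
qed

lift_definition dpartial :: "'n::finite \<Rightarrow> 'n pdistr \<Rightarrow> 'n pdistr"
  is "\<lambda>j T \<phi>. if \<phi> \<in> Cinf_per then - T (partial j \<phi>) else 0"
proof -
  fix j :: 'n and T :: "(real^'n \<Rightarrow> real) \<Rightarrow> real"
  assume T: "(\<forall>\<phi>. \<phi> \<notin> Cinf_per \<longrightarrow> T \<phi> = 0) \<and>
      (\<forall>\<phi>\<in>Cinf_per. \<forall>\<psi>\<in>Cinf_per. \<forall>a b. T (\<lambda>x. a * \<phi> x + b * \<psi> x) = a * T \<phi> + b * T \<psi>) \<and>
      (\<forall>\<phi>. null_seq \<phi> \<longrightarrow> (\<lambda>m. T (\<phi> m)) \<longlonglongrightarrow> 0)"
  let ?S = "\<lambda>\<phi>. if \<phi> \<in> Cinf_per then - T (partial j \<phi>) else 0"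
  have "?S (\<lambda>x. a * \<phi> x + b * \<psi> x) = a * ?S \<phi> + b * ?S \<psi>"
    if "\<phi> \<in> Cinf_per" "\<psi> \<in> Cinf_per" for \<phi> \<psi> a b
    using that partials_lincomb[OF that, of "[j]"] T by (simp add: Cinf_per_lincomb Cinf_per_partial)
  moreover have "(\<lambda>m. ?S (\<phi> m)) \<longlonglongrightarrow> 0" if "null_seq \<phi>" for \<phi>
  proof -
    have "(\<lambda>m. - T (partial j (\<phi> m))) \<longlonglongrightarrow> - 0"
      using T null_seq_partial[OF that] by (intro tendsto_minus) blast
    then show ?thesis using that by (simp add: null_seq_def)
  qed
  ultimately show "(\<forall>\<phi>. \<phi> \<notin> Cinf_per \<longrightarrow> ?S \<phi> = 0) \<and>
      (\<forall>\<phi>\<in>Cinf_per. \<forall>\<psi>\<in>Cinf_per. \<forall>a b. ?S (\<lambda>x. a * \<phi> x + b * \<psi> x) = a * ?S \<phi> + b * ?S \<psi>) \<and>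
      (\<forall>\<phi>. null_seq \<phi> \<longrightarrow> (\<lambda>m. ?S (\<phi> m)) \<longlonglongrightarrow> 0)"
    by simp
qed

lift_definition dmult :: "(real^'n::finite \<Rightarrow> real) \<Rightarrow> 'n pdistr \<Rightarrow> 'n pdistr"
  is "\<lambda>f T \<phi>. if f \<in> Cinf_per \<and> \<phi> \<in> Cinf_per then T (\<lambda>x. f x * \<phi> x) else 0"
proof -
  fix f :: "real^'n \<Rightarrow> real" and T :: "(real^'n \<Rightarrow> real) \<Rightarrow> real"
  assume T: "(\<forall>\<phi>. \<phi> \<notin> Cinf_per \<longrightarrow> T \<phi> = 0) \<and>
      (\<forall>\<phi>\<in>Cinf_per. \<forall>\<psi>\<in>Cinf_per. \<forall>a b. T (\<lambda>x. a * \<phi> x + b * \<psi> x) = a * T \<phi> + b * T \<psi>) \<and>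
      (\<forall>\<phi>. null_seq \<phi> \<longrightarrow> (\<lambda>m. T (\<phi> m)) \<longlonglongrightarrow> 0)"
  let ?S = "\<lambda>\<phi>. if f \<in> Cinf_per \<and> \<phi> \<in> Cinf_per then T (\<lambda>x. f x * \<phi> x) else 0"
  have "?S (\<lambda>x. a * \<phi> x + b * \<psi> x) = a * ?S \<phi> + b * ?S \<psi>"
    if "\<phi> \<in> Cinf_per" "\<psi> \<in> Cinf_per" for \<phi> \<psi> a b
  proof (cases "f \<in> Cinf_per")
    case True
    have "(\<lambda>x. f x * (a * \<phi> x + b * \<psi> x)) = (\<lambda>x. a * (f x * \<phi> x) + b * (f x * \<psi> x))"
      by (simp add: algebra_simps)
    then show ?thesis
      using that T Cinf_per_mult[OF True that(1)] Cinf_per_mult[OF True that(2)]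
      by (simp add: Cinf_per_lincomb)
  qed simp
  moreover have "(\<lambda>m. ?S (\<phi> m)) \<longlonglongrightarrow> 0" if "null_seq \<phi>" for \<phi>
  proof (cases "f \<in> Cinf_per")
    case True
    have "(\<lambda>m. T (\<lambda>x. f x * \<phi> m x)) \<longlonglongrightarrow> 0"
      using T null_seq_mult[OF True that] by blast
    then show ?thesis using True that by (simp add: null_seq_def)
  qed simp
  ultimately show "(\<forall>\<phi>. \<phi> \<notin> Cinf_per \<longrightarrow> ?S \<phi> = 0) \<and>
      (\<forall>\<phi>\<in>Cinf_per. \<forall>\<psi>\<in>Cinf_per. \<forall>a b. ?S (\<lambda>x. a * \<phi> x + b * \<psi> x) = a * ?S \<phi> + b * ?S \<psi>) \<and>
      (\<forall>\<phi>. null_seq \<phi> \<longrightarrow> (\<lambda>m. ?S (\<phi> m)) \<longlonglongrightarrow> 0)"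
    by simp
qed


section \<open>Fourier coefficients and Sobolev spaces\<close>

definition freq :: "int^'n::finite \<Rightarrow> real^'n"
  where "freq \<xi> = (\<chi> i. real_of_int (\<xi> $ i))"

text \<open>
  Distributions act on real test functions, so the pairing with \<open>exp (- 2 \<pi> \<i> x \<bullet> \<xi>)\<close> is taken
  separately for its real and imaginary part.
\<close>

definition fourier :: "'n::finite pdistr \<Rightarrow> int^'n \<Rightarrow> complex"
  where "fourier g \<xi> = Complex (pairing g (\<lambda>x. cos (2 * pi * (x \<bullet> freq \<xi>))))
                              (- pairing g (\<lambda>x. sin (2 * pi * (x \<bullet> freq \<xi>))))"

definition Hs :: "real \<Rightarrow> 'n::finite pdistr set"
  where "Hs s = {g. (\<lambda>\<xi>. (1 + (norm (freq \<xi>))\<^sup>2) powr s * (cmod (fourier g \<xi>))\<^sup>2) summable_on UNIV}"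

definition Hs_norm :: "real \<Rightarrow> 'n::finite pdistr \<Rightarrow> real"
  where "Hs_norm s g = sqrt (\<Sum>\<^sub>\<infinity>\<xi>. (1 + (norm (freq \<xi>))\<^sup>2) powr s * (cmod (fourier g \<xi>))\<^sup>2)"

definition Hs_dot :: "real \<Rightarrow> 'n::finite pdistr set"
  where "Hs_dot s = {g \<in> Hs s. fourier g 0 = 0}"

lemma trig_Cinf_per:
  "(\<lambda>x. a * cos (2 * pi * (x \<bullet> freq \<xi>)) + b * sin (2 * pi * (x \<bullet> freq \<xi>))) \<in> Cinf_per"
proof -
  let ?t = "\<lambda>a b x. a * cos (2 * pi * (x \<bullet> freq \<xi>)) + b * sin (2 * pi * (x \<bullet> freq \<xi>))"
  have der: "(?t a b has_derivative (\<lambda>h. 2 * pi * (h \<bullet> freq \<xi>) *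
      (b * cos (2 * pi * (x \<bullet> freq \<xi>)) - a * sin (2 * pi * (x \<bullet> freq \<xi>))))) (at x)" for a b x
    by (auto intro!: derivative_eq_intros simp: algebra_simps)
  have partial: "partial j (?t a b) =
      ?t (2 * pi * (axis j 1 \<bullet> freq \<xi>) * b) (- 2 * pi * (axis j 1 \<bullet> freq \<xi>) * a)" for a b j
    proof (rule ext)
    fix x
    show "partial j (?t a b) x =
        ?t (2 * pi * (axis j 1 \<bullet> freq \<xi>) * b) (- 2 * pi * (axis j 1 \<bullet> freq \<xi>) * a) x"
      unfolding partial_eqI[OF der] by (simp add: algebra_simps)
  qed
  have "\<exists>c d. partials js (?t a b) = ?t c d" for js
  proof (induction js)
    case (Cons j js)
    then obtain c d where "partials js (?t a b) = ?t c d" by blast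
    hence "partials (j # js) (?t a b) = partial j (?t c d)" by simp
    then show ?case unfolding partial by blast
  qed auto
  moreover have "?t c d differentiable (at x)" for c d x
    using der differentiable_def by blast
  ultimately have "partials js (?t a b) differentiable (at x)" for js x
  proof -
    assume diff: "\<And>c d x. ?t c d differentiable (at x)"
    assume "\<And>js. \<exists>c d. partials js (?t a b) = ?t c d"
    then obtain c d where "partials js (?t a b) = ?t c d" by blast
    then show ?thesis by (simp only: diff)
  qed
  moreover have "?t a b (x + axis j 1) = ?t a b x" for j x
  proof -
    have "2 * pi * ((x + axis j 1) \<bullet> freq \<xi>) = 2 * pi * (x \<bullet> freq \<xi>) + 2 * pi * of_int (\<xi> $ j)"
      by (simp add: inner_add_left inner_axis' freq_def algebra_simps)
    moreover have "sin (2 * pi * of_int (\<xi> $ j)) = 0" "cos (2 * pi * of_int (\<xi> $ j)) = 1"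
      by (auto simp: sin_int_2pin cos_int_2pin)
    ultimately show ?thesis by (simp add: sin_add cos_add)
  qed
  ultimately show ?thesis unfolding Cinf_per_def by blast
qed

lemma fourier_of_fun:
  fixes f :: "real^'n::finite \<Rightarrow> real"
  assumes f: "f \<in> Cinf_per"
  shows "fourier (of_fun f) \<xi> =
    (LINT x:torus|lborel. exp (- 2 * pi * \<i> * complex_of_real (x \<bullet> freq \<xi>)) * complex_of_real (f x))"
proof -
  let ?c = "\<lambda>x. cos (2 * pi * (x \<bullet> freq \<xi>))" and ?s = "\<lambda>x. sin (2 * pi * (x \<bullet> freq \<xi>))"
  have trig: "?c \<in> Cinf_per" "?s \<in> Cinf_per"
    using trig_Cinf_per[of 1 \<xi> 0] trig_Cinf_per[of 0 \<xi> 1] by simp_all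
  have int: "set_integrable lborel torus (\<lambda>x. f x * ?c x)" "set_integrable lborel torus (\<lambda>x. f x * ?s x)"
    by (intro Cinf_per_integrable Cinf_per_mult f trig)+
  have cint: "set_integrable lborel torus (\<lambda>x. complex_of_real (h x))"
    if "set_integrable lborel torus h" for h :: "real^'n \<Rightarrow> real"
    using integrable_of_real[OF that[unfolded set_integrable_def], where 'a = complex]
    by (simp add: set_integrable_def scaleR_conv_of_real)
  have "exp (- 2 * pi * \<i> * complex_of_real (x \<bullet> freq \<xi>)) * complex_of_real (f x) =
      complex_of_real (f x * ?c x) - \<i> * complex_of_real (f x * ?s x)" for x
    by (simp add: complex_eq_iff Re_exp Im_exp)
  hence "(LINT x:torus|lborel. exp (- 2 * pi * \<i> * complex_of_real (x \<bullet> freq \<xi>)) * complex_of_real (f x)) =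
      (LINT x:torus|lborel. complex_of_real (f x * ?c x) - \<i> * complex_of_real (f x * ?s x))"
    by simp
  also have "\<dots> = (LINT x:torus|lborel. complex_of_real (f x * ?c x)) -
      (LINT x:torus|lborel. \<i> * complex_of_real (f x * ?s x))"
    by (intro set_integral_diff set_integrable_mult_right cint int)
  also have "\<dots> = complex_of_real (LINT x:torus|lborel. f x * ?c x) -
      \<i> * complex_of_real (LINT x:torus|lborel. f x * ?s x)"
    by (simp only: set_integral_mult_right set_integral_complex_of_real)
  also have "\<dots> = fourier (of_fun f) \<xi>"
    by (simp add: fourier_def of_fun.rep_eq f trig complex_eq_iff)
  finally show ?thesis by simp
qed


section \<open>Vector fields and pairs\<close>

type_synonym 'n vdistr = "('n pdistr)^'n"

definition components_in :: "'a set \<Rightarrow> ('a^'n::finite) set"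
  where "components_in S = {u. \<forall>k. u $ k \<in> S}"

definition Hs_norm_vec :: "real \<Rightarrow> 'n::finite vdistr \<Rightarrow> real"
  where "Hs_norm_vec s u = sqrt (\<Sum>k\<in>UNIV. (Hs_norm s (u $ k))\<^sup>2)"

definition Hs_dot_pair :: "real \<Rightarrow> real \<Rightarrow> ('n::finite vdistr \<times> 'n pdistr) set"
  where "Hs_dot_pair s t = components_in (Hs_dot s) \<times> Hs_dot t"

definition Hs_norm_pair :: "real \<Rightarrow> real \<Rightarrow> 'n::finite vdistr \<times> 'n pdistr \<Rightarrow> real"
  where "Hs_norm_pair s t = (\<lambda>(u, p). Hs_norm_vec s u + Hs_norm t p)"

definition Cinf_dot_pair :: "('n::finite vdistr \<times> 'n pdistr) set"
  where "Cinf_dot_pair = components_in (of_fun ` Cinf_per_dot) \<times> of_fun ` Cinf_per_dot"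

text \<open>Isomorphism of normed spaces, each given by a carrier and a norm function on it.\<close>

definition normed_isomorphism ::
  "'a::real_vector set \<Rightarrow> ('a \<Rightarrow> real) \<Rightarrow> 'b::real_vector set \<Rightarrow> ('b \<Rightarrow> real) \<Rightarrow> ('a \<Rightarrow> 'b) \<Rightarrow> bool"
  where "normed_isomorphism X NX Y NY T \<longleftrightarrow>
    bij_betw T X Y \<and>
    (\<forall>x\<in>X. \<forall>y\<in>X. \<forall>a b. T (a *\<^sub>R x + b *\<^sub>R y) = a *\<^sub>R T x + b *\<^sub>R T y) \<and>
    (\<exists>C. \<forall>x\<in>X. NY (T x) \<le> C * NX x) \<and>
    (\<exists>C. \<forall>y\<in>Y. NX (inv_into X T y) \<le> C * NY y)"


section \<open>The anisotropic Oseen operator\<close>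

text \<open>A tensor \<open>A\<close> has the entries \<open>A k j \<alpha> \<beta>\<close>, with lower indices \<open>k j\<close> and upper indices \<open>\<alpha> \<beta>\<close>.\<close>

type_synonym 'n tensor = "'n \<Rightarrow> 'n \<Rightarrow> 'n \<Rightarrow> 'n \<Rightarrow> real"

definition tensor_symmetric :: "'n tensor \<Rightarrow> bool"
  where "tensor_symmetric A \<longleftrightarrow>
    (\<forall>k j \<alpha> \<beta>. A k j \<alpha> \<beta> = A \<alpha> j k \<beta> \<and> A k j \<alpha> \<beta> = A k \<beta> \<alpha> j)"

definition relaxed_elliptic :: "'n::finite tensor \<Rightarrow> real \<Rightarrow> bool"
  where "relaxed_elliptic A C \<longleftrightarrow> C > 0 \<and>
    (\<forall>\<zeta> :: real^'n^'n. \<zeta> = transpose \<zeta> \<and> trace \<zeta> = 0 \<longrightarrow>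
       C * (\<Sum>k\<in>UNIV. \<Sum>j\<in>UNIV. \<Sum>\<alpha>\<in>UNIV. \<Sum>\<beta>\<in>UNIV. A k j \<alpha> \<beta> * \<zeta> $ k $ \<alpha> * \<zeta> $ j $ \<beta>)
         \<ge> (\<Sum>k\<in>UNIV. \<Sum>\<alpha>\<in>UNIV. \<zeta> $ k $ \<alpha> * \<zeta> $ k $ \<alpha>))"

definition tensor_norm :: "'n::finite tensor \<Rightarrow> real"
  where "tensor_norm A = Max {\<bar>A k j \<alpha> \<beta>\<bar> | k j \<alpha> \<beta>. True}"

definition strain :: "'n::finite vdistr \<Rightarrow> 'n \<Rightarrow> 'n \<Rightarrow> 'n pdistr"
  where "strain u j \<beta> = (1/2) *\<^sub>R (dpartial j (u $ \<beta>) + dpartial \<beta> (u $ j))"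

definition aniso_op :: "'n::finite tensor \<Rightarrow> 'n vdistr \<Rightarrow> 'n vdistr"
  where "aniso_op A u =
    (\<chi> k. \<Sum>\<alpha>\<in>UNIV. dpartial \<alpha> (\<Sum>j\<in>UNIV. \<Sum>\<beta>\<in>UNIV. A k j \<alpha> \<beta> *\<^sub>R strain u j \<beta>))"

definition grad :: "'n::finite pdistr \<Rightarrow> 'n vdistr"
  where "grad p = (\<chi> k. dpartial k p)"

definition divergence :: "'n::finite vdistr \<Rightarrow> 'n pdistr"
  where "divergence u = (\<Sum>k\<in>UNIV. dpartial k (u $ k))"

definition advect :: "(real^'n::finite \<Rightarrow> real^'n) \<Rightarrow> 'n vdistr \<Rightarrow> 'n vdistr"
  where "advect U u = (\<chi> k. \<Sum>j\<in>UNIV. dmult (\<lambda>x. U x $ j) (dpartial j (u $ k)))"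

definition oseen :: "'n::finite tensor \<Rightarrow> (real^'n \<Rightarrow> real^'n) \<Rightarrow>
    'n vdistr \<times> 'n pdistr \<Rightarrow> 'n vdistr \<times> 'n pdistr"
  where "oseen A U = (\<lambda>(u, p). (- aniso_op A u + grad p + advect U u, divergence u))"

end

theory Submission
  imports Defs
begin

text \<open>
  Everything is done on Fourier coefficients. At a frequency \<open>\<xi> \<noteq> 0\<close>, with \<open>\<kappa> = 2 \<pi> \<xi>\<close>, the system
  without advection is the linear system \<open>M(\<kappa>) u + \<i> \<kappa> p = f\<close>, \<open>\<i> \<kappa> \<cdot> u = g\<close>. Relaxed
  ellipticity makes \<open>M(\<kappa>)\<close> coercive on the orthogonal complement of \<open>\<kappa>\<close>, so this system is uniquely
  solvable with \<open>|\<kappa>|\<^sup>2 |u| + |\<kappa>| |p| \<le> K (|f| + |\<kappa>| |g|)\<close>. The advection term is a convolution. It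
  loses one derivative less than the viscous term, and \<open>((U \<cdot> \<nabla>) v, v) = 0\<close> because \<open>div U = 0\<close>; the latter
  bounds \<open>u\<close> in \<open>H\<^sup>1\<close>, and interpolating \<open>H\<^sup>s\<^sup>-\<^sup>1\<close> between \<open>H\<^sup>s\<close> and \<open>H\<^sup>1\<close> turns the symbol bound into an
  a priori estimate in \<open>H\<^sup>s\<close>. Both bounds are uniform when the advection term is multiplied by
  \<open>t \<in> [0, 1]\<close>, so the method of continuity deforms the explicitly solvable case \<open>t = 0\<close> into \<open>t = 1\<close>.
  For smooth data, solutions exist in every \<open>H\<^sup>t\<close> and coincide by uniqueness.
\<close>

section \<open>Square-summable families\<close>

lemma summable_on_dominated:
  fixes f :: "'i \<Rightarrow> 'b::banach"
  assumes "g summable_on A" "\<And>x. x \<in> A \<Longrightarrow> norm (f x) \<le> g x"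
  shows "f summable_on A" "norm (infsum f A) \<le> infsum g A"
proof -
  show f: "f summable_on A"
    by (rule abs_summable_summable[OF Infinite_Sum.abs_summable_on_comparison_test'[OF assms(1)]]) (use assms(2) in auto)
  show "norm (infsum f A) \<le> infsum g A"
    by (rule norm_infsum_le[OF has_sum_infsum[OF f] has_sum_infsum[OF assms(1)]]) (use assms(2) in auto)
qed

lemma has_sum_finite_sum:
  fixes f :: "'k \<Rightarrow> 'i \<Rightarrow> 'b::topological_comm_monoid_add"
  assumes "\<And>k. k \<in> K \<Longrightarrow> (f k has_sum s k) A"
  shows "((\<lambda>x. \<Sum>k\<in>K. f k x) has_sum (\<Sum>k\<in>K. s k)) A"
  using assms by (induction K rule: infinite_finite_induct) (auto intro: has_sum_add)

lemma summable_on_finite_sum: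
  fixes f :: "'k \<Rightarrow> 'i \<Rightarrow> 'b::{topological_comm_monoid_add,t2_space}"
  assumes "\<And>k. k \<in> K \<Longrightarrow> f k summable_on A"
  shows "(\<lambda>x. \<Sum>k\<in>K. f k x) summable_on A"
    and "infsum (\<lambda>x. \<Sum>k\<in>K. f k x) A = (\<Sum>k\<in>K. infsum (f k) A)"
  using has_sum_finite_sum[of K f A "\<lambda>k. infsum (f k) A"] assms
  by (auto simp: has_sum_iff)

definition l2 :: "('i \<Rightarrow> real) \<Rightarrow> bool"
  where "l2 f \<longleftrightarrow> (\<lambda>i. (f i)\<^sup>2) summable_on UNIV"

definition l2norm :: "('i \<Rightarrow> real) \<Rightarrow> real"
  where "l2norm f = sqrt (\<Sum>\<^sub>\<infinity>i. (f i)\<^sup>2)"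

lemma l2norm_nonneg [simp]: "0 \<le> l2norm f"
  by (simp add: l2norm_def infsum_nonneg)

lemma l2norm_squared: "(l2norm f)\<^sup>2 = (\<Sum>\<^sub>\<infinity>i. (f i)\<^sup>2)"
  by (simp add: l2norm_def infsum_nonneg)

lemma L2_set_le_l2norm: "l2 f \<Longrightarrow> finite F \<Longrightarrow> L2_set f F \<le> l2norm f"
  unfolding L2_set_def l2norm_def l2_def
  by (intro real_sqrt_le_mono finite_sum_le_infsum) auto

lemma l2I_squares:
  assumes "\<And>F. finite F \<Longrightarrow> (\<Sum>i\<in>F. (f i)\<^sup>2) \<le> K\<^sup>2" and "K \<ge> 0"
  shows "l2 f" "l2norm f \<le> K"
proof -
  have "bdd_above (sum (\<lambda>i. (f i)\<^sup>2) ` {F. F \<subseteq> UNIV \<and> finite F})"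
    using assms(1) by (intro bdd_aboveI2[where M = "K\<^sup>2"]) auto
  then show "l2 f" unfolding l2_def by (intro nonneg_bdd_above_summable_on) auto
  hence "(\<Sum>\<^sub>\<infinity>i. (f i)\<^sup>2) \<le> K\<^sup>2"
    unfolding l2_def by (rule infsum_le_finite_sums) (use assms in auto)
  then show "l2norm f \<le> K" unfolding l2norm_def using assms(2) real_le_lsqrt by auto
qed

lemma l2I:
  assumes "\<And>F. finite F \<Longrightarrow> L2_set f F \<le> K"
  shows "l2 f" "l2norm f \<le> K"
proof -
  have K: "K \<ge> 0" using assms[of "{}"] by simp
  have "(\<Sum>i\<in>F. (f i)\<^sup>2) \<le> K\<^sup>2" if "finite F" for F
    using assms[OF that] K unfolding L2_set_def by (simp add: sqrt_le_D)
  from l2I_squares[OF this K] show "l2 f" "l2norm f \<le> K" by auto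
qed

lemma l2_le_add:
  assumes "l2 g" "l2 h" and "\<And>i. \<bar>f i\<bar> \<le> \<bar>g i\<bar> + \<bar>h i\<bar>"
  shows "l2 f" "l2norm f \<le> l2norm g + l2norm h"
proof -
  have "L2_set f F \<le> l2norm g + l2norm h" if F: "finite F" for F
  proof -
    have "L2_set f F = L2_set (\<lambda>i. \<bar>f i\<bar>) F" by (simp add: L2_set_def)
    also have "\<dots> \<le> L2_set (\<lambda>i. \<bar>g i\<bar> + \<bar>h i\<bar>) F"
      by (rule L2_set_mono) (use assms in auto)
    also have "\<dots> \<le> L2_set (\<lambda>i. \<bar>g i\<bar>) F + L2_set (\<lambda>i. \<bar>h i\<bar>) F" by (rule L2_set_triangle_ineq)
    also have "\<dots> = L2_set g F + L2_set h F" by (simp add: L2_set_def)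
    also have "\<dots> \<le> l2norm g + l2norm h" by (intro add_mono L2_set_le_l2norm assms F)
    finally show ?thesis .
  qed
  from l2I[OF this] show "l2 f" "l2norm f \<le> l2norm g + l2norm h" by auto
qed

lemma l2_zero [simp]: "l2 (\<lambda>_. 0)" "l2norm (\<lambda>_. 0) = 0"
  by (simp_all add: l2_def l2norm_def)

lemma l2_le:
  assumes "l2 g" and "\<And>i. \<bar>f i\<bar> \<le> \<bar>g i\<bar>"
  shows "l2 f" "l2norm f \<le> l2norm g"
  using l2_le_add[OF assms(1) l2_zero(1), of f] assms(2) by auto

lemma l2_cmult:
  assumes "l2 g"
  shows "l2 (\<lambda>i. c * g i)" "l2norm (\<lambda>i. c * g i) = \<bar>c\<bar> * l2norm g"
  using assms unfolding l2_def l2norm_def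
  by (auto simp: power_mult_distrib infsum_cmult_right' real_sqrt_mult intro!: summable_on_cmult_right)

lemma l2_component: "l2 f \<Longrightarrow> \<bar>f i\<bar> \<le> l2norm f"
  using L2_set_le_l2norm[of f "{i}"] by (simp add: L2_set_def)

lemma l2_mult:
  assumes "l2 f" "l2 g"
  shows "(\<lambda>i. f i * g i) summable_on UNIV" "\<bar>\<Sum>\<^sub>\<infinity>i. f i * g i\<bar> \<le> l2norm f * l2norm g"
proof -
  have le: "(\<Sum>i\<in>F. \<bar>f i\<bar> * \<bar>g i\<bar>) \<le> l2norm f * l2norm g" if "finite F" for F
    using L2_set_mult_ineq[of f g F] mult_mono[OF L2_set_le_l2norm[OF assms(1) that]
        L2_set_le_l2norm[OF assms(2) that]] by auto
  hence "bdd_above (sum (\<lambda>i. \<bar>f i\<bar> * \<bar>g i\<bar>) ` {F. F \<subseteq> UNIV \<and> finite F})"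
    by (intro bdd_aboveI2[where M = "l2norm f * l2norm g"]) auto
  hence s: "(\<lambda>i. \<bar>f i\<bar> * \<bar>g i\<bar>) summable_on UNIV"
    by (intro nonneg_bdd_above_summable_on) auto
  have d: "norm (f i * g i) \<le> \<bar>f i\<bar> * \<bar>g i\<bar>" for i by (simp add: abs_mult)
  show "(\<lambda>i. f i * g i) summable_on UNIV" by (rule summable_on_dominated(1)[OF s d])
  have "(\<Sum>\<^sub>\<infinity>i. \<bar>f i\<bar> * \<bar>g i\<bar>) \<le> l2norm f * l2norm g"
    by (rule infsum_le_finite_sums[OF s]) (use le in auto)
  then show "\<bar>\<Sum>\<^sub>\<infinity>i. f i * g i\<bar> \<le> l2norm f * l2norm g"
    using summable_on_dominated(2)[OF s d] by simp
qed

lemma summable_on_diff_reflect: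
  fixes a :: "'g::ab_group_add \<Rightarrow> real"
  assumes "a summable_on UNIV"
  shows "(\<lambda>\<eta>. a (\<xi> - \<eta>)) summable_on UNIV"
  using assms summable_on_reindex_bij_witness[of UNIV "\<lambda>\<eta>. \<xi> - \<eta>" "\<lambda>\<eta>. \<xi> - \<eta>" UNIV a "\<lambda>\<eta>. a (\<xi> - \<eta>)"]
  by simp

lemma l2_convolution:
  fixes a b :: "'g::ab_group_add \<Rightarrow> real"
  assumes a: "a summable_on UNIV" "\<And>\<xi>. a \<xi> \<ge> 0" and b: "l2 b"
  shows "(\<lambda>\<eta>. a (\<xi> - \<eta>) * b \<eta>) summable_on UNIV"
    and "l2 (\<lambda>\<xi>. \<Sum>\<^sub>\<infinity>\<eta>. a (\<xi> - \<eta>) * b \<eta>)"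
    and "l2norm (\<lambda>\<xi>. \<Sum>\<^sub>\<infinity>\<eta>. a (\<xi> - \<eta>) * b \<eta>) \<le> (\<Sum>\<^sub>\<infinity>\<zeta>. a \<zeta>) * l2norm b"
proof -
  define S where "S = (\<Sum>\<^sub>\<infinity>\<zeta>. a \<zeta>)"
  have S0: "S \<ge> 0" unfolding S_def by (intro infsum_nonneg a)
  have ar: "(\<lambda>\<eta>. a (\<xi> - \<eta>)) summable_on UNIV" for \<xi> by (rule summable_on_diff_reflect[OF a(1)])
  have arS: "(\<Sum>\<^sub>\<infinity>\<eta>. a (\<xi> - \<eta>)) = S" for \<xi>
    unfolding S_def by (rule infsum_reindex_bij_witness[of _ "\<lambda>\<eta>. \<xi> - \<eta>" "\<lambda>\<eta>. \<xi> - \<eta>"]) auto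
  have b2: "(\<lambda>i. (b i)\<^sup>2) summable_on UNIV" using b by (simp add: l2_def)
  have ab: "(\<lambda>\<eta>. a (\<xi> - \<eta>) * b \<eta>) summable_on UNIV" for \<xi>
  proof (rule summable_on_dominated(1)[where g = "\<lambda>\<eta>. a (\<xi> - \<eta>) * l2norm b"])
    show "(\<lambda>\<eta>. a (\<xi> - \<eta>) * l2norm b) summable_on UNIV" by (intro summable_on_cmult_left ar)
    show "norm (a (\<xi> - \<eta>) * b \<eta>) \<le> a (\<xi> - \<eta>) * l2norm b" for \<eta>
      using a(2) l2_component[OF b] by (simp add: abs_mult mult_left_mono)
  qed
  then show "(\<lambda>\<eta>. a (\<xi> - \<eta>) * b \<eta>) summable_on UNIV" .
  have ab2: "(\<lambda>\<eta>. a (\<xi> - \<eta>) * (b \<eta>)\<^sup>2) summable_on UNIV" for \<xi>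
  proof (rule summable_on_dominated(1)[where g = "\<lambda>\<eta>. S * (b \<eta>)\<^sup>2"])
    show "(\<lambda>\<eta>. S * (b \<eta>)\<^sup>2) summable_on UNIV" by (intro summable_on_cmult_right b2)
    have "a \<zeta> \<le> S" for \<zeta>
      using finite_sum_le_infsum[OF a(1), of "{\<zeta>}"] a(2) by (simp add: S_def)
    then show "norm (a (\<xi> - \<eta>) * (b \<eta>)\<^sup>2) \<le> S * (b \<eta>)\<^sup>2" for \<eta>
      using a(2) by (simp add: abs_mult mult_right_mono)
  qed
  have cs: "(\<Sum>\<^sub>\<infinity>\<eta>. a (\<xi> - \<eta>) * b \<eta>)\<^sup>2 \<le> S * (\<Sum>\<^sub>\<infinity>\<eta>. a (\<xi> - \<eta>) * (b \<eta>)\<^sup>2)" for \<xi>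
  proof -
    let ?f = "\<lambda>\<eta>. sqrt (a (\<xi> - \<eta>))" and ?g = "\<lambda>\<eta>. sqrt (a (\<xi> - \<eta>)) * b \<eta>"
    have f2: "(?f \<eta>)\<^sup>2 = a (\<xi> - \<eta>)" "(?g \<eta>)\<^sup>2 = a (\<xi> - \<eta>) * (b \<eta>)\<^sup>2"
        "?f \<eta> * ?g \<eta> = a (\<xi> - \<eta>) * b \<eta>" for \<eta>
      using a(2) by (simp_all add: power_mult_distrib flip: mult.assoc)
    have "l2 ?f" "l2 ?g" unfolding l2_def f2 by (rule ar, rule ab2)
    from l2_mult(2)[OF this] have "(\<Sum>\<^sub>\<infinity>\<eta>. a (\<xi> - \<eta>) * b \<eta>)\<^sup>2 \<le> (l2norm ?f * l2norm ?g)\<^sup>2"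
      unfolding f2 by (rule power2_le_iff_abs_le[THEN iffD2, rotated]) simp
    also have "\<dots> = S * (\<Sum>\<^sub>\<infinity>\<eta>. a (\<xi> - \<eta>) * (b \<eta>)\<^sup>2)"
      unfolding power_mult_distrib l2norm_squared f2 arS ..
    finally show ?thesis .
  qed
  have "(\<Sum>\<xi>\<in>F. (\<Sum>\<^sub>\<infinity>\<eta>. a (\<xi> - \<eta>) * b \<eta>)\<^sup>2) \<le> (S * l2norm b)\<^sup>2" if F: "finite F" for F
  proof -
    have "(\<Sum>\<xi>\<in>F. (\<Sum>\<^sub>\<infinity>\<eta>. a (\<xi> - \<eta>) * b \<eta>)\<^sup>2) \<le> (\<Sum>\<xi>\<in>F. S * (\<Sum>\<^sub>\<infinity>\<eta>. a (\<xi> - \<eta>) * (b \<eta>)\<^sup>2))"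
      by (intro sum_mono cs)
    also have "\<dots> = S * (\<Sum>\<^sub>\<infinity>\<eta>. \<Sum>\<xi>\<in>F. a (\<xi> - \<eta>) * (b \<eta>)\<^sup>2)"
      unfolding sum_distrib_left[symmetric] by (subst summable_on_finite_sum(2)) (auto intro: ab2)
    also have "(\<Sum>\<^sub>\<infinity>\<eta>. \<Sum>\<xi>\<in>F. a (\<xi> - \<eta>) * (b \<eta>)\<^sup>2) \<le> (\<Sum>\<^sub>\<infinity>\<eta>. S * (b \<eta>)\<^sup>2)"
    proof (rule infsum_mono)
      show "(\<lambda>\<eta>. \<Sum>\<xi>\<in>F. a (\<xi> - \<eta>) * (b \<eta>)\<^sup>2) summable_on UNIV"
        by (intro summable_on_finite_sum ab2)
      show "(\<lambda>\<eta>. S * (b \<eta>)\<^sup>2) summable_on UNIV" by (intro summable_on_cmult_right b2)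
      fix \<eta>
      have "(\<Sum>\<xi>\<in>F. a (\<xi> - \<eta>)) = (\<Sum>\<zeta>\<in>(\<lambda>\<xi>. \<xi> - \<eta>) ` F. a \<zeta>)"
        by (subst sum.reindex) (auto simp: inj_on_def)
      also have "\<dots> \<le> S" unfolding S_def by (rule finite_sum_le_infsum[OF a(1)]) (use F a in auto)
      finally show "(\<Sum>\<xi>\<in>F. a (\<xi> - \<eta>) * (b \<eta>)\<^sup>2) \<le> S * (b \<eta>)\<^sup>2"
        unfolding sum_distrib_right[symmetric] by (intro mult_right_mono) auto
    qed
    also have "S * (\<Sum>\<^sub>\<infinity>\<eta>. S * (b \<eta>)\<^sup>2) = (S * l2norm b)\<^sup>2"
      by (simp add: infsum_cmult_right' l2norm_squared power_mult_distrib power2_eq_square[of S])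
    finally show ?thesis using S0 by (simp add: mult_left_mono)
  qed
  from l2I_squares[OF this] S0
  show "l2 (\<lambda>\<xi>. \<Sum>\<^sub>\<infinity>\<eta>. a (\<xi> - \<eta>) * b \<eta>)"
    and "l2norm (\<lambda>\<xi>. \<Sum>\<^sub>\<infinity>\<eta>. a (\<xi> - \<eta>) * b \<eta>) \<le> (\<Sum>\<^sub>\<infinity>\<zeta>. a \<zeta>) * l2norm b"
    by (auto simp: S_def)
qed

lemma summable_on_trilinear:
  fixes a b f :: "'g::ab_group_add \<Rightarrow> real"
  assumes a: "a summable_on UNIV" "\<And>\<xi>. a \<xi> \<ge> 0" and b: "l2 b" "\<And>\<xi>. b \<xi> \<ge> 0"
    and f: "l2 f" "\<And>\<xi>. f \<xi> \<ge> 0"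
  shows "(\<lambda>(\<xi>, \<eta>). f \<xi> * (a (\<xi> - \<eta>) * b \<eta>)) summable_on UNIV \<times> UNIV"
proof (rule summable_on_SigmaI)
  show "((\<lambda>\<eta>. case (\<xi>, \<eta>) of (\<xi>, \<eta>) \<Rightarrow> f \<xi> * (a (\<xi> - \<eta>) * b \<eta>)) has_sum
      f \<xi> * (\<Sum>\<^sub>\<infinity>\<eta>. a (\<xi> - \<eta>) * b \<eta>)) UNIV" for \<xi>
    unfolding prod.case by (intro has_sum_cmult_right has_sum_infsum l2_convolution a b)
  show "(\<lambda>\<xi>. f \<xi> * (\<Sum>\<^sub>\<infinity>\<eta>. a (\<xi> - \<eta>) * b \<eta>)) summable_on UNIV"
    by (rule l2_mult(1)[OF f(1) l2_convolution(2)[OF a b(1)]])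
qed (use assms in auto)

section \<open>Fourier coefficients of smooth periodic functions\<close>

abbreviation tint :: "(real^'n::finite \<Rightarrow> real) \<Rightarrow> real"
  where "tint f \<equiv> (LINT x:torus|lborel. f x)"

lemma lborel_integral_shift:
  fixes f :: "'a::euclidean_space \<Rightarrow> real"
  assumes "f \<in> borel_measurable borel"
  shows "(LINT x|lborel. f (c + x)) = (LINT x|lborel. f x)"
  by (subst (2) lborel_distr_plus[of c, symmetric], subst integral_distr) (use assms in auto)

lemma tint_shift:
  fixes f :: "real^'n::finite \<Rightarrow> real"
  assumes f: "f \<in> Cinf_per" and h: "0 \<le> h" "h \<le> 1"
  shows "tint (\<lambda>x. f (x + h *\<^sub>R axis j 1)) = tint f"
proof -
  define e :: "real^'n" where "e = axis j 1"
  define A where "A = torus \<inter> {x::real^'n. x $ j < h}"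
  obtain B where B: "\<And>x. \<bar>f x\<bar> \<le> B" using Cinf_per_bounded[OF f] by blast
  have fm[measurable]: "f \<in> borel_measurable borel"
    using Cinf_per_continuous[OF f] by (rule borel_measurable_continuous_onI)
  have tm[measurable]: "(torus :: (real^'n) set) \<in> sets borel" using torus_lborel(1) by simp
  have Am[measurable]: "A \<in> sets borel"
  proof -
    have "{x::real^'n. x $ j < h} \<in> sets borel" by measurable
    then show ?thesis using tm unfolding A_def by blast
  qed
  have "emeasure lborel A \<le> emeasure lborel (torus :: (real^'n) set)"
    by (intro emeasure_mono) (auto simp: A_def)
  hence Af: "emeasure lborel A < \<infinity>" using torus_lborel(2) by (rule le_less_trans)
  have int: "integrable lborel (\<lambda>x. indicator S x *\<^sub>R f x)"
    if "S \<in> sets lborel" "emeasure lborel S < \<infinity>" for S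
    using that B by (intro integrableI_bounded_set_indicator[where B = B]) auto
  have Ae: "(LINT y|lborel. indicator A (y - e) *\<^sub>R f y) = (LINT y|lborel. indicator A y *\<^sub>R f y)"
    "integrable lborel (\<lambda>y. indicator A (y - e) *\<^sub>R f y)"
  proof -
    have "(LINT y|lborel. indicator A (y - e) *\<^sub>R f y) =
        (LINT y|lborel. indicator A ((e + y) - e) *\<^sub>R f (e + y))"
      by (rule lborel_integral_shift[symmetric]) measurable
    also have "\<dots> = (LINT y|lborel. indicator A y *\<^sub>R f y)"
      by (simp add: Cinf_per_period[OF f] e_def add.commute[of "axis j 1"])
    finally show "(LINT y|lborel. indicator A (y - e) *\<^sub>R f y) = (LINT y|lborel. indicator A y *\<^sub>R f y)" .
    have "emeasure lborel ((\<lambda>y. y - e) -` A) = emeasure lborel A"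
    proof -
      have "emeasure lborel A = emeasure (distr lborel borel ((+) (- e))) A"
        by (simp add: lborel_distr_plus)
      also have "\<dots> = emeasure lborel ((\<lambda>y. y - e) -` A)"
        by (subst emeasure_distr) (auto simp: vimage_def)
      finally show ?thesis by simp
    qed
    moreover have "(\<lambda>y. y - e) -` A \<in> sets lborel"
      using measurable_sets[of "\<lambda>y. y - e" borel borel A] by simp
    ultimately have "integrable lborel (\<lambda>y. indicator ((\<lambda>y. y - e) -` A) y *\<^sub>R f y)"
      using Af by (intro int) auto
    then show "integrable lborel (\<lambda>y. indicator A (y - e) *\<^sub>R f y)" by (simp add: indicator_def)
  qed
  have ind: "indicator torus (y - h *\<^sub>R e) = (indicator torus y - indicator A y + indicator A (y - e) :: real)" for y
  proof -
    have c: "(y - t *\<^sub>R e) $ i = (if i = j then y $ j - t else y $ i)" for t i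
      by (simp add: e_def axis_def)
    have T: "(y - t *\<^sub>R e) \<in> torus \<longleftrightarrow> (\<forall>i. i \<noteq> j \<longrightarrow> 0 \<le> y $ i \<and> y $ i < 1) \<and> 0 \<le> y $ j - t \<and> y $ j - t < 1" for t
      unfolding torus_def mem_Collect_eq c by auto
    show ?thesis
      using T[of h] T[of 0] T[of 1] c[of 1 j] h by (auto simp: indicator_def A_def)
  qed
  have "tint (\<lambda>x. f (x + h *\<^sub>R e)) = (LINT x|lborel. indicator torus ((h *\<^sub>R e + x) - h *\<^sub>R e) *\<^sub>R f (h *\<^sub>R e + x))"
    by (simp add: set_lebesgue_integral_def add.commute)
  also have "\<dots> = (LINT y|lborel. indicator torus (y - h *\<^sub>R e) *\<^sub>R f y)"
    by (rule lborel_integral_shift) measurable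
  also have "\<dots> = (LINT y|lborel. indicator torus y *\<^sub>R f y - indicator A y *\<^sub>R f y + indicator A (y - e) *\<^sub>R f y)"
    unfolding ind by (simp add: algebra_simps)
  also have "\<dots> = (LINT y|lborel. indicator torus y *\<^sub>R f y - indicator A y *\<^sub>R f y) +
      (LINT y|lborel. indicator A (y - e) *\<^sub>R f y)"
    by (intro Bochner_Integration.integral_add Bochner_Integration.integrable_diff int Ae torus_lborel) (use Af in auto)
  also have "\<dots> = (LINT y|lborel. indicator torus y *\<^sub>R f y)"
    unfolding Ae by (subst Bochner_Integration.integral_diff) (use int torus_lborel Af in auto)
  finally show ?thesis by (simp add: set_lebesgue_integral_def e_def)
qed

lemma Cinf_per_line_derivative:
  assumes "f \<in> Cinf_per"
  shows "((\<lambda>t. f (x + t *\<^sub>R axis j 1)) has_real_derivative partial j f (x + t *\<^sub>R axis j 1)) (at t)"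
proof -
  let ?D = "frechet_derivative f (at (x + t *\<^sub>R axis j 1))"
  have D: "(f has_derivative ?D) (at (x + t *\<^sub>R axis j 1))"
    using Cinf_per_differentiable0[OF assms] frechet_derivative_works by blast
  have "((\<lambda>t. f (x + t *\<^sub>R axis j 1)) has_derivative (\<lambda>h. ?D (h *\<^sub>R axis j 1))) (at t)"
    by (rule has_derivative_compose[where f = "\<lambda>t. x + t *\<^sub>R axis j 1", OF _ D])
      (auto intro!: derivative_eq_intros)
  moreover have "?D (h *\<^sub>R axis j 1) = partial j f (x + t *\<^sub>R axis j 1) * h" for h
    using linear_scale[OF has_derivative_linear[OF D]] by (simp add: partial_def)
  ultimately show ?thesis by (simp add: has_field_derivative_def)
qed

lemma tint_partial:
  fixes f :: "real^'n::finite \<Rightarrow> real"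
  assumes f: "f \<in> Cinf_per"
  shows "tint (partial j f) = 0"
proof -
  define h where "h m = inverse (real (Suc m))" for m
  have h: "0 < h m" "h m \<le> 1" for m by (auto simp: h_def field_simps)
  define Q where "Q m x = (f (x + h m *\<^sub>R axis j 1) - f x) / h m" for m x
  obtain B where B: "\<And>x. \<bar>partial j f x\<bar> \<le> B" using Cinf_per_bounded[OF Cinf_per_partial[OF f]] by blast
  have fm[measurable]: "g \<in> borel_measurable borel" if "g \<in> Cinf_per" for g :: "real^'n \<Rightarrow> real"
    using Cinf_per_continuous[OF that] by (rule borel_measurable_continuous_onI)
  have tm[measurable]: "(torus :: (real^'n) set) \<in> sets borel" using torus_lborel(1) by simp
  note [measurable] = fm[OF f] fm[OF Cinf_per_partial[OF f]]
  have Qb: "\<bar>Q m x\<bar> \<le> B" for m x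
  proof -
    obtain z where "f (x + h m *\<^sub>R axis j 1) - f (x + 0 *\<^sub>R axis j 1) = (h m - 0) * partial j f (x + z *\<^sub>R axis j 1)"
      using MVT2[OF h(1)[of m], of "\<lambda>t. f (x + t *\<^sub>R axis j 1)" "\<lambda>t. partial j f (x + t *\<^sub>R axis j 1)",
          OF Cinf_per_line_derivative[OF f]] by blast
    hence "Q m x = partial j f (x + z *\<^sub>R axis j 1)" using h(1)[of m] by (simp add: Q_def field_simps)
    then show ?thesis using B by simp
  qed
  have Qlim: "(\<lambda>m. Q m x) \<longlonglongrightarrow> partial j f x" for x
  proof -
    have "(\<lambda>t. (f (x + (0 + t) *\<^sub>R axis j 1) - f (x + 0 *\<^sub>R axis j 1)) / t) \<midarrow>0\<rightarrow> partial j f (x + 0 *\<^sub>R axis j 1)"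
      using Cinf_per_line_derivative[OF f, of x j 0] unfolding DERIV_def by blast
    moreover have "filterlim h (at 0) sequentially"
      unfolding filterlim_at h_def using LIMSEQ_inverse_real_of_nat by simp
    ultimately show ?thesis unfolding Q_def by (auto dest: filterlim_compose)
  qed
  have "(\<lambda>m. LINT x|lborel. indicator torus x *\<^sub>R Q m x) \<longlonglongrightarrow> (LINT x|lborel. indicator torus x *\<^sub>R partial j f x)"
  proof (rule integral_dominated_convergence[where w = "\<lambda>x. indicator torus x *\<^sub>R B"])
    show "integrable lborel (\<lambda>x::real^'n. indicator torus x *\<^sub>R B)"
      using torus_lborel by (intro integrableI_bounded_set_indicator[where B = "\<bar>B\<bar>"]) auto
    show "AE x in lborel. (\<lambda>m. indicator torus x *\<^sub>R Q m x) \<longlonglongrightarrow> indicator torus x *\<^sub>R partial j f x"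
      by (intro AE_I2 tendsto_intros Qlim)
    show "AE x in lborel. norm (indicator torus x *\<^sub>R Q m x) \<le> indicator torus x *\<^sub>R B" for m
      using Qb by (intro AE_I2) (simp add: indicator_def)
  qed (unfold Q_def, measurable)
  moreover have "(LINT x|lborel. indicator torus x *\<^sub>R Q m x) = 0" for m
  proof -
    have i1: "set_integrable lborel torus (\<lambda>x. f (x + h m *\<^sub>R axis j 1))"
    proof -
      obtain C where "\<And>x. \<bar>f x\<bar> \<le> C" using Cinf_per_bounded[OF f] by blast
      then show ?thesis unfolding set_integrable_def using torus_lborel
        by (intro integrableI_bounded_set_indicator[where B = C]) auto
    qed
    have "(LINT x|lborel. indicator torus x *\<^sub>R Q m x) = tint (\<lambda>x. (f (x + h m *\<^sub>R axis j 1) - f x) / h m)"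
      by (simp add: set_lebesgue_integral_def Q_def)
    also have "\<dots> = (tint (\<lambda>x. f (x + h m *\<^sub>R axis j 1)) - tint f) / h m"
      using i1 Cinf_per_integrable[OF f] by (simp add: set_integral_diff)
    also have "\<dots> = 0" using tint_shift[OF f, of "h m" j] h[of m] by (simp add: less_imp_le)
    finally show ?thesis .
  qed
  ultimately have "(\<lambda>m. 0) \<longlonglongrightarrow> tint (partial j f)" by (simp add: set_lebesgue_integral_def)
  then show ?thesis by (simp add: LIMSEQ_const_iff)
qed

lemma measure_torus: "measure lborel (torus :: (real^'n::finite) set) = 1"
proof -
  let ?c = "cbox (0::real^'n) (\<chi> i. 1)" and ?b = "box (0::real^'n) (\<chi> i. 1)"
  have one: "(\<Prod>b\<in>Basis. ((\<chi> i. 1) - (0::real^'n)) \<bullet> b) = 1"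
    by (intro prod.neutral) (auto simp: Basis_vec_def inner_axis)
  have "emeasure lborel ?c = 1" "emeasure lborel ?b = 1"
    using one by (subst emeasure_lborel_cbox_eq emeasure_lborel_box_eq; auto simp: Basis_vec_def inner_axis)+
  moreover have "emeasure lborel (torus :: (real^'n) set) \<le> emeasure lborel ?c"
    by (intro emeasure_mono torus_subset) simp
  moreover have "emeasure lborel ?b \<le> emeasure lborel (torus :: (real^'n) set)"
    using torus_lborel(1) by (intro emeasure_mono) (auto simp: mem_box_cart torus_def less_imp_le)
  ultimately show ?thesis by (simp add: measure_def)
qed

definition wv :: "int^'n::finite \<Rightarrow> real^'n"
  where "wv \<xi> = (2 * pi) *\<^sub>R freq \<xi>"

lemma inner_wv: "2 * pi * (x \<bullet> freq \<xi>) = x \<bullet> wv \<xi>"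
  by (simp add: wv_def)

lemma freq_simps [simp]:
  "freq 0 = 0" "freq (- \<xi>) = - freq \<xi>" "freq (\<xi> + \<eta>) = freq \<xi> + freq \<eta>" "freq (\<xi> - \<eta>) = freq \<xi> - freq \<eta>"
  by (simp_all add: freq_def vec_eq_iff)

lemma wv_simps [simp]:
  "wv 0 = 0" "wv (- \<xi>) = - wv \<xi>" "wv (\<xi> + \<eta>) = wv \<xi> + wv \<eta>" "wv (\<xi> - \<eta>) = wv \<xi> - wv \<eta>"
  by (simp_all add: wv_def algebra_simps)

lemma wv_eq_0 [simp]: "wv \<xi> = 0 \<longleftrightarrow> \<xi> = 0"
  by (simp add: wv_def freq_def vec_eq_iff)

lemma trig_wv_Cinf_per:
  "(\<lambda>x. cos (x \<bullet> wv \<xi>)) \<in> Cinf_per" "(\<lambda>x. sin (x \<bullet> wv \<xi>)) \<in> Cinf_per"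
  using trig_Cinf_per[of 1 \<xi> 0] trig_Cinf_per[of 0 \<xi> 1] by (simp_all add: inner_wv)

lemma fourier_wv:
  "fourier g \<xi> = Complex (pairing g (\<lambda>x. cos (x \<bullet> wv \<xi>))) (- pairing g (\<lambda>x. sin (x \<bullet> wv \<xi>)))"
  by (simp add: fourier_def inner_wv)

lemma partial_trig:
  "partial j (\<lambda>x. cos (x \<bullet> wv \<xi>)) = (\<lambda>x. - (wv \<xi> $ j) * sin (x \<bullet> wv \<xi>))"
  "partial j (\<lambda>x. sin (x \<bullet> wv \<xi>)) = (\<lambda>x. wv \<xi> $ j * cos (x \<bullet> wv \<xi>))"
proof -
  have "((\<lambda>x. cos (x \<bullet> wv \<xi>)) has_derivative (\<lambda>h. - sin (x \<bullet> wv \<xi>) * (h \<bullet> wv \<xi>))) (at x)"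
    "((\<lambda>x. sin (x \<bullet> wv \<xi>)) has_derivative (\<lambda>h. cos (x \<bullet> wv \<xi>) * (h \<bullet> wv \<xi>))) (at x)" for x
    by (auto intro!: derivative_eq_intros)
  from this[THEN partial_eqI] show "partial j (\<lambda>x. cos (x \<bullet> wv \<xi>)) = (\<lambda>x. - (wv \<xi> $ j) * sin (x \<bullet> wv \<xi>))"
    "partial j (\<lambda>x. sin (x \<bullet> wv \<xi>)) = (\<lambda>x. wv \<xi> $ j * cos (x \<bullet> wv \<xi>))"
    by (auto simp: inner_axis')
qed

lemma pairing_lincomb:
  "\<phi> \<in> Cinf_per \<Longrightarrow> \<psi> \<in> Cinf_per \<Longrightarrow>
    pairing T (\<lambda>x. a * \<phi> x + b * \<psi> x) = a * pairing T \<phi> + b * pairing T \<psi>"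
  using pairing[of T] by blast

lemma pairing_cmult: "\<phi> \<in> Cinf_per \<Longrightarrow> pairing T (\<lambda>x. a * \<phi> x) = a * pairing T \<phi>"
  using pairing_lincomb[of \<phi> \<phi> T a 0] by simp

lemma pairing_outside: "\<phi> \<notin> Cinf_per \<Longrightarrow> pairing T \<phi> = 0"
  using pairing[of T] by blast

lemma pairing_null_seq: "null_seq \<phi> \<Longrightarrow> (\<lambda>m. pairing T (\<phi> m)) \<longlonglongrightarrow> 0"
  using pairing[of T] by blast

lemma fourier_dpartial: "fourier (dpartial j T) \<xi> = \<i> * of_real (wv \<xi> $ j) * fourier T \<xi>"
  using trig_wv_Cinf_per[of \<xi>]
  by (simp add: fourier_wv dpartial.rep_eq partial_trig pairing_cmult complex_eq_iff
      pairing_cmult[where a = "- (wv \<xi> $ j)", simplified])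

lemma fourier_linear [simp]:
  "fourier (S + T) \<xi> = fourier S \<xi> + fourier T \<xi>"
  "fourier (S - T) \<xi> = fourier S \<xi> - fourier T \<xi>"
  "fourier (- T) \<xi> = - fourier T \<xi>"
  "fourier (a *\<^sub>R T) \<xi> = a *\<^sub>R fourier T \<xi>"
  "fourier 0 \<xi> = 0"
  by (simp_all add: fourier_wv plus_pdistr.rep_eq minus_pdistr.rep_eq uminus_pdistr.rep_eq
      scaleR_pdistr.rep_eq zero_pdistr.rep_eq complex_eq_iff)

lemma fourier_sum [simp]: "fourier (\<Sum>k\<in>K. T k) \<xi> = (\<Sum>k\<in>K. fourier (T k) \<xi>)"
  by (induction K rule: infinite_finite_induct) auto

lemma fourier_reflect: "fourier T (- \<xi>) = cnj (fourier T \<xi>)"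
  using pairing_cmult[OF trig_wv_Cinf_per(2), of T "-1" \<xi>]
  by (simp add: fourier_wv complex_eq_iff)

lemma pdistr_eqI: "(\<And>\<phi>. \<phi> \<in> Cinf_per \<Longrightarrow> pairing S \<phi> = pairing T \<phi>) \<Longrightarrow> S = T"
  by (subst pairing_inject[symmetric], rule ext) (metis pairing_outside)

lemma pairing_of_fun: "f \<in> Cinf_per \<Longrightarrow> \<phi> \<in> Cinf_per \<Longrightarrow> pairing (of_fun f) \<phi> = tint (\<lambda>x. f x * \<phi> x)"
  by (simp add: of_fun.rep_eq)

lemma tint_lincomb:
  assumes "f \<in> Cinf_per" "g \<in> Cinf_per"
  shows "tint (\<lambda>x. a * f x + b * g x) = a * tint f + b * tint g"
  by (subst set_integral_add) (auto intro!: Cinf_per_integrable set_integrable_mult_right assms)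

lemma of_fun_lincomb:
  assumes "f \<in> Cinf_per" "g \<in> Cinf_per"
  shows "of_fun (\<lambda>x. a * f x + b * g x) = a *\<^sub>R of_fun f + b *\<^sub>R of_fun g"
proof (rule pdistr_eqI)
  fix \<phi> :: "real^'a \<Rightarrow> real" assume \<phi>: "\<phi> \<in> Cinf_per"
  have "tint (\<lambda>x. (a * f x + b * g x) * \<phi> x) = tint (\<lambda>x. a * (f x * \<phi> x) + b * (g x * \<phi> x))"
    by (simp add: algebra_simps)
  also have "\<dots> = a * tint (\<lambda>x. f x * \<phi> x) + b * tint (\<lambda>x. g x * \<phi> x)"
    by (intro tint_lincomb Cinf_per_mult assms \<phi>)
  finally show "pairing (of_fun (\<lambda>x. a * f x + b * g x)) \<phi> = pairing (a *\<^sub>R of_fun f + b *\<^sub>R of_fun g) \<phi>"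
    by (simp add: pairing_of_fun Cinf_per_lincomb assms \<phi> plus_pdistr.rep_eq scaleR_pdistr.rep_eq)
qed

lemma dpartial_of_fun:
  assumes f: "f \<in> Cinf_per"
  shows "dpartial j (of_fun f) = of_fun (partial j f)"
proof (rule pdistr_eqI)
  fix \<phi> :: "real^'a \<Rightarrow> real" assume \<phi>: "\<phi> \<in> Cinf_per"
  have "0 = tint (partial j (\<lambda>x. f x * \<phi> x))"
    by (simp add: tint_partial Cinf_per_mult f \<phi>)
  also have "partial j (\<lambda>x. f x * \<phi> x) = (\<lambda>x. 1 * (partial j f x * \<phi> x) + 1 * (f x * partial j \<phi> x))"
    by (rule ext) (simp add: partial_mult Cinf_per_differentiable0 f \<phi>)
  also have "tint \<dots> = tint (\<lambda>x. partial j f x * \<phi> x) + tint (\<lambda>x. f x * partial j \<phi> x)"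
    by (subst tint_lincomb) (auto intro!: Cinf_per_mult Cinf_per_partial f \<phi>)
  finally show "pairing (dpartial j (of_fun f)) \<phi> = pairing (of_fun (partial j f)) \<phi>"
    by (simp add: dpartial.rep_eq pairing_of_fun Cinf_per_partial f \<phi>)
qed

abbreviation coeff :: "(real^'n::finite \<Rightarrow> real) \<Rightarrow> int^'n \<Rightarrow> complex"
  where "coeff \<phi> \<equiv> fourier (of_fun \<phi>)"

lemma coeff_lincomb:
  "f \<in> Cinf_per \<Longrightarrow> g \<in> Cinf_per \<Longrightarrow>
    coeff (\<lambda>x. a * f x + b * g x) \<xi> = of_real a * coeff f \<xi> + of_real b * coeff g \<xi>"
  by (simp add: of_fun_lincomb scaleR_conv_of_real)

lemma coeff_partial: "f \<in> Cinf_per \<Longrightarrow> coeff (partial j f) \<xi> = \<i> * of_real (wv \<xi> $ j) * coeff f \<xi>"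
  by (simp add: fourier_dpartial flip: dpartial_of_fun)

lemma tint_one: "tint (\<lambda>x::real^'n::finite. 1) = 1"
  by (simp add: set_lebesgue_integral_def measure_torus torus_lborel(1))

lemma tint_trig:
  "tint (\<lambda>x. cos (x \<bullet> wv \<xi>)) = (if \<xi> = 0 then 1 else 0)" (is ?c)
  "tint (\<lambda>x. sin (x \<bullet> wv \<xi>)) = 0" (is ?s)
proof -
  have "tint (\<lambda>x. cos (x \<bullet> wv \<xi>)) = 0 \<and> tint (\<lambda>x. sin (x \<bullet> wv \<xi>)) = 0" if "\<xi> \<noteq> 0"
  proof -
    have "wv \<xi> \<noteq> 0" using that by simp
    then obtain j where j: "wv \<xi> $ j \<noteq> 0" by (auto simp: vec_eq_iff)
    have "tint (\<lambda>x. - (wv \<xi> $ j) * sin (x \<bullet> wv \<xi>)) = 0" "tint (\<lambda>x. wv \<xi> $ j * cos (x \<bullet> wv \<xi>)) = 0"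
      using tint_partial[OF trig_wv_Cinf_per(1), of j \<xi>] tint_partial[OF trig_wv_Cinf_per(2), of j \<xi>]
      unfolding partial_trig by auto
    then show ?thesis using j unfolding set_integral_mult_right by auto
  qed
  moreover have "tint (\<lambda>x. cos (x \<bullet> wv 0)) = 1" using tint_one by simp
  moreover have "tint (\<lambda>x. sin (x \<bullet> wv 0)) = 0" by (simp add: set_lebesgue_integral_def)
  ultimately show ?c ?s by (cases "\<xi> = 0"; simp)+
qed

lemma coeff_tint:
  assumes "f \<in> Cinf_per"
  shows "coeff f \<xi> = Complex (tint (\<lambda>x. f x * cos (x \<bullet> wv \<xi>))) (- tint (\<lambda>x. f x * sin (x \<bullet> wv \<xi>)))"
  by (simp add: fourier_wv pairing_of_fun trig_wv_Cinf_per assms)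

lemma coeff_mult_trig:
  assumes f: "f \<in> Cinf_per"
  shows "coeff (\<lambda>x. f x * cos (x \<bullet> wv \<eta>)) \<xi> = (coeff f (\<xi> - \<eta>) + coeff f (\<xi> + \<eta>)) / 2" (is ?c)
    and "coeff (\<lambda>x. f x * sin (x \<bullet> wv \<eta>)) \<xi> = (coeff f (\<xi> - \<eta>) - coeff f (\<xi> + \<eta>)) / (2 * \<i>)" (is ?s)
proof -
  let ?C = "\<lambda>\<zeta> x. f x * cos (x \<bullet> wv \<zeta>)" and ?S = "\<lambda>\<zeta> x. f x * sin (x \<bullet> wv \<zeta>)"
  have cs: "?C \<zeta> \<in> Cinf_per" "?S \<zeta> \<in> Cinf_per" for \<zeta> by (intro Cinf_per_mult f trig_wv_Cinf_per)+
  have e: "(\<lambda>x. ?C \<eta> x * cos (x \<bullet> wv \<xi>)) = (\<lambda>x. (1/2) * ?C (\<xi> - \<eta>) x + (1/2) * ?C (\<xi> + \<eta>) x)"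
    "(\<lambda>x. ?C \<eta> x * sin (x \<bullet> wv \<xi>)) = (\<lambda>x. (1/2) * ?S (\<xi> - \<eta>) x + (1/2) * ?S (\<xi> + \<eta>) x)"
    "(\<lambda>x. ?S \<eta> x * cos (x \<bullet> wv \<xi>)) = (\<lambda>x. (-1/2) * ?S (\<xi> - \<eta>) x + (1/2) * ?S (\<xi> + \<eta>) x)"
    "(\<lambda>x. ?S \<eta> x * sin (x \<bullet> wv \<xi>)) = (\<lambda>x. (1/2) * ?C (\<xi> - \<eta>) x + (-1/2) * ?C (\<xi> + \<eta>) x)"
    by (rule ext, simp add: inner_diff_right inner_add_right cos_diff cos_add sin_diff sin_add field_simps)+
  show ?c
    unfolding coeff_tint[OF cs(1)] coeff_tint[OF f] e tint_lincomb[OF cs(1) cs(1)] tint_lincomb[OF cs(2) cs(2)]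
    by (simp add: complex_eq_iff)
  have "coeff (?S \<eta>) \<xi> * (2 * \<i>) = coeff f (\<xi> - \<eta>) - coeff f (\<xi> + \<eta>)"
    unfolding coeff_tint[OF cs(2)] coeff_tint[OF f] e tint_lincomb[OF cs(1) cs(1)] tint_lincomb[OF cs(2) cs(2)]
    by (simp add: complex_eq_iff)
  then show ?s by (metis (no_types) complex_i_not_zero mult_eq_0_iff nonzero_mult_div_cancel_right zero_neq_numeral)
qed

lemma one_Cinf_per: "(\<lambda>x::real^'n::finite. 1) \<in> Cinf_per"
  using trig_wv_Cinf_per(1)[of 0] by simp

lemma coeff_one: "coeff (\<lambda>x. 1) \<xi> = (if \<xi> = 0 then 1 else 0)"
  by (simp add: coeff_tint one_Cinf_per tint_trig complex_eq_iff)

lemma coeff_trig: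
  "coeff (\<lambda>x. cos (x \<bullet> wv \<eta>)) \<xi> = ((if \<xi> = \<eta> then 1 else 0) + (if \<xi> = - \<eta> then 1 else 0)) / 2"
  "coeff (\<lambda>x. sin (x \<bullet> wv \<eta>)) \<xi> = ((if \<xi> = \<eta> then 1 else 0) - (if \<xi> = - \<eta> then 1 else 0)) / (2 * \<i>)"
  using coeff_mult_trig[OF one_Cinf_per, of \<eta> \<xi>] unfolding eq_neg_iff_add_eq_0 by (simp_all add: coeff_one)

lemma Cinf_per_sum:
  assumes "\<And>k. k \<in> K \<Longrightarrow> f k \<in> Cinf_per"
  shows "(\<lambda>x. \<Sum>k\<in>K. f k x) \<in> Cinf_per"
  using assms
proof (induction K rule: infinite_finite_induct)
  case (insert k K)
  then show ?case using Cinf_per_lincomb[of "f k" "\<lambda>x. \<Sum>k\<in>K. f k x" 1 1] by simp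
qed (auto simp: zero_Cinf_per)

lemma pairing_sum:
  assumes "\<And>k. k \<in> K \<Longrightarrow> f k \<in> Cinf_per"
  shows "pairing T (\<lambda>x. \<Sum>k\<in>K. f k x) = (\<Sum>k\<in>K. pairing T (f k))"
  using assms
proof (induction K rule: infinite_finite_induct)
  case (insert k K)
  then show ?case using pairing_lincomb[of "f k" "\<lambda>x. \<Sum>k\<in>K. f k x" T 1 1] by (simp add: Cinf_per_sum)
qed (use pairing_cmult[OF zero_Cinf_per, of T 0] in simp_all)

lemma coeff_sum:
  assumes "\<And>k. k \<in> K \<Longrightarrow> f k \<in> Cinf_per"
  shows "coeff (\<lambda>x. \<Sum>k\<in>K. f k x) \<xi> = (\<Sum>k\<in>K. coeff (f k) \<xi>)"
  using assms
proof (induction K rule: infinite_finite_induct)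
  case (insert k K)
  then show ?case using coeff_lincomb[of "f k" "\<lambda>x. \<Sum>k\<in>K. f k x" 1 1] by (simp add: Cinf_per_sum)
qed (use coeff_lincomb[OF zero_Cinf_per zero_Cinf_per, of 0 0] in simp_all)

lemma null_seq_lincomb:
  assumes "null_seq \<phi>" "null_seq \<psi>"
  shows "null_seq (\<lambda>m x. a * \<phi> m x + b * \<psi> m x)"
proof -
  have c: "\<phi> m \<in> Cinf_per" "\<psi> m \<in> Cinf_per" for m using assms by (auto simp: null_seq_def)
  have "uniform_limit UNIV (\<lambda>m x. a * partials js (\<phi> m) x + b * partials js (\<psi> m) x) (\<lambda>_. a * 0 + b * 0) sequentially" for js
    using assms by (intro uniform_limit_add bounded_linear.uniform_limit[OF bounded_linear_mult_right])
      (auto simp: null_seq_def)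
  then show ?thesis using c by (simp add: null_seq_def Cinf_per_lincomb partials_lincomb)
qed

lemma null_seq_zero: "null_seq (\<lambda>m x::real^'n::finite. 0)"
proof -
  have "partials js (\<lambda>x::real^'n. 0) = (\<lambda>x. 0)" for js :: "'n list"
    by (induction js) (auto simp: partial_def)
  then show ?thesis by (simp add: null_seq_def zero_Cinf_per uniform_limit_const)
qed

lemma null_seq_sum:
  assumes "\<And>k. k \<in> K \<Longrightarrow> null_seq (\<phi> k)"
  shows "null_seq (\<lambda>m x. \<Sum>k\<in>K. \<phi> k m x)"
  using assms
proof (induction K rule: infinite_finite_induct)
  case (insert k K)
  then show ?case using null_seq_lincomb[of "\<phi> k" "\<lambda>m x. \<Sum>k\<in>K. \<phi> k m x" 1 1] by simp
qed (auto simp: null_seq_zero)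

text \<open>
  The operator \<open>1 - \<Delta>\<close>; each application gains two powers of decay of the Fourier coefficients. The factors
  \<open>1\<close> and \<open>-1\<close> fit the linear combinations of \<open>Cinf_per_lincomb\<close>.
\<close>

definition bessel :: "(real^'n::finite \<Rightarrow> real) \<Rightarrow> real^'n \<Rightarrow> real"
  where "bessel f = (\<lambda>x. 1 * f x + (-1) * (\<Sum>j\<in>UNIV. partial j (partial j f) x))"

lemma bessel_Cinf_per: "f \<in> Cinf_per \<Longrightarrow> bessel f \<in> Cinf_per"
  unfolding bessel_def by (intro Cinf_per_lincomb Cinf_per_sum Cinf_per_partial)

lemma bessel_pow_Cinf_per: "f \<in> Cinf_per \<Longrightarrow> (bessel ^^ k) f \<in> Cinf_per"
  by (induction k) (auto intro: bessel_Cinf_per)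

lemma null_seq_bessel: "null_seq \<phi> \<Longrightarrow> null_seq (\<lambda>m. bessel (\<phi> m))"
  unfolding bessel_def by (intro null_seq_lincomb null_seq_sum null_seq_partial)

lemma null_seq_bessel_pow: "null_seq \<phi> \<Longrightarrow> null_seq (\<lambda>m. (bessel ^^ k) (\<phi> m))"
  by (induction k) (auto intro: null_seq_bessel)

text \<open>The square of the Japanese bracket, so the weight of \<open>H\<^sup>s\<close> is \<open>jb \<xi> powr (s / 2)\<close>.\<close>

definition jb :: "int^'n::finite \<Rightarrow> real"
  where "jb \<xi> = 1 + (norm (freq \<xi>))\<^sup>2"

lemma jb_ge_1 [simp]: "1 \<le> jb \<xi>" and jb_pos [simp]: "0 < jb \<xi>" and jb_nonneg [simp]: "0 \<le> jb \<xi>"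
  by (auto simp: jb_def add_pos_nonneg)

lemma jb_nonzero [simp]: "jb \<xi> \<noteq> 0"
  using jb_pos[of \<xi>] by linarith

lemma jb_le_wv: "jb \<xi> \<le> 1 + (norm (wv \<xi>))\<^sup>2"
proof -
  have "1 * (norm (freq \<xi>))\<^sup>2 \<le> (2 * pi)\<^sup>2 * (norm (freq \<xi>))\<^sup>2"
    by (intro mult_right_mono one_le_power) (use pi_gt3 in auto)
  then show ?thesis by (simp add: jb_def wv_def power_mult_distrib)
qed

lemma coeff_bessel:
  assumes f: "f \<in> Cinf_per"
  shows "coeff (bessel f) \<xi> = of_real (1 + (norm (wv \<xi>))\<^sup>2) * coeff f \<xi>"
proof -
  have "(norm (wv \<xi>))\<^sup>2 = (\<Sum>j\<in>UNIV. (wv \<xi> $ j) * (wv \<xi> $ j))"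
    by (simp add: power2_norm_eq_inner inner_vec_def)
  then show ?thesis unfolding bessel_def
    by (subst coeff_lincomb)
      (auto simp: f coeff_sum Cinf_per_sum Cinf_per_partial coeff_partial algebra_simps sum_distrib_left sum_negf[symmetric])
qed

lemma norm_coeff_le:
  fixes f :: "real^'n::finite \<Rightarrow> real"
  assumes f: "f \<in> Cinf_per" and B: "\<And>x. \<bar>f x\<bar> \<le> B"
  shows "cmod (coeff f \<xi>) \<le> B"
proof -
  let ?g = "\<lambda>x. exp (- 2 * pi * \<i> * complex_of_real (x \<bullet> freq \<xi>)) * complex_of_real (f x)"
  have "cmod (coeff f \<xi>) \<le> (LINT x|lborel. norm (indicat_real torus x *\<^sub>R ?g x))"
    unfolding fourier_of_fun[OF f] set_lebesgue_integral_def by (rule Bochner_Integration.integral_norm_bound)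
  also have "\<dots> \<le> (LINT x:(torus :: (real^'n) set)|lborel. B)"
    unfolding set_lebesgue_integral_def
  proof (rule Bochner_Integration.integral_mono)
    show "integrable lborel (\<lambda>x::real^'n. indicat_real torus x *\<^sub>R B)"
      using torus_lborel by (intro integrableI_bounded_set_indicator[where B = "\<bar>B\<bar>"]) auto
    have [measurable]: "f \<in> borel_measurable borel"
      using Cinf_per_continuous[OF f] by (rule borel_measurable_continuous_onI)
    show "integrable lborel (\<lambda>x. norm (indicat_real torus x *\<^sub>R ?g x))"
      using torus_lborel B by (intro integrable_norm integrableI_bounded_set_indicator[where B = B]) (auto simp: norm_mult)
    show "norm (indicat_real torus x *\<^sub>R ?g x) \<le> indicat_real torus x *\<^sub>R B" for x
      using B by (auto simp: norm_mult indicator_def)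
  qed
  also have "\<dots> = B" using tint_one[where 'n = 'n] by (simp add: set_lebesgue_integral_def)
  finally show ?thesis .
qed

lemma coeff_decay:
  assumes f: "f \<in> Cinf_per" and B: "\<And>x. \<bar>(bessel ^^ k) f x\<bar> \<le> B"
  shows "jb \<xi> ^ k * cmod (coeff f \<xi>) \<le> B"
proof -
  have "coeff ((bessel ^^ k) f) \<xi> = of_real ((1 + (norm (wv \<xi>))\<^sup>2) ^ k) * coeff f \<xi>"
    by (induction k) (auto simp: coeff_bessel bessel_pow_Cinf_per f algebra_simps)
  hence "(1 + (norm (wv \<xi>))\<^sup>2) ^ k * cmod (coeff f \<xi>) = cmod (coeff ((bessel ^^ k) f) \<xi>)"
    by (simp only: norm_mult norm_of_real) simp
  also have "\<dots> \<le> B" by (rule norm_coeff_le[OF bessel_pow_Cinf_per[OF f] B])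
  finally have "(1 + (norm (wv \<xi>))\<^sup>2) ^ k * cmod (coeff f \<xi>) \<le> B" .
  moreover have "jb \<xi> ^ k * cmod (coeff f \<xi>) \<le> (1 + (norm (wv \<xi>))\<^sup>2) ^ k * cmod (coeff f \<xi>)"
    by (intro mult_right_mono power_mono jb_le_wv) auto
  ultimately show ?thesis by linarith
qed

definition rapid :: "(int^'n::finite \<Rightarrow> complex) \<Rightarrow> bool"
  where "rapid c \<longleftrightarrow> (\<forall>k. \<exists>B. \<forall>\<xi>. jb \<xi> ^ k * cmod (c \<xi>) \<le> B)"

lemma rapid_coeff: "f \<in> Cinf_per \<Longrightarrow> rapid (coeff f)"
  unfolding rapid_def by (metis Cinf_per_bounded bessel_pow_Cinf_per coeff_decay)

section \<open>Trigonometric series\<close>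

definition freq_box :: "nat \<Rightarrow> (int^'n::finite) set"
  where "freq_box N = {\<xi>. \<forall>i. \<bar>\<xi> $ i\<bar> \<le> int N}"

lemma freq_box_image: "freq_box N = vec_lambda ` (UNIV \<rightarrow>\<^sub>E {- int N..int N})"
proof (rule set_eqI, rule iffI)
  fix \<xi> :: "int^'n" assume "\<xi> \<in> freq_box N"
  hence "($) \<xi> \<in> UNIV \<rightarrow>\<^sub>E {- int N..int N}" by (auto simp: freq_box_def PiE_UNIV_domain abs_le_iff minus_le_iff)
  then show "\<xi> \<in> vec_lambda ` (UNIV \<rightarrow>\<^sub>E {- int N..int N})"
    by (metis image_eqI vec_nth_inverse)
next
  fix \<xi> :: "int^'n" assume "\<xi> \<in> vec_lambda ` (UNIV \<rightarrow>\<^sub>E {- int N..int N})"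
  then obtain h where "h \<in> UNIV \<rightarrow>\<^sub>E {- int N..int N}" "\<xi> = vec_lambda h" by blast
  then show "\<xi> \<in> freq_box N" by (auto simp: freq_box_def PiE_UNIV_domain Pi_iff abs_le_iff minus_le_iff)
qed

lemma finite_freq_box [simp]: "finite (freq_box N)"
  unfolding freq_box_image by (intro finite_imageI finite_PiE) auto

lemma freq_box_mono: "M \<le> N \<Longrightarrow> freq_box M \<subseteq> freq_box N"
  by (auto simp: freq_box_def intro: order_trans)

lemma finite_subset_freq_box:
  fixes F :: "(int^'n::finite) set"
  assumes "finite F"
  shows "\<exists>N. F \<subseteq> freq_box N"
  using assms
proof (induction F rule: finite_induct)
  case (insert \<xi> F)
  then obtain N where N: "F \<subseteq> freq_box N" by blast
  define M where "M = nat (Max (range (\<lambda>i. \<bar>\<xi> $ i\<bar>)))"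
  have "\<bar>\<xi> $ i\<bar> \<le> int M" for i
  proof -
    have "\<bar>\<xi> $ i\<bar> \<le> Max (range (\<lambda>i. \<bar>\<xi> $ i\<bar>))" by (intro Max_ge) auto
    then show ?thesis unfolding M_def by linarith
  qed
  hence "\<xi> \<in> freq_box M" by (simp add: freq_box_def)
  hence "insert \<xi> F \<subseteq> freq_box (max N M)"
    using N freq_box_mono[of N "max N M"] freq_box_mono[of M "max N M"] by auto
  then show ?case by blast
qed simp

lemma filterlim_freq_box: "filterlim freq_box (finite_subsets_at_top UNIV) sequentially"
  unfolding filterlim_finite_subsets_at_top
  by (metis (mono_tags, lifting) eventually_sequentially finite_freq_box finite_subset_freq_box
      freq_box_mono order_trans subset_UNIV)

lemma has_sum_freq_box: "(f has_sum S) UNIV \<Longrightarrow> (\<lambda>N. sum f (freq_box N)) \<longlonglongrightarrow> S"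
  unfolding has_sum_def by (rule filterlim_compose[OF _ filterlim_freq_box])

lemma summable_inverse_square_int: "(\<lambda>m::int. 1 / (1 + (real_of_int m)\<^sup>2)) summable_on UNIV"
proof -
  let ?f = "\<lambda>m::int. 1 / (1 + (real_of_int m)\<^sup>2)"
  have s: "(\<lambda>n. 1 / (1 + (real n)\<^sup>2)) summable_on UNIV"
  proof (rule summable_nonneg_imp_summable_on)
    have "summable (\<lambda>n. 1 / (1 + (real n)\<^sup>2))"
    proof (rule summable_comparison_test_ev)
      show "\<forall>\<^sub>F n in sequentially. norm (1 / (1 + (real n)\<^sup>2)) \<le> inverse ((real n)\<^sup>2)"
        using eventually_gt_at_top[of 0] by eventually_elim (auto simp: inverse_eq_divide intro!: frac_le)
      show "summable (\<lambda>n. inverse ((real n)\<^sup>2))" by (rule inverse_power_summable) simp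
    qed
    then show "summable (\<lambda>n. 1 / (1 + (real n)\<^sup>2))" .
  qed auto
  have "?f summable_on range int" "?f summable_on range (\<lambda>n. - int n)"
    by (subst summable_on_reindex; use s in \<open>force simp: inj_on_def o_def\<close>)+
  hence "?f summable_on (range int \<union> range (\<lambda>n. - int n))"
    by (rule summable_on_union)
  moreover have "range int \<union> range (\<lambda>n. - int n) = UNIV"
    by (metis (mono_tags, lifting) UNIV_eq_I Un_iff int_cases2 rangeI)
  ultimately show ?thesis by simp
qed

lemma summable_jb: "(\<lambda>\<xi>::int^'n::finite. 1 / jb \<xi> ^ CARD('n)) summable_on UNIV"
proof -
  let ?f = "\<lambda>m::int. 1 / (1 + (real_of_int m)\<^sup>2)"
  let ?g = "\<lambda>\<xi>::int^'n. 1 / jb \<xi> ^ CARD('n)"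
  have le: "?g \<xi> \<le> (\<Prod>i\<in>UNIV. ?f (\<xi> $ i))" for \<xi>
  proof -
    have "(\<Prod>i\<in>UNIV. 1 + (real_of_int (\<xi> $ i))\<^sup>2) \<le> (\<Prod>i\<in>(UNIV::'n set). jb \<xi>)"
    proof (intro prod_mono conjI)
      fix i
      have "(real_of_int (\<xi> $ i))\<^sup>2 \<le> (norm (freq \<xi>))\<^sup>2"
        using component_le_norm_cart[of "freq \<xi>" i] by (simp add: freq_def abs_le_square_iff[symmetric])
      then show "1 + (real_of_int (\<xi> $ i))\<^sup>2 \<le> jb \<xi>" by (simp add: jb_def)
    qed simp
    moreover have "(\<Prod>i\<in>UNIV. 1 + (real_of_int (\<xi> $ i))\<^sup>2) > 0"
      by (intro prod_pos) (auto simp: add_pos_nonneg)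
    ultimately show ?thesis by (simp add: prod_dividef frac_le)
  qed
  define B where "B = infsum ?f UNIV"
  have part: "sum ?g F \<le> B ^ CARD('n)" if "finite F" for F
  proof -
    obtain N where N: "F \<subseteq> freq_box N" using finite_subset_freq_box[OF \<open>finite F\<close>] by blast
    have "sum ?g F \<le> sum ?g (freq_box N)" by (intro sum_mono2 N) auto
    also have "\<dots> \<le> (\<Sum>\<xi>\<in>(freq_box N :: (int^'n) set). \<Prod>i\<in>UNIV. ?f (\<xi> $ i))" by (intro sum_mono le)
    also have "\<dots> = (\<Sum>h\<in>(UNIV :: 'n set) \<rightarrow>\<^sub>E {- int N..int N}. \<Prod>i\<in>UNIV. ?f (h i))"
      unfolding freq_box_image by (subst sum.reindex) (auto simp: inj_on_def vec_lambda_inject)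
    also have "\<dots> = (\<Prod>i\<in>(UNIV::'n set). \<Sum>m\<in>{- int N..int N}. ?f m)"
      by (rule prod_sum_PiE[symmetric]) auto
    also have "\<dots> \<le> (\<Prod>i\<in>(UNIV::'n set). B)"
      unfolding B_def
      by (intro prod_mono conjI sum_nonneg finite_sum_le_infsum[OF summable_inverse_square_int]) auto
    finally show ?thesis by simp
  qed
  show ?thesis
    by (rule nonneg_bdd_above_summable_on)
      (use part in \<open>auto intro!: bdd_aboveI2[where M = "B ^ CARD('n)"]\<close>)
qed

lemma rapid_summable:
  assumes "rapid (c :: int^'n::finite \<Rightarrow> complex)"
  shows "(\<lambda>\<xi>. jb \<xi> ^ k * cmod (c \<xi>)) summable_on UNIV"
proof -
  obtain B where B: "\<And>\<xi>. jb \<xi> ^ (k + CARD('n)) * cmod (c \<xi>) \<le> B"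
    using assms unfolding rapid_def by blast
  have "(\<lambda>\<xi>. B * (1 / jb \<xi> ^ CARD('n))) summable_on (UNIV :: (int^'n) set)"
    by (intro summable_on_cmult_right summable_jb)
  then show ?thesis
  proof (rule summable_on_dominated(1))
    show "norm (jb \<xi> ^ k * cmod (c \<xi>)) \<le> B * (1 / jb \<xi> ^ CARD('n))" for \<xi>
      using B[of \<xi>] by (simp add: field_simps power_add abs_mult)
  qed
qed

lemma rapid_abs_summable: "rapid c \<Longrightarrow> (\<lambda>\<xi>. cmod (c \<xi>)) summable_on UNIV"
  using rapid_summable[of c 0] by simp

lemma abs_wv_le_jb: "\<bar>wv \<xi> $ j\<bar> \<le> 2 * pi * jb \<xi>"
proof -
  have "\<bar>freq \<xi> $ j\<bar> \<le> norm (freq \<xi>)" by (rule component_le_norm_cart)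
  also have "\<dots> \<le> jb \<xi>" 
  proof -
    have "0 \<le> (norm (freq \<xi>) - 1)\<^sup>2" by simp
    hence "2 * norm (freq \<xi>) \<le> 1 + (norm (freq \<xi>))\<^sup>2" by (simp add: power2_diff)
    then show ?thesis unfolding jb_def using norm_ge_zero[of "freq \<xi>"] by linarith
  qed
  finally show ?thesis by (simp add: wv_def abs_mult)
qed

lemma rapid_wv:
  assumes "rapid c"
  shows "rapid (\<lambda>\<xi>. \<i> * of_real (wv \<xi> $ j) * c \<xi>)"
  unfolding rapid_def
proof
  fix k
  obtain B where B: "\<And>\<xi>. jb \<xi> ^ Suc k * cmod (c \<xi>) \<le> B" using assms unfolding rapid_def by blast
  have "jb \<xi> ^ k * cmod (\<i> * of_real (wv \<xi> $ j) * c \<xi>) \<le> 2 * pi * B" for \<xi>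
  proof -
    have "jb \<xi> ^ k * cmod (\<i> * of_real (wv \<xi> $ j) * c \<xi>) = \<bar>wv \<xi> $ j\<bar> * (jb \<xi> ^ k * cmod (c \<xi>))"
      by (simp add: norm_mult)
    also have "\<dots> \<le> (2 * pi * jb \<xi>) * (jb \<xi> ^ k * cmod (c \<xi>))"
      by (intro mult_right_mono abs_wv_le_jb) auto
    also have "\<dots> = 2 * pi * (jb \<xi> ^ Suc k * cmod (c \<xi>))" by simp
    also have "\<dots> \<le> 2 * pi * B" by (intro mult_left_mono B) auto
    finally show ?thesis .
  qed
  then show "\<exists>B. \<forall>\<xi>. jb \<xi> ^ k * cmod (\<i> * of_real (wv \<xi> $ j) * c \<xi>) \<le> B" by blast
qed

definition syn_term :: "(int^'n::finite \<Rightarrow> complex) \<Rightarrow> int^'n \<Rightarrow> real^'n \<Rightarrow> real"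
  where "syn_term c \<xi> x = Re (c \<xi>) * cos (x \<bullet> wv \<xi>) + (- Im (c \<xi>)) * sin (x \<bullet> wv \<xi>)"

definition syn :: "(int^'n::finite \<Rightarrow> complex) \<Rightarrow> real^'n \<Rightarrow> real"
  where "syn c x = (\<Sum>\<^sub>\<infinity>\<xi>. syn_term c \<xi> x)"

lemma syn_term_cis: "syn_term c \<xi> x = Re (c \<xi> * cis (x \<bullet> wv \<xi>))"
  by (simp add: syn_term_def)

lemma norm_syn_term_le: "norm (syn_term c \<xi> x) \<le> cmod (c \<xi>)"
  using abs_Re_le_cmod[of "c \<xi> * cis (x \<bullet> wv \<xi>)"] unfolding norm_mult norm_cis syn_term_cis real_norm_def by simp

lemma syn_term_Cinf_per: "syn_term c \<xi> \<in> Cinf_per"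
  unfolding syn_term_def by (intro Cinf_per_lincomb trig_wv_Cinf_per)

definition tail :: "(int^'n::finite \<Rightarrow> complex) \<Rightarrow> nat \<Rightarrow> real"
  where "tail c N = (\<Sum>\<^sub>\<infinity>\<xi>. cmod (c \<xi>)) - (\<Sum>\<xi>\<in>freq_box N. cmod (c \<xi>))"

lemma tail_tendsto: "rapid c \<Longrightarrow> tail c \<longlonglongrightarrow> 0"
  unfolding tail_def
  using tendsto_diff[OF tendsto_const has_sum_freq_box[OF has_sum_infsum[OF rapid_abs_summable]],
      of c "\<Sum>\<^sub>\<infinity>\<xi>. cmod (c \<xi>)"] by simp

lemma dominated_tail:
  fixes f :: "int^'n::finite \<Rightarrow> 'b::banach"
  assumes c: "(\<lambda>\<xi>. cmod (c \<xi>)) summable_on UNIV" and f: "\<And>\<xi>. norm (f \<xi>) \<le> cmod (c \<xi>)"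
  shows "norm (infsum f UNIV - sum f (freq_box N)) \<le> tail c N"
proof -
  have fs: "f summable_on UNIV" by (rule summable_on_dominated(1)[OF c f])
  have c': "(\<lambda>\<xi>. cmod (c \<xi>)) summable_on - freq_box N" using c by (rule summable_on_subset) auto
  have split: "infsum g UNIV = sum g (freq_box N) + infsum g (- freq_box N)"
    if "g summable_on UNIV" for g :: "int^'n \<Rightarrow> 'd::banach"
    using infsum_Un_disjoint[of g "freq_box N" "- freq_box N"] summable_on_subset_banach[OF that, of "- freq_box N"] by simp
  have "norm (infsum f (- freq_box N)) \<le> infsum (\<lambda>\<xi>. cmod (c \<xi>)) (- freq_box N)"
    by (rule summable_on_dominated(2)[OF c' f])
  then show ?thesis by (simp add: split[OF fs] split[OF c] tail_def)
qed

lemma syn_approx: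
  "rapid c \<Longrightarrow> \<bar>syn c x - (\<Sum>\<xi>\<in>freq_box N. syn_term c \<xi> x)\<bar> \<le> tail c N"
  unfolding syn_def using dominated_tail[OF rapid_abs_summable norm_syn_term_le] by simp

lemma syn_limit:
  assumes "rapid c"
  shows "(\<lambda>N. \<Sum>\<xi>\<in>freq_box N. syn_term c \<xi> x) \<longlonglongrightarrow> syn c x"
  unfolding syn_def
  by (intro has_sum_freq_box has_sum_infsum summable_on_dominated(1)[OF rapid_abs_summable[OF assms]] norm_syn_term_le)

lemma partial_syn_term: "partial j (syn_term c \<xi>) x = syn_term (\<lambda>\<xi>. \<i> * of_real (wv \<xi> $ j) * c \<xi>) \<xi> x"
proof -
  have "partial j (syn_term c \<xi>) x = Re (c \<xi>) * partial j (\<lambda>x. cos (x \<bullet> wv \<xi>)) x + (- Im (c \<xi>)) * partial j (\<lambda>x. sin (x \<bullet> wv \<xi>)) x"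
    unfolding syn_term_def by (intro partial_lincomb Cinf_per_differentiable0 trig_wv_Cinf_per)
  also have "\<dots> = syn_term (\<lambda>\<xi>. \<i> * of_real (wv \<xi> $ j) * c \<xi>) \<xi> x"
    by (simp add: partial_trig syn_term_def algebra_simps)
  finally show ?thesis .
qed

lemma Cinf_per_has_derivative:
  assumes "f \<in> Cinf_per"
  shows "(f has_derivative (\<lambda>h. \<Sum>j\<in>UNIV. h $ j * partial j f x)) (at x)"
proof -
  let ?D = "frechet_derivative f (at x)"
  have D: "(f has_derivative ?D) (at x)"
    using Cinf_per_differentiable0[OF assms] frechet_derivative_works by blast
  have "?D h = (\<Sum>j\<in>UNIV. h $ j * partial j f x)" for h
  proof -
    have "?D h = ?D (\<Sum>j\<in>UNIV. h $ j *\<^sub>R axis j 1)"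
      using basis_expansion[of h] by (simp add: scalar_mult_eq_scaleR)
    also have "\<dots> = (\<Sum>j\<in>UNIV. h $ j * partial j f x)"
      by (subst linear_sum[OF has_derivative_linear[OF D]])
        (simp add: linear_scale[OF has_derivative_linear[OF D]] partial_def)
    finally show ?thesis .
  qed
  hence "?D = (\<lambda>h. \<Sum>j\<in>UNIV. h $ j * partial j f x)" by (rule ext)
  with D show ?thesis by simp
qed

lemma partial_syn_sum:
  "partial j (\<lambda>x. \<Sum>\<xi>\<in>F. syn_term c \<xi> x) =
    (\<lambda>x. \<Sum>\<xi>\<in>F. syn_term (\<lambda>\<xi>. \<i> * of_real (wv \<xi> $ j) * c \<xi>) \<xi> x)"
proof
  fix x
  have "((\<lambda>x. \<Sum>\<xi>\<in>F. syn_term c \<xi> x) has_derivative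
      (\<lambda>h. \<Sum>\<xi>\<in>F. frechet_derivative (syn_term c \<xi>) (at x) h)) (at x)"
    by (intro has_derivative_sum)
      (use Cinf_per_differentiable0[OF syn_term_Cinf_per] frechet_derivative_works in blast)
  from partial_eqI[OF this, of j]
  show "partial j (\<lambda>x. \<Sum>\<xi>\<in>F. syn_term c \<xi> x) x =
      (\<Sum>\<xi>\<in>F. syn_term (\<lambda>\<xi>. \<i> * of_real (wv \<xi> $ j) * c \<xi>) \<xi> x)"
    by (simp add: partial_def[symmetric, THEN fun_cong] partial_syn_term)
qed

lemma syn_has_derivative:
  fixes c :: "int^'n::finite \<Rightarrow> complex"
  assumes c: "rapid c"
  shows "(syn c has_derivative (\<lambda>h. \<Sum>j\<in>UNIV. h $ j * syn (\<lambda>\<xi>. \<i> * of_real (wv \<xi> $ j) * c \<xi>) x)) (at x)"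
proof -
  let ?c = "\<lambda>j \<xi>. \<i> * of_real (wv \<xi> $ j) * c \<xi>"
  let ?S = "\<lambda>c N x. \<Sum>\<xi>\<in>freq_box N. syn_term c \<xi> x"
  have SC: "?S c N \<in> Cinf_per" for N by (intro Cinf_per_sum syn_term_Cinf_per)
  have "\<exists>g. \<forall>x\<in>UNIV. (\<lambda>N. ?S c N x) \<longlonglongrightarrow> g x \<and>
      (g has_derivative (\<lambda>h. \<Sum>j\<in>UNIV. h $ j * syn (?c j) x)) (at x within UNIV)"
  proof (rule has_derivative_sequence[where f' = "\<lambda>N x h. \<Sum>j\<in>UNIV. h $ j * ?S (?c j) N x" and ?x0.0 = 0])
    show "(?S c N has_derivative (\<lambda>h. \<Sum>j\<in>UNIV. h $ j * ?S (?c j) N x)) (at x within UNIV)" for N x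
      using Cinf_per_has_derivative[OF SC, of N x] unfolding partial_syn_sum by simp
    show "(\<lambda>N. ?S c N 0) \<longlonglongrightarrow> syn c 0" by (rule syn_limit[OF c])
    fix e :: real assume e: "e > 0"
    have "(\<lambda>N. \<Sum>j\<in>UNIV. tail (?c j) N) \<longlonglongrightarrow> (\<Sum>j\<in>(UNIV::'n set). 0)"
      by (intro tendsto_sum tail_tendsto rapid_wv c)
    hence "\<forall>\<^sub>F N in sequentially. (\<Sum>j\<in>UNIV. tail (?c j) N) < e"
      using e by (intro order_tendstoD) auto
    then show "\<forall>\<^sub>F N in sequentially. \<forall>x\<in>UNIV. \<forall>h. norm ((\<Sum>j\<in>UNIV. h $ j * ?S (?c j) N x) - (\<Sum>j\<in>UNIV. h $ j * syn (?c j) x)) \<le> e * norm h"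
    proof (eventually_elim, intro ballI allI)
      fix N x and h :: "real^'n" assume t: "(\<Sum>j\<in>UNIV. tail (?c j) N) < e"
      have "norm ((\<Sum>j\<in>UNIV. h $ j * ?S (?c j) N x) - (\<Sum>j\<in>UNIV. h $ j * syn (?c j) x))
          = norm (\<Sum>j\<in>UNIV. h $ j * (?S (?c j) N x - syn (?c j) x))"
        by (simp add: sum_subtractf right_diff_distrib)
      also have "\<dots> \<le> (\<Sum>j\<in>UNIV. norm h * tail (?c j) N)"
      proof (rule sum_norm_le)
        fix j
        have "norm (h $ j * (?S (?c j) N x - syn (?c j) x)) = \<bar>h $ j\<bar> * \<bar>syn (?c j) x - ?S (?c j) N x\<bar>"
          by (simp add: abs_mult abs_minus_commute)
        also have "\<dots> \<le> norm h * tail (?c j) N"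
          by (intro mult_mono component_le_norm_cart syn_approx rapid_wv c) auto
        finally show "norm (h $ j * (?S (?c j) N x - syn (?c j) x)) \<le> norm h * tail (?c j) N" .
      qed
      also have "\<dots> = norm h * (\<Sum>j\<in>UNIV. tail (?c j) N)" by (simp only: sum_distrib_left)
      also have "\<dots> \<le> norm h * e" by (rule mult_left_mono[OF less_imp_le[OF t] norm_ge_zero])
      also have "\<dots> = e * norm h" by simp
      finally show "norm ((\<Sum>j\<in>UNIV. h $ j * ?S (?c j) N x) - (\<Sum>j\<in>UNIV. h $ j * syn (?c j) x)) \<le> e * norm h" .
    qed
  qed auto
  then obtain g where g: "\<And>x. (\<lambda>N. ?S c N x) \<longlonglongrightarrow> g x"
      "\<And>x. (g has_derivative (\<lambda>h. \<Sum>j\<in>UNIV. h $ j * syn (?c j) x)) (at x)" by auto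
  have "g = syn c" using LIMSEQ_unique[OF g(1) syn_limit[OF c]] by blast
  with g(2) show ?thesis by simp
qed

lemma sum_axis: "(\<Sum>k\<in>UNIV. axis j 1 $ k * g k) = (g j :: real)"
  using inner_axis'[of j 1 "vec_lambda g"] by (simp add: inner_vec_def)

lemma partial_syn:
  assumes "rapid c"
  shows "partial j (syn c) = syn (\<lambda>\<xi>. \<i> * of_real (wv \<xi> $ j) * c \<xi>)"
proof
  show "partial j (syn c) x = syn (\<lambda>\<xi>. \<i> * of_real (wv \<xi> $ j) * c \<xi>) x" for x
    unfolding partial_eqI[OF syn_has_derivative[OF assms, of x], of j] by (rule sum_axis)
qed

lemma partials_syn:
  assumes "rapid c"
  shows "\<exists>c'. rapid c' \<and> partials js (syn c) = syn c' \<and>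
    (\<forall>F. partials js (\<lambda>x. \<Sum>\<xi>\<in>F. syn_term c \<xi> x) = (\<lambda>x. \<Sum>\<xi>\<in>F. syn_term c' \<xi> x))"
  using assms
proof (induction js)
  case (Cons j js)
  then obtain c' where "rapid c'" "partials js (syn c) = syn c'"
    "\<And>F. partials js (\<lambda>x. \<Sum>\<xi>\<in>F. syn_term c \<xi> x) = (\<lambda>x. \<Sum>\<xi>\<in>F. syn_term c' \<xi> x)" by blast
  then show ?case using partial_syn[of c' j] rapid_wv[of c' j] by (auto simp: partial_syn_sum)
qed auto

lemma syn_Cinf_per:
  assumes c: "rapid c"
  shows "syn c \<in> Cinf_per"
proof -
  have "partials js (syn c) differentiable (at x)" for js x
  proof -
    obtain c' where "rapid c'" "partials js (syn c) = syn c'" using partials_syn[OF c] by blast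
    then show ?thesis using syn_has_derivative[of c' x] by (auto intro: differentiableI)
  qed
  moreover have "syn c (x + axis j 1) = syn c x" for j x
    unfolding syn_def by (simp only: Cinf_per_period[OF syn_term_Cinf_per])
  ultimately show ?thesis by (simp add: Cinf_per_def)
qed

lemma inner_complex_expand: "(z :: complex) \<bullet> w = Re z * Re w + Im z * Im w"
  by (simp add: inner_complex_def)

lemma cmod_inner_le: "norm ((z :: complex) \<bullet> w) \<le> cmod z * cmod w"
  using Cauchy_Schwarz_ineq2[of z w] by simp

lemma pairing_syn_term:
  "pairing T (syn_term c \<xi>) = c \<xi> \<bullet> fourier T \<xi>"
  unfolding syn_term_def pairing_lincomb[OF trig_wv_Cinf_per]
  by (simp add: fourier_wv inner_complex_expand)

lemma tint_bound:
  fixes f :: "real^'n::finite \<Rightarrow> real"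
  assumes "f \<in> Cinf_per" "\<And>x. \<bar>f x\<bar> \<le> B"
  shows "\<bar>tint f\<bar> \<le> B"
  using norm_coeff_le[OF assms, of 0] by (simp add: coeff_tint assms set_lebesgue_integral_def cmod_def)

lemma tint_syn_mult:
  fixes c :: "int^'n::finite \<Rightarrow> complex"
  assumes c: "rapid c" and \<phi>: "\<phi> \<in> Cinf_per"
  shows "((\<lambda>\<xi>. c \<xi> \<bullet> coeff \<phi> \<xi>) has_sum tint (\<lambda>x. syn c x * \<phi> x)) UNIV"
proof -
  let ?S = "\<lambda>N x. \<Sum>\<xi>\<in>freq_box N. syn_term c \<xi> x"
  obtain B where B: "B > 0" "\<And>x. \<bar>\<phi> x\<bar> \<le> B" using Cinf_per_bounded[OF \<phi>] by blast
  have SC: "?S N \<in> Cinf_per" for N by (intro Cinf_per_sum syn_term_Cinf_per)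
  have s: "(\<lambda>\<xi>. c \<xi> \<bullet> coeff \<phi> \<xi>) summable_on UNIV"
  proof (rule summable_on_dominated(1))
    show "(\<lambda>\<xi>. cmod (c \<xi>) * B) summable_on UNIV" by (intro summable_on_cmult_left rapid_abs_summable c)
    show "norm (c \<xi> \<bullet> coeff \<phi> \<xi>) \<le> cmod (c \<xi>) * B" for \<xi>
      by (rule order_trans[OF cmod_inner_le]) (intro mult_left_mono norm_coeff_le[OF \<phi> B(2)] norm_ge_zero)
  qed
  have part: "(\<Sum>\<xi>\<in>freq_box N. c \<xi> \<bullet> coeff \<phi> \<xi>) = tint (\<lambda>x. ?S N x * \<phi> x)" for N
  proof -
    have "tint (\<lambda>x. ?S N x * \<phi> x) = pairing (of_fun \<phi>) (?S N)"
      by (simp add: pairing_of_fun \<phi> SC mult.commute)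
    also have "\<dots> = (\<Sum>\<xi>\<in>freq_box N. c \<xi> \<bullet> coeff \<phi> \<xi>)"
      by (simp add: pairing_sum syn_term_Cinf_per pairing_syn_term)
    finally show ?thesis by simp
  qed
  have diff: "norm (tint (\<lambda>x. ?S N x * \<phi> x) - tint (\<lambda>x. syn c x * \<phi> x)) \<le> tail c N * B" for N
  proof -
    have "tint (\<lambda>x. ?S N x * \<phi> x) - tint (\<lambda>x. syn c x * \<phi> x) = tint (\<lambda>x. 1 * (?S N x * \<phi> x) + (-1) * (syn c x * \<phi> x))"
      by (subst tint_lincomb) (auto intro!: Cinf_per_mult SC syn_Cinf_per c \<phi>)
    moreover have "\<bar>tint (\<lambda>x. 1 * (?S N x * \<phi> x) + (-1) * (syn c x * \<phi> x))\<bar> \<le> tail c N * B"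
    proof (rule tint_bound)
      show "(\<lambda>x. 1 * (?S N x * \<phi> x) + - 1 * (syn c x * \<phi> x)) \<in> Cinf_per"
        by (intro Cinf_per_lincomb Cinf_per_mult SC syn_Cinf_per c \<phi>)
      fix x
      have "\<bar>1 * (?S N x * \<phi> x) + - 1 * (syn c x * \<phi> x)\<bar> = \<bar>syn c x - ?S N x\<bar> * \<bar>\<phi> x\<bar>"
        by (simp add: abs_mult[symmetric] algebra_simps abs_minus_commute)
      also have "\<dots> \<le> tail c N * B"
        by (intro mult_mono syn_approx c B order_trans[OF abs_ge_zero syn_approx[OF c, of x]]) auto
      finally show "\<bar>1 * (?S N x * \<phi> x) + - 1 * (syn c x * \<phi> x)\<bar> \<le> tail c N * B" .
    qed
    ultimately show ?thesis by simp
  qed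
  have "(\<lambda>N. tail c N * B) \<longlonglongrightarrow> 0" using tendsto_mult_left_zero[OF tail_tendsto[OF c]] .
  hence "(\<lambda>N. tint (\<lambda>x. ?S N x * \<phi> x) - tint (\<lambda>x. syn c x * \<phi> x)) \<longlonglongrightarrow> 0"
    by (rule Lim_null_comparison[rotated]) (simp add: diff[unfolded real_norm_def])
  hence "(\<lambda>N. \<Sum>\<xi>\<in>freq_box N. c \<xi> \<bullet> coeff \<phi> \<xi>) \<longlonglongrightarrow> tint (\<lambda>x. syn c x * \<phi> x)"
    unfolding part by (rule LIM_zero_cancel)
  from LIMSEQ_unique[OF this has_sum_freq_box[OF has_sum_infsum[OF s]]] s show ?thesis
    by (simp add: has_sum_iff)
qed

lemma has_sum_single: "((\<lambda>\<eta>. if \<eta> = \<xi> then a else 0) has_sum (a::real)) UNIV"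
  by (rule has_sum_finite_neutralI[where B = "{\<xi>}"]) auto

lemma has_sum_coeff_trig:
  assumes "\<And>\<xi>. c (- \<xi>) = cnj (c \<xi>)"
  shows "((\<lambda>\<eta>. c \<eta> \<bullet> coeff (\<lambda>x. cos (x \<bullet> wv \<xi>)) \<eta>) has_sum Re (c \<xi>)) UNIV"
    and "((\<lambda>\<eta>. c \<eta> \<bullet> coeff (\<lambda>x. sin (x \<bullet> wv \<xi>)) \<eta>) has_sum (- Im (c \<xi>))) UNIV"
proof -
  have h: "c \<eta> \<bullet> (((if P then 1 else 0) + (if Q then 1 else 0)) / 2) =
      (if P then Re (c \<eta>) / 2 else 0) + (if Q then Re (c \<eta>) / 2 else 0)"
    "c \<eta> \<bullet> (((if P then 1 else 0) - (if Q then 1 else 0)) / (2 * \<i>)) =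
      (if P then - Im (c \<eta>) / 2 else 0) + (if Q then Im (c \<eta>) / 2 else 0)" for \<eta> P Q
    by (cases P; cases Q; simp add: inner_complex_expand)+
  have h': "(if \<eta> = \<xi> then Re (c \<eta>) / 2 else 0) = (if \<eta> = \<xi> then Re (c \<xi>) / 2 else 0)"
    "(if \<eta> = - \<xi> then Re (c \<eta>) / 2 else 0) = (if \<eta> = - \<xi> then Re (c \<xi>) / 2 else 0)"
    "(if \<eta> = \<xi> then - Im (c \<eta>) / 2 else 0) = (if \<eta> = \<xi> then - Im (c \<xi>) / 2 else 0)"
    "(if \<eta> = - \<xi> then Im (c \<eta>) / 2 else 0) = (if \<eta> = - \<xi> then - Im (c \<xi>) / 2 else 0)" for \<eta>
    by (rule if_cong; simp add: assms)+
  show "((\<lambda>\<eta>. c \<eta> \<bullet> coeff (\<lambda>x. cos (x \<bullet> wv \<xi>)) \<eta>) has_sum Re (c \<xi>)) UNIV"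
    using has_sum_add[OF has_sum_single[of \<xi> "Re (c \<xi>) / 2"] has_sum_single[of "- \<xi>" "Re (c \<xi>) / 2"]]
    unfolding coeff_trig h h' by (simp only: field_sum_of_halves)
  show "((\<lambda>\<eta>. c \<eta> \<bullet> coeff (\<lambda>x. sin (x \<bullet> wv \<xi>)) \<eta>) has_sum (- Im (c \<xi>))) UNIV"
    using has_sum_add[OF has_sum_single[of \<xi> "- Im (c \<xi>) / 2"] has_sum_single[of "- \<xi>" "- Im (c \<xi>) / 2"]]
    unfolding coeff_trig h h' by (simp only: field_sum_of_halves)
qed

lemma coeff_syn:
  assumes c: "rapid c" and sym: "\<And>\<xi>. c (- \<xi>) = cnj (c \<xi>)"
  shows "coeff (syn c) \<xi> = c \<xi>"
  using has_sum_unique[OF tint_syn_mult[OF c trig_wv_Cinf_per(1)] has_sum_coeff_trig(1)[of c, OF sym], of \<xi>]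
    has_sum_unique[OF tint_syn_mult[OF c trig_wv_Cinf_per(2)] has_sum_coeff_trig(2)[of c, OF sym], of \<xi>]
  by (simp add: coeff_tint syn_Cinf_per c complex_eq_iff)

subsection \<open>Uniqueness of Fourier coefficients\<close>

definition peak :: "real^'n::finite \<Rightarrow> real^'n \<Rightarrow> real"
  where "peak y x = (\<Prod>i\<in>UNIV. (1 + cos (2 * pi * (x $ i - y $ i))) / 2)"

lemma half_one_plus_cos: "0 \<le> (1 + cos t) / 2" "(1 + cos t) / 2 \<le> (1::real)"
  using cos_ge_minus_one[of t] cos_le_one[of t] by (simp_all only: zero_le_divide_iff divide_le_eq_1) linarith+

lemma peak_bounds: "0 \<le> peak y x" "peak y x \<le> 1"
  unfolding peak_def by (intro prod_nonneg prod_le_1 conjI half_one_plus_cos)+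

lemma peak_self: "peak y y = 1"
  by (simp add: peak_def)

lemma Cinf_per_translate_lattice:
  assumes f: "f \<in> Cinf_per" and "\<And>i. x $ i - y $ i \<in> \<int>"
  shows "f x = f y"
proof -
  have "\<exists>m. x $ i - y $ i = of_int m" for i using assms(2)[of i] by (rule Ints_cases) blast
  then obtain m where m: "\<And>i. x $ i - y $ i = of_int (m i)" using choice[of "\<lambda>i m. x $ i - y $ i = of_int m"] by blast
  have "f (y + (\<Sum>i\<in>S. of_int (m i) *\<^sub>R axis i 1)) = f y" if "finite S" for S
    using that
  proof (induction S)
    case (insert i S)
    have "y + (\<Sum>i\<in>insert i S. of_int (m i) *\<^sub>R axis i 1) = (y + (\<Sum>i\<in>S. of_int (m i) *\<^sub>R axis i 1)) + of_int (m i) *\<^sub>R axis i 1"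
      using insert by (simp add: algebra_simps)
    then show ?case using insert.IH by (simp only: Cinf_per_translate_int[OF f])
  qed simp
  from this[OF finite_class.finite_UNIV]
  have "f (y + (\<Sum>i\<in>UNIV. of_int (m i) *\<^sub>R axis i 1)) = f y" .
  moreover have "y + (\<Sum>i\<in>UNIV. of_int (m i) *\<^sub>R axis i 1) = x"
  proof -
    have "(\<Sum>i\<in>UNIV. of_int (m i) *\<^sub>R axis i 1) = (\<Sum>i\<in>UNIV. (x - y) $ i *s axis i 1)"
      by (simp add: m scalar_mult_eq_scaleR)
    also have "\<dots> = x - y" by (rule basis_expansion)
    finally show ?thesis by simp
  qed
  ultimately show ?thesis by simp
qed

lemma peak_eq_1:
  assumes "f \<in> Cinf_per" "peak y x = 1"
  shows "f x = f y"
proof (rule Cinf_per_translate_lattice[OF assms(1)])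
  fix i
  let ?c = "\<lambda>i. (1 + cos (2 * pi * (x $ i - y $ i))) / 2"
  have c: "0 \<le> ?c i" "?c i \<le> 1" for i by (rule half_one_plus_cos)+
  have "peak y x = ?c i * (\<Prod>i\<in>UNIV - {i}. ?c i)" unfolding peak_def by (rule prod.remove) auto
  also have "\<dots> \<le> ?c i * 1" by (intro mult_left_mono prod_le_1 conjI c)
  finally have "1 \<le> cos (2 * pi * (x $ i - y $ i))" using assms(2) by simp
  hence "cos (2 * pi * (x $ i - y $ i)) = 1" by (intro antisym cos_le_one)
  then obtain n where "2 * pi * (x $ i - y $ i) = of_int n * 2 * pi" using cos_one_2pi_int by blast
  hence "x $ i - y $ i = of_int n" by simp
  then show "x $ i - y $ i \<in> \<int>" by simp
qed

definition coeff_null :: "(real^'n::finite \<Rightarrow> real) set"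
  where "coeff_null = {f \<in> Cinf_per. \<forall>\<xi>. coeff f \<xi> = 0}"

lemma coeff_null_lincomb: "f \<in> coeff_null \<Longrightarrow> g \<in> coeff_null \<Longrightarrow> (\<lambda>x. a * f x + b * g x) \<in> coeff_null"
  by (simp add: coeff_null_def Cinf_per_lincomb coeff_lincomb)

lemma coeff_null_trig:
  "f \<in> coeff_null \<Longrightarrow> (\<lambda>x. f x * cos (x \<bullet> wv \<eta>)) \<in> coeff_null"
  "f \<in> coeff_null \<Longrightarrow> (\<lambda>x. f x * sin (x \<bullet> wv \<eta>)) \<in> coeff_null"
  by (auto simp: coeff_null_def coeff_mult_trig intro!: Cinf_per_mult trig_wv_Cinf_per)

lemma coeff_null_peak:
  fixes y :: "real^'n::finite"
  assumes f: "f \<in> coeff_null"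
  shows "(\<lambda>x. f x * peak y x) \<in> coeff_null"
proof -
  let ?c = "\<lambda>i x. (1 + cos (2 * pi * (x $ i - y $ i))) / 2"
  have one: "(\<lambda>x. f x * ?c i x) \<in> coeff_null" if f: "f \<in> coeff_null" for f i
  proof -
    let ?e = "axis i 1 :: int^'n"
    have w: "x \<bullet> wv ?e = 2 * pi * x $ i" for x :: "real^'n"
    proof -
      have "freq ?e = axis i 1" by (simp add: freq_def axis_def vec_eq_iff)
      then show ?thesis by (simp add: wv_def inner_axis)
    qed
    have "(\<lambda>x. (1/2) * f x + 1 * ((cos (2 * pi * y $ i) / 2) * (f x * cos (x \<bullet> wv ?e)) +
        (sin (2 * pi * y $ i) / 2) * (f x * sin (x \<bullet> wv ?e)))) \<in> coeff_null"
      by (intro coeff_null_lincomb coeff_null_trig f)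
    also have "(\<lambda>x. (1/2) * f x + 1 * ((cos (2 * pi * y $ i) / 2) * (f x * cos (x \<bullet> wv ?e)) +
        (sin (2 * pi * y $ i) / 2) * (f x * sin (x \<bullet> wv ?e)))) = (\<lambda>x. f x * ?c i x)"
      unfolding w right_diff_distrib cos_diff by (rule ext) (simp add: field_simps)
    finally show ?thesis .
  qed
  have "(\<lambda>x. f x * (\<Prod>i\<in>S. ?c i x)) \<in> coeff_null" if "finite S" for S
    using that
  proof (induction S)
    case (insert i S)
    from one[OF insert.IH, of i] insert.hyps show ?case by (simp add: mult.assoc mult.left_commute mult.commute)
  qed (simp add: f)
  then show ?thesis unfolding peak_def by simp
qed

lemma coeff_null_peak_power:
  assumes f: "f \<in> coeff_null"
  shows "(\<lambda>x. f x * peak y x ^ k) \<in> coeff_null"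
proof (induction k)
  case (Suc k)
  from coeff_null_peak[OF this, of y] show ?case by (simp add: mult.assoc mult.commute mult.left_commute)
qed (simp add: f)

lemma continuous_on_peak: "continuous_on S (peak y)"
  unfolding peak_def by (intro continuous_intros) auto

text \<open>
  A positive value of \<open>f\<close> at \<open>y\<close> would be detected by integrating against a high power of the
  trigonometric polynomial \<open>peak y\<close>, which concentrates at \<open>y\<close>.
\<close>

lemma coeff_null_nonpos:
  fixes f :: "real^'n::finite \<Rightarrow> real"
  assumes f: "f \<in> coeff_null" and y: "y \<in> torus"
  shows "f y \<le> 0"
proof (rule ccontr)
  assume "\<not> f y \<le> 0"
  define e where "e = f y / 2"
  have e: "e > 0" "e < f y" using \<open>\<not> f y \<le> 0\<close> by (auto simp: e_def)
  have fC: "f \<in> Cinf_per" using f by (simp add: coeff_null_def)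
  obtain B where B: "B > 0" "\<And>x. \<bar>f x\<bar> \<le> B" using Cinf_per_bounded[OF fC] by blast
  define W where "W = cbox (0::real^'n) (\<chi> i. 1) \<inter> {x. f x \<le> e}"
  have W: "compact W" unfolding W_def
    by (intro compact_Int_closed compact_cbox closed_Collect_le Cinf_per_continuous fC continuous_intros)
  obtain r where r: "0 \<le> r" "r < 1" "\<And>x. x \<in> W \<Longrightarrow> peak y x \<le> r"
  proof (cases "W = {}")
    case True
    then show ?thesis using that[of 0] by auto
  next
    case False
    obtain z where z: "z \<in> W" "\<And>x. x \<in> W \<Longrightarrow> peak y x \<le> peak y z"
      using continuous_attains_sup[OF W False continuous_on_peak] by blast
    have "peak y z \<noteq> 1"
    proof
      assume "peak y z = 1"
      hence "f z = f y" by (rule peak_eq_1[OF fC])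
      then show False using z(1) e by (auto simp: W_def)
    qed
    then show ?thesis using that[of "peak y z"] z peak_bounds[of y z] by auto
  qed
  define q where "q = (1 + r) / 2"
  have q: "r < q" "q < 1" "0 < q" using r by (auto simp: q_def)
  have "\<forall>\<^sub>F x in at y. e < f x \<and> q < peak y x"
  proof (intro eventually_conj)
    have "isCont f y" "isCont (peak y) y"
      using Cinf_per_continuous[OF fC, of UNIV] continuous_on_peak[of UNIV y]
      by (auto simp: continuous_on_eq_continuous_at)
    then show "\<forall>\<^sub>F x in at y. e < f x" "\<forall>\<^sub>F x in at y. q < peak y x"
      using e q by (auto simp: isCont_def peak_self intro: order_tendstoD)
  qed
  then obtain d where d: "d > 0" "\<And>x. dist x y < d \<Longrightarrow> e < f x \<and> q < peak y x"
    using e q peak_self[of y] unfolding eventually_at by (metis UNIV_I)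
  define u where "u = (\<chi> i. min 1 (min (y $ i + d / (2 * CARD('n))) ((y $ i + 1) / 2)))"
  define Q where "Q = box y u"
  have yi: "0 \<le> y $ i" "y $ i < 1" for i using y by (auto simp: torus_def)
  have yu: "y $ i < u $ i" for i using yi[of i] d(1) by (auto simp: u_def)
  have Qt: "Q \<subseteq> torus"
    using yi by (auto simp: Q_def mem_box_cart torus_def u_def intro: order_trans less_imp_le) (metis less_imp_le order_trans)
  have Qd: "e < f x \<and> q < peak y x" if "x \<in> Q" for x
  proof (rule d(2))
    have "dist x y \<le> (\<Sum>i\<in>UNIV. \<bar>(x - y) $ i\<bar>)" unfolding dist_norm by (rule norm_le_l1_cart)
    also have "\<dots> \<le> (\<Sum>i\<in>(UNIV :: 'n set). d / (2 * CARD('n)))"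
    proof (rule sum_mono)
      fix i
      have "y $ i < x $ i" "x $ i < u $ i" using that by (auto simp: Q_def mem_box_cart)
      then show "\<bar>(x - y) $ i\<bar> \<le> d / (2 * CARD('n))" by (simp add: u_def)
    qed
    also have "\<dots> = d / 2" by simp
    also have "\<dots> < d" using d by simp
    finally show "dist x y < d" .
  qed
  define \<mu> where "\<mu> = measure lborel Q"
  have \<mu>: "\<mu> > 0"
  proof -
    show ?thesis unfolding \<mu>_def Q_def using yu
      by (subst measure_lborel_box_eq) (auto simp: Basis_vec_def inner_axis less_imp_le intro!: prod_pos)
  qed
  have Qm: "Q \<in> sets lborel" "emeasure lborel Q < \<infinity>" using emeasure_lborel_box_finite[of y u] by (simp_all add: Q_def)
  have bound: "e * \<mu> * q ^ k \<le> B * r ^ k" for k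
  proof -
    have 0: "tint (\<lambda>x. f x * peak y x ^ k) = 0"
    proof -
      have "(\<lambda>x. f x * peak y x ^ k) \<in> coeff_null" by (rule coeff_null_peak_power[OF f])
      hence "Re (coeff (\<lambda>x. f x * peak y x ^ k) 0) = 0" "(\<lambda>x. f x * peak y x ^ k) \<in> Cinf_per"
        by (auto simp: coeff_null_def)
      then show ?thesis by (simp add: coeff_tint)
    qed
    have int: "integrable lborel (\<lambda>x. indicator torus x *\<^sub>R (f x * peak y x ^ k))"
      using Cinf_per_integrable[of "\<lambda>x. f x * peak y x ^ k"] coeff_null_peak_power[OF f, of y k]
      by (auto simp: set_integrable_def coeff_null_def)
    have "e * q ^ k * \<mu> - B * r ^ k = (LINT x|lborel. indicator Q x *\<^sub>R (e * q ^ k)) - (LINT x|lborel. indicator (torus :: (real^'n) set) x *\<^sub>R (B * r ^ k))"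
      using Qm by (simp add: \<mu>_def measure_torus torus_lborel(1))
    also have "\<dots> = (LINT x|lborel. indicator Q x *\<^sub>R (e * q ^ k) - indicator torus x *\<^sub>R (B * r ^ k))"
      using Qm torus_lborel by (intro Bochner_Integration.integral_diff[symmetric]) auto
    also have "\<dots> \<le> (LINT x|lborel. indicator torus x *\<^sub>R (f x * peak y x ^ k))"
    proof (rule Bochner_Integration.integral_mono)
      show "integrable lborel (\<lambda>x. indicator Q x *\<^sub>R (e * q ^ k) - indicator torus x *\<^sub>R (B * r ^ k))"
        using Qm torus_lborel by (intro Bochner_Integration.integrable_diff) auto
      show "integrable lborel (\<lambda>x. indicator torus x *\<^sub>R (f x * peak y x ^ k))" by (rule int)
      fix x :: "real^'n"
      show "indicator Q x *\<^sub>R (e * q ^ k) - indicator torus x *\<^sub>R (B * r ^ k) \<le> indicator torus x *\<^sub>R (f x * peak y x ^ k)"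
      proof (cases "x \<in> torus")
        case xt: True
        have Br: "0 \<le> B * r ^ k" using B r by simp
        show ?thesis
        proof (cases "x \<in> Q")
          case True
          have "e * q ^ k \<le> f x * peak y x ^ k"
            using Qd[OF True] e q by (intro mult_mono power_mono) auto
          then show ?thesis using True xt Br by simp
        next
          case False
          have "- (B * r ^ k) \<le> f x * peak y x ^ k"
          proof (cases "x \<in> W")
            case True
            have "\<bar>f x * peak y x ^ k\<bar> \<le> B * r ^ k"
              unfolding abs_mult power_abs using True r B peak_bounds[of y x]
              by (intro mult_mono power_mono) auto
            then show ?thesis by linarith
          next
            case False
            hence "e < f x" using xt torus_subset by (auto simp: W_def)
            hence "0 \<le> f x * peak y x ^ k" using e peak_bounds[of y x] by simp
            then show ?thesis using Br by linarith
          qed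
          then show ?thesis using False xt by simp
        qed
      next
        case False
        then show ?thesis using Qt by (auto simp: indicator_def)
      qed
    qed
    also have "\<dots> = 0" using 0 by (simp add: set_lebesgue_integral_def)
    finally show ?thesis by (simp add: algebra_simps)
  qed
  have "(\<lambda>k. B * (r / q) ^ k) \<longlonglongrightarrow> B * 0"
    using q r by (intro tendsto_mult tendsto_const LIMSEQ_realpow_zero) auto
  moreover have "e * \<mu> \<le> B * (r / q) ^ k" for k
    using bound[of k] q by (simp add: power_divide field_simps)
  ultimately have "e * \<mu> \<le> B * 0" by (intro LIMSEQ_le_const) auto
  then show False using e \<mu> by (simp add: mult_le_0_iff)
qed

lemma coeff_null_zero:
  assumes f: "f \<in> coeff_null"
  shows "f = (\<lambda>x. 0)"
proof
  fix x
  have nf: "(\<lambda>x. (-1) * f x + 0 * f x) \<in> coeff_null" by (intro coeff_null_lincomb f)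
  obtain y where y: "y \<in> torus" "f y = f x"
    using Cinf_per_attained[of f x] f by (auto simp: coeff_null_def)
  then show "f x = 0" using coeff_null_nonpos[OF f y(1)] coeff_null_nonpos[OF nf y(1)] by simp
qed

lemma syn_coeff:
  assumes f: "f \<in> Cinf_per"
  shows "syn (coeff f) = f"
proof -
  have r: "rapid (coeff f)" by (rule rapid_coeff[OF f])
  have "(\<lambda>x. 1 * syn (coeff f) x + (-1) * f x) \<in> coeff_null"
    by (simp only: coeff_null_def mem_Collect_eq Cinf_per_lincomb syn_Cinf_per r f coeff_lincomb
        coeff_syn[OF r fourier_reflect]) simp
  from coeff_null_zero[OF this] show ?thesis by (simp add: fun_eq_iff)
qed

section \<open>Fourier series of distributions\<close>

lemma null_seq_syn_remainder:
  assumes f: "f \<in> Cinf_per"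
  shows "null_seq (\<lambda>N x. 1 * f x + (-1) * (\<Sum>\<xi>\<in>freq_box N. syn_term (coeff f) \<xi> x))"
  unfolding null_seq_def
proof (intro conjI allI)
  let ?S = "\<lambda>N x. \<Sum>\<xi>\<in>freq_box N. syn_term (coeff f) \<xi> x"
  have r: "rapid (coeff f)" by (rule rapid_coeff[OF f])
  have SC: "?S N \<in> Cinf_per" for N by (intro Cinf_per_sum syn_term_Cinf_per)
  show "(\<lambda>x. 1 * f x + (-1) * ?S N x) \<in> Cinf_per" for N by (intro Cinf_per_lincomb f SC)
  fix js
  obtain c' where c': "rapid c'" "partials js (syn (coeff f)) = syn c'"
    "\<And>F. partials js (\<lambda>x. \<Sum>\<xi>\<in>F. syn_term (coeff f) \<xi> x) = (\<lambda>x. \<Sum>\<xi>\<in>F. syn_term c' \<xi> x)"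
    using partials_syn[OF r, of js] by blast
  have eq: "partials js (\<lambda>x. 1 * f x + (-1) * ?S N x) =
      (\<lambda>x. 1 * syn c' x + (-1) * (\<Sum>\<xi>\<in>freq_box N. syn_term c' \<xi> x))" for N
    using c'(2) unfolding partials_lincomb[OF f SC] c'(3) syn_coeff[OF f] by simp
  show "uniform_limit UNIV (\<lambda>N. partials js (\<lambda>x. 1 * f x + (-1) * ?S N x)) (\<lambda>_. 0) sequentially"
    unfolding eq
  proof (rule uniform_limitI)
    fix e :: real assume "e > 0"
    hence "\<forall>\<^sub>F N in sequentially. tail c' N < e"
      using tail_tendsto[OF c'(1)] by (auto intro: order_tendstoD)
    then show "\<forall>\<^sub>F N in sequentially. \<forall>x\<in>UNIV.
        dist (1 * syn c' x + (-1) * (\<Sum>\<xi>\<in>freq_box N. syn_term c' \<xi> x)) 0 < e"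
    proof eventually_elim
      case (elim N)
      have "\<bar>syn c' x - (\<Sum>\<xi>\<in>freq_box N. syn_term c' \<xi> x)\<bar> < e" for x
        using syn_approx[OF c'(1), of x N] elim by linarith
      then show ?case by simp
    qed
  qed
qed

text \<open>
  Since test functions are real, \<open>T(f)\<close> is the sum of the real inner products of the coefficients
  in \<open>\<complex> = \<real>\<^sup>2\<close>.
\<close>

lemma pairing_fourier_limit:
  assumes f: "f \<in> Cinf_per"
  shows "(\<lambda>N. \<Sum>\<xi>\<in>freq_box N. coeff f \<xi> \<bullet> fourier T \<xi>) \<longlonglongrightarrow> pairing T f"
proof -
  let ?S = "\<lambda>N x. \<Sum>\<xi>\<in>freq_box N. syn_term (coeff f) \<xi> x"
  have SC: "?S N \<in> Cinf_per" for N by (intro Cinf_per_sum syn_term_Cinf_per)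
  have "pairing T (\<lambda>x. 1 * f x + (-1) * ?S N x) = pairing T f - (\<Sum>\<xi>\<in>freq_box N. coeff f \<xi> \<bullet> fourier T \<xi>)" for N
    unfolding pairing_lincomb[OF f SC] by (simp add: pairing_sum syn_term_Cinf_per pairing_syn_term)
  with pairing_null_seq[OF null_seq_syn_remainder[OF f], of T]
  have "(\<lambda>N. pairing T f - (\<Sum>\<xi>\<in>freq_box N. coeff f \<xi> \<bullet> fourier T \<xi>)) \<longlonglongrightarrow> 0" by simp
  from tendsto_diff[OF tendsto_const this, of "pairing T f"] show ?thesis by simp
qed

lemma fourier_inject:
  assumes "\<And>\<xi>. fourier S \<xi> = fourier T \<xi>"
  shows "S = T"
proof (rule pdistr_eqI)
  show "pairing S f = pairing T f" if "f \<in> Cinf_per" for f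
    using LIMSEQ_unique[OF pairing_fourier_limit[OF that, of S]] pairing_fourier_limit[OF that, of T]
    by (simp add: assms)
qed

definition tempered :: "(int^'n::finite \<Rightarrow> complex) \<Rightarrow> bool"
  where "tempered c \<longleftrightarrow> (\<exists>k B. \<forall>\<xi>. cmod (c \<xi>) \<le> B * jb \<xi> ^ k)"

lemma tempered_bound:
  fixes c :: "int^'n::finite \<Rightarrow> complex"
  assumes "tempered c"
  shows "\<exists>B\<ge>0. \<exists>k. \<forall>\<xi>. cmod (c \<xi>) \<le> B * jb \<xi> ^ k"
proof -
  obtain k B where B: "\<And>\<xi>. cmod (c \<xi>) \<le> B * jb \<xi> ^ k" using assms unfolding tempered_def by blast
  have "0 \<le> B * jb (0 :: int^'n) ^ k" by (rule order_trans[OF norm_ge_zero B[of 0]])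
  hence "B \<ge> 0" by (simp add: jb_def)
  with B show ?thesis by auto
qed

lemma tempered_rapid_summable:
  assumes "tempered c" "rapid d"
  shows "(\<lambda>\<xi>. cmod (c \<xi>) * cmod (d \<xi>)) summable_on UNIV"
proof -
  obtain B k where B: "B \<ge> 0" "\<And>\<xi>. cmod (c \<xi>) \<le> B * jb \<xi> ^ k" using tempered_bound[OF assms(1)] by auto
  show ?thesis
  proof (rule summable_on_dominated(1))
    show "(\<lambda>\<xi>. B * (jb \<xi> ^ k * cmod (d \<xi>))) summable_on UNIV"
      by (intro summable_on_cmult_right rapid_summable assms)
    show "norm (cmod (c \<xi>) * cmod (d \<xi>)) \<le> B * (jb \<xi> ^ k * cmod (d \<xi>))" for \<xi>
      using mult_right_mono[OF B(2)[of \<xi>], of "cmod (d \<xi>)"] by (simp add: mult.assoc)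
  qed
qed

lemma coeff_pairing_summable:
  assumes "tempered c" "f \<in> Cinf_per"
  shows "(\<lambda>\<xi>. c \<xi> \<bullet> coeff f \<xi>) summable_on UNIV"
  by (rule summable_on_dominated(1)[OF tempered_rapid_summable[OF assms(1) rapid_coeff[OF assms(2)]]])
    (rule cmod_inner_le)

definition dsyn :: "(int^'n::finite \<Rightarrow> complex) \<Rightarrow> 'n pdistr"
  where "dsyn c = Abs_pdistr (\<lambda>\<phi>. if \<phi> \<in> Cinf_per then \<Sum>\<^sub>\<infinity>\<xi>. c \<xi> \<bullet> coeff \<phi> \<xi> else 0)"

lemma pairing_dsyn:
  fixes c :: "int^'n::finite \<Rightarrow> complex"
  assumes c: "tempered c"
  shows "pairing (dsyn c) = (\<lambda>\<phi>. if \<phi> \<in> Cinf_per then \<Sum>\<^sub>\<infinity>\<xi>. c \<xi> \<bullet> coeff \<phi> \<xi> else 0)"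
  unfolding dsyn_def
proof (rule Abs_pdistr_inverse, safe, goal_cases)
  case (1 \<phi>)
  then show ?case by simp
next
  case (2 \<phi> \<psi> a b)
  have "(\<Sum>\<^sub>\<infinity>\<xi>. c \<xi> \<bullet> coeff (\<lambda>x. a * \<phi> x + b * \<psi> x) \<xi>) =
      (\<Sum>\<^sub>\<infinity>\<xi>. a * (c \<xi> \<bullet> coeff \<phi> \<xi>) + b * (c \<xi> \<bullet> coeff \<psi> \<xi>))"
    by (intro infsum_cong) (simp add: coeff_lincomb 2 inner_add_right flip: scaleR_conv_of_real)
  also have "\<dots> = a * (\<Sum>\<^sub>\<infinity>\<xi>. c \<xi> \<bullet> coeff \<phi> \<xi>) + b * (\<Sum>\<^sub>\<infinity>\<xi>. c \<xi> \<bullet> coeff \<psi> \<xi>)"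
    by (subst infsum_add) (auto simp: infsum_cmult_right' intro!: summable_on_cmult_right coeff_pairing_summable c 2)
  finally show ?case using 2 by (simp add: Cinf_per_lincomb)
next
  case (3 \<phi>)
  obtain B k where B: "B \<ge> 0" "\<And>\<xi>. cmod (c \<xi>) \<le> B * jb \<xi> ^ k" using tempered_bound[OF c] by auto
  let ?n = "k + CARD('n)"
  have \<phi>: "\<phi> m \<in> Cinf_per" for m using 3 by (simp add: null_seq_def)
  let ?J = "\<Sum>\<^sub>\<infinity>\<xi>::int^'n. 1 / jb \<xi> ^ CARD('n)"
  have J: "?J \<ge> 0" by (intro infsum_nonneg) simp
  have le: "\<bar>\<Sum>\<^sub>\<infinity>\<xi>. c \<xi> \<bullet> coeff (\<phi> m) \<xi>\<bar> \<le> B * e * ?J"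
    if e: "\<And>x. \<bar>(bessel ^^ ?n) (\<phi> m) x\<bar> \<le> e" for m e
  proof -
    have "norm (\<Sum>\<^sub>\<infinity>\<xi>. c \<xi> \<bullet> coeff (\<phi> m) \<xi>) \<le> (\<Sum>\<^sub>\<infinity>\<xi>::int^'n. (B * e) * (1 / jb \<xi> ^ CARD('n)))"
    proof (rule summable_on_dominated(2))
      show "(\<lambda>\<xi>::int^'n. (B * e) * (1 / jb \<xi> ^ CARD('n))) summable_on UNIV"
        by (intro summable_on_cmult_right summable_jb)
      fix \<xi>
      have "norm (c \<xi> \<bullet> coeff (\<phi> m) \<xi>) \<le> cmod (c \<xi>) * cmod (coeff (\<phi> m) \<xi>)" by (rule cmod_inner_le)
      also have "\<dots> \<le> (B * jb \<xi> ^ k) * (e / jb \<xi> ^ ?n)"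
        using coeff_decay[OF \<phi> e, of \<xi>] B by (intro mult_mono B) (auto simp: field_simps)
      also have "\<dots> = (B * e) * (1 / jb \<xi> ^ CARD('n))" by (simp add: power_add field_simps)
      finally show "norm (c \<xi> \<bullet> coeff (\<phi> m) \<xi>) \<le> (B * e) * (1 / jb \<xi> ^ CARD('n))" .
    qed
    also have "\<dots> = B * e * ?J" by (simp only: infsum_cmult_right')
    finally show ?thesis by simp
  qed
  have "uniform_limit UNIV (\<lambda>m. partials [] ((bessel ^^ ?n) (\<phi> m))) (\<lambda>_. 0) sequentially"
    using null_seq_bessel_pow[OF 3, of ?n] unfolding null_seq_def by blast
  hence lim: "uniform_limit UNIV (\<lambda>m. (bessel ^^ ?n) (\<phi> m)) (\<lambda>_. 0) sequentially" by simp
  have "(\<lambda>m. \<Sum>\<^sub>\<infinity>\<xi>. c \<xi> \<bullet> coeff (\<phi> m) \<xi>) \<longlonglongrightarrow> 0"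
  proof (rule tendstoI)
    fix e :: real assume e: "e > 0"
    define d where "d = e / (B * ?J + 1)"
    have "B * ?J \<ge> 0" using B J by simp
    hence d: "d > 0" "B * d * ?J < e" using e
      by (auto simp: d_def field_simps add_nonneg_pos)
    have "\<forall>\<^sub>F m in sequentially. \<forall>x\<in>UNIV. dist ((bessel ^^ ?n) (\<phi> m) x) 0 < d"
      by (rule uniform_limitD[OF lim d(1)])
    then show "\<forall>\<^sub>F m in sequentially. dist (\<Sum>\<^sub>\<infinity>\<xi>. c \<xi> \<bullet> coeff (\<phi> m) \<xi>) 0 < e"
    proof eventually_elim
      case (elim m)
      have "\<bar>\<Sum>\<^sub>\<infinity>\<xi>. c \<xi> \<bullet> coeff (\<phi> m) \<xi>\<bar> \<le> B * d * ?J"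
        by (rule le) (use elim in \<open>auto intro: less_imp_le\<close>)
      then show ?case using d(2) by simp
    qed
  qed
  then show ?case by (simp add: \<phi>)
qed

lemma fourier_dsyn:
  assumes c: "tempered c" and sym: "\<And>\<xi>. c (- \<xi>) = cnj (c \<xi>)"
  shows "fourier (dsyn c) \<xi> = c \<xi>"
  using infsumI[OF has_sum_coeff_trig(1)[of c, OF sym]] infsumI[OF has_sum_coeff_trig(2)[of c, OF sym]]
  by (simp add: fourier_wv pairing_dsyn[OF c] trig_wv_Cinf_per)

lemma of_fun_syn:
  assumes "rapid (fourier T)"
  shows "T = of_fun (syn (fourier T))"
  by (rule fourier_inject) (simp add: coeff_syn[OF assms fourier_reflect])

lemma pairing_fourier:
  assumes T: "tempered (fourier T)" and f: "f \<in> Cinf_per"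
  shows "((\<lambda>\<eta>. fourier T \<eta> * coeff f (- \<eta>)) has_sum of_real (pairing T f)) UNIV"
proof -
  let ?g = "\<lambda>\<eta>. fourier T \<eta> * coeff f (- \<eta>)"
  have r: "rapid (coeff f)" by (rule rapid_coeff[OF f])
  have s: "?g summable_on UNIV"
    by (rule summable_on_dominated(1)[OF tempered_rapid_summable[OF T r]]) (simp add: norm_mult fourier_reflect)
  define z where "z = infsum ?g UNIV"
  have z: "(?g has_sum z) UNIV" using s by (simp add: z_def)
  have "cnj z = (\<Sum>\<^sub>\<infinity>\<eta>. cnj (?g \<eta>))" unfolding z_def by (rule infsum_cnj[symmetric])
  also have "\<dots> = z" unfolding z_def
    by (rule infsum_reindex_bij_witness[of _ uminus uminus]) (auto simp: fourier_reflect)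
  finally have "Im z = 0" by (simp add: complex_eq_iff)
  moreover have "Re z = pairing T f"
  proof -
    have "((\<lambda>\<eta>. Re (?g \<eta>)) has_sum Re z) UNIV" by (rule has_sum_Re[OF z])
    moreover have "Re (?g \<eta>) = coeff f \<eta> \<bullet> fourier T \<eta>" for \<eta>
      by (simp add: fourier_reflect inner_complex_expand mult.commute)
    ultimately have "(\<lambda>N. \<Sum>\<eta>\<in>freq_box N. coeff f \<eta> \<bullet> fourier T \<eta>) \<longlonglongrightarrow> Re z"
      using has_sum_freq_box by force
    from LIMSEQ_unique[OF this pairing_fourier_limit[OF f]] show ?thesis .
  qed
  ultimately have "z = of_real (pairing T f)" by (simp add: complex_eq_iff)
  with z show ?thesis by simp
qed

lemma fourier_dmult:
  assumes T: "tempered (fourier T)" and f: "f \<in> Cinf_per"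
  shows "((\<lambda>\<eta>. coeff f (\<xi> - \<eta>) * fourier T \<eta>) has_sum fourier (dmult f T) \<xi>) UNIV"
proof -
  let ?C = "\<lambda>x. f x * cos (x \<bullet> wv \<xi>)" and ?S = "\<lambda>x. f x * sin (x \<bullet> wv \<xi>)"
  have "((\<lambda>\<eta>. fourier T \<eta> * coeff ?C (- \<eta>) + (- \<i>) * (fourier T \<eta> * coeff ?S (- \<eta>))) has_sum
      of_real (pairing T ?C) + (- \<i>) * of_real (pairing T ?S)) UNIV"
    by (intro has_sum_add has_sum_cmult_right pairing_fourier T Cinf_per_mult f trig_wv_Cinf_per)
  moreover have "fourier T \<eta> * coeff ?C (- \<eta>) + (- \<i>) * (fourier T \<eta> * coeff ?S (- \<eta>)) =
      coeff f (\<xi> - \<eta>) * fourier T \<eta>" for \<eta>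
  proof -
    have e: "a * ((b + c) / 2) + (- \<i>) * (a * ((b - c) / (2 * \<i>))) = c * a" for a b c :: complex
      by (simp add: field_simps)
    show ?thesis unfolding coeff_mult_trig[OF f] e by simp
  qed
  moreover have "of_real (pairing T ?C) + (- \<i>) * of_real (pairing T ?S) = fourier (dmult f T) \<xi>"
    by (simp add: fourier_wv dmult.rep_eq trig_wv_Cinf_per f complex_eq_iff)
  ultimately show ?thesis by simp
qed

section \<open>Sobolev spaces through Fourier coefficients\<close>

definition hs :: "real \<Rightarrow> (int^'n::finite \<Rightarrow> 'v::real_normed_vector) \<Rightarrow> bool"
  where "hs s c \<longleftrightarrow> l2 (\<lambda>\<xi>. jb \<xi> powr (s / 2) * norm (c \<xi>))"

definition hnorm :: "real \<Rightarrow> (int^'n::finite \<Rightarrow> 'v::real_normed_vector) \<Rightarrow> real"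
  where "hnorm s c = l2norm (\<lambda>\<xi>. jb \<xi> powr (s / 2) * norm (c \<xi>))"

lemma hnorm_nonneg [simp]: "0 \<le> hnorm s c"
  by (simp add: hnorm_def)

lemma weight_squared: "(jb \<xi> powr (s / 2) * x)\<^sup>2 = jb \<xi> powr s * x\<^sup>2"
  by (simp add: power_mult_distrib power2_eq_square flip: powr_add)

lemma Hs_iff: "g \<in> Hs s \<longleftrightarrow> hs s (fourier g)"
  by (simp add: Hs_def hs_def l2_def weight_squared) (simp add: jb_def)

lemma Hs_norm_eq: "Hs_norm s g = hnorm s (fourier g)"
  by (simp add: Hs_norm_def hnorm_def l2norm_def weight_squared) (simp add: jb_def)

lemma Hs_dot_iff: "g \<in> Hs_dot s \<longleftrightarrow> hs s (fourier g) \<and> fourier g 0 = 0"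
  by (simp add: Hs_dot_def Hs_iff)

lemma hs_weighted_le:
  assumes "hs t d" "\<And>\<xi>. jb \<xi> powr (s / 2) * norm (c \<xi>) \<le> K * (jb \<xi> powr (t / 2) * norm (d \<xi>))" "K \<ge> 0"
  shows "hs s c" "hnorm s c \<le> K * hnorm t d"
proof -
  have l: "l2 (\<lambda>\<xi>. K * (jb \<xi> powr (t / 2) * norm (d \<xi>)))"
    "l2norm (\<lambda>\<xi>. K * (jb \<xi> powr (t / 2) * norm (d \<xi>))) = K * hnorm t d"
    using l2_cmult[of "\<lambda>\<xi>. jb \<xi> powr (t / 2) * norm (d \<xi>)" K] assms(1,3) by (simp_all add: hs_def hnorm_def)
  have le: "\<bar>jb \<xi> powr (s / 2) * norm (c \<xi>)\<bar> \<le> \<bar>K * (jb \<xi> powr (t / 2) * norm (d \<xi>))\<bar>" for \<xi>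
    using assms(2)[of \<xi>] assms(3) by (simp add: abs_mult)
  show "hs s c" "hnorm s c \<le> K * hnorm t d"
    using l2_le[OF l(1) le] l(2) by (simp_all add: hs_def hnorm_def)
qed

lemma hs_le:
  assumes "hs s d" "\<And>\<xi>. norm (c \<xi>) \<le> K * norm (d \<xi>)" "K \<ge> 0"
  shows "hs s c" "hnorm s c \<le> K * hnorm s d"
proof -
  have "jb \<xi> powr (s / 2) * norm (c \<xi>) \<le> K * (jb \<xi> powr (s / 2) * norm (d \<xi>))" for \<xi>
    using mult_left_mono[OF assms(2)[of \<xi>], of "jb \<xi> powr (s / 2)"] by (simp add: mult_ac)
  from hs_weighted_le[OF assms(1) this assms(3)] show "hs s c" "hnorm s c \<le> K * hnorm s d" by auto
qed

lemma hs_mono: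
  assumes "hs t c" "s \<le> t"
  shows "hs s c" "hnorm s c \<le> hnorm t c"
proof -
  have "jb \<xi> powr (s / 2) * norm (c \<xi>) \<le> 1 * (jb \<xi> powr (t / 2) * norm (c \<xi>))" for \<xi>
    using assms(2) by (simp add: mult_right_mono powr_mono)
  from hs_weighted_le[OF assms(1) this] show "hs s c" "hnorm s c \<le> hnorm t c" by auto
qed

lemma hs_add_weighted:
  assumes "hs t d" "hs u e"
    and "\<And>\<xi>. jb \<xi> powr (s / 2) * norm (c \<xi>) \<le> jb \<xi> powr (t / 2) * norm (d \<xi>) + jb \<xi> powr (u / 2) * norm (e \<xi>)"
  shows "hs s c" "hnorm s c \<le> hnorm t d + hnorm u e"
proof -
  have le: "\<bar>jb \<xi> powr (s / 2) * norm (c \<xi>)\<bar> \<le> \<bar>jb \<xi> powr (t / 2) * norm (d \<xi>)\<bar> + \<bar>jb \<xi> powr (u / 2) * norm (e \<xi>)\<bar>" for \<xi>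
    using assms(3)[of \<xi>] by (simp add: abs_mult)
  show "hs s c" "hnorm s c \<le> hnorm t d + hnorm u e"
    using l2_le_add[OF assms(1)[unfolded hs_def] assms(2)[unfolded hs_def] le] by (simp_all add: hs_def hnorm_def)
qed

lemma hs_add_le:
  assumes "hs s d" "hs s e" and "\<And>\<xi>. norm (c \<xi>) \<le> norm (d \<xi>) + norm (e \<xi>)"
  shows "hs s c" "hnorm s c \<le> hnorm s d + hnorm s e"
proof -
  have "jb \<xi> powr (s / 2) * norm (c \<xi>) \<le> jb \<xi> powr (s / 2) * norm (d \<xi>) + jb \<xi> powr (s / 2) * norm (e \<xi>)" for \<xi>
    using mult_left_mono[OF assms(3)[of \<xi>], of "jb \<xi> powr (s / 2)"] by (simp add: algebra_simps)
  from hs_add_weighted[OF assms(1,2) this] show "hs s c" "hnorm s c \<le> hnorm s d + hnorm s e" by auto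
qed

lemma hs_add:
  assumes "hs s c" "hs s d"
  shows "hs s (\<lambda>\<xi>. c \<xi> + d \<xi>)" "hnorm s (\<lambda>\<xi>. c \<xi> + d \<xi>) \<le> hnorm s c + hnorm s d"
  by (rule hs_add_le[OF assms norm_triangle_ineq])+

lemma hs_diff:
  assumes "hs s c" "hs s d"
  shows "hs s (\<lambda>\<xi>. c \<xi> - d \<xi>)" "hnorm s (\<lambda>\<xi>. c \<xi> - d \<xi>) \<le> hnorm s c + hnorm s d"
  by (rule hs_add_le[OF assms norm_triangle_ineq4])+

lemma hs_zero [simp]: "hs s (\<lambda>_. 0)" "hnorm s (\<lambda>_. 0) = 0"
  by (simp_all add: hs_def hnorm_def)

lemma hs_scaleR:
  assumes "hs s c"
  shows "hs s (\<lambda>\<xi>. a *\<^sub>R c \<xi>)" "hnorm s (\<lambda>\<xi>. a *\<^sub>R c \<xi>) = \<bar>a\<bar> * hnorm s c"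
  using l2_cmult[of "\<lambda>\<xi>. jb \<xi> powr (s / 2) * norm (c \<xi>)" "\<bar>a\<bar>"] assms
  by (simp_all add: hs_def hnorm_def mult_ac)

lemma hs_component_le: "hs s c \<Longrightarrow> jb \<xi> powr (s / 2) * norm (c \<xi>) \<le> hnorm s c"
  using l2_component[of "\<lambda>\<xi>. jb \<xi> powr (s / 2) * norm (c \<xi>)" \<xi>] by (simp add: hs_def hnorm_def abs_mult)

lemma hnorm_eq_0: "hs s c \<Longrightarrow> hnorm s c = 0 \<Longrightarrow> c \<xi> = 0"
  using hs_component_le[of s c \<xi>] by (simp add: mult_le_0_iff)

lemma hs_finite_sum:
  assumes "finite K" "\<And>k. k \<in> K \<Longrightarrow> hs s (c k)"
  shows "hs s (\<lambda>\<xi>. \<Sum>k\<in>K. c k \<xi>) \<and> hnorm s (\<lambda>\<xi>. \<Sum>k\<in>K. c k \<xi>) \<le> (\<Sum>k\<in>K. hnorm s (c k))"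
  using assms
proof (induction K rule: finite_induct)
  case (insert k K)
  then have "hs s (c k)" "hs s (\<lambda>\<xi>. \<Sum>k\<in>K. c k \<xi>)" by auto
  from hs_add[OF this] show ?case using insert by fastforce
qed simp

lemma tempered_hs:
  fixes c :: "int^'n::finite \<Rightarrow> complex"
  assumes "hs s c"
  shows "tempered c"
proof -
  define k where "k = nat \<lceil>\<bar>s\<bar>\<rceil>"
  have "cmod (c \<xi>) \<le> hnorm s c * jb \<xi> ^ k" for \<xi>
  proof -
    have "jb \<xi> powr (- (s / 2)) \<le> jb \<xi> powr real k"
      unfolding k_def by (intro powr_mono) (auto, linarith)
    hence p: "jb \<xi> powr (- (s / 2)) \<le> jb \<xi> ^ k" by (simp add: powr_realpow)
    have "cmod (c \<xi>) = (jb \<xi> powr (s / 2) * cmod (c \<xi>)) * jb \<xi> powr (- (s / 2))"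
      by (simp add: powr_minus field_simps)
    also have "\<dots> \<le> hnorm s c * jb \<xi> ^ k"
      by (intro mult_mono hs_component_le assms p) auto
    finally show ?thesis .
  qed
  then show ?thesis unfolding tempered_def by blast
qed

lemma rapid_hs:
  fixes c :: "int^'n::finite \<Rightarrow> complex"
  assumes "rapid c"
  shows "hs s c"
proof -
  define k where "k = nat \<lceil>\<bar>s\<bar>\<rceil>"
  obtain B where B: "\<And>\<xi>. jb \<xi> ^ k * cmod (c \<xi>) \<le> B" using assms unfolding rapid_def by blast
  have le: "norm ((jb \<xi> powr (s / 2) * cmod (c \<xi>))\<^sup>2) \<le> B * (jb \<xi> ^ k * cmod (c \<xi>))" for \<xi>
  proof -
    have "jb \<xi> powr (s / 2) \<le> jb \<xi> powr real k"
      unfolding k_def by (intro powr_mono) (auto, linarith)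
    hence p: "jb \<xi> powr (s / 2) * cmod (c \<xi>) \<le> jb \<xi> ^ k * cmod (c \<xi>)"
      by (simp add: powr_realpow mult_right_mono)
    have "(jb \<xi> powr (s / 2) * cmod (c \<xi>))\<^sup>2 \<le> (jb \<xi> ^ k * cmod (c \<xi>))\<^sup>2"
      by (intro power_mono p) auto
    also have "\<dots> \<le> B * (jb \<xi> ^ k * cmod (c \<xi>))"
      unfolding power2_eq_square by (intro mult_right_mono B) auto
    finally show ?thesis by simp
  qed
  have "(\<lambda>\<xi>. B * (jb \<xi> ^ k * cmod (c \<xi>))) summable_on UNIV"
    by (intro summable_on_cmult_right rapid_summable assms)
  from summable_on_dominated(1)[OF this le] show ?thesis by (simp add: hs_def l2_def)
qed

lemma rapid_if_hs:
  fixes c :: "int^'n::finite \<Rightarrow> complex"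
  assumes "\<And>t. t \<ge> t0 \<Longrightarrow> hs t c"
  shows "rapid c"
  unfolding rapid_def
proof
  fix k :: nat
  define t where "t = max t0 (2 * real k)"
  have h: "hs t c" by (rule assms) (simp add: t_def)
  have "jb \<xi> ^ k * cmod (c \<xi>) \<le> hnorm t c" for \<xi>
  proof -
    have "jb \<xi> ^ k = jb \<xi> powr real k" by (simp add: powr_realpow)
    also have "\<dots> \<le> jb \<xi> powr (t / 2)" by (intro powr_mono) (auto simp: t_def)
    finally have "jb \<xi> ^ k * cmod (c \<xi>) \<le> jb \<xi> powr (t / 2) * cmod (c \<xi>)" by (intro mult_right_mono) auto
    then show ?thesis using hs_component_le[OF h, of \<xi>] by linarith
  qed
  then show "\<exists>B. \<forall>\<xi>. jb \<xi> ^ k * cmod (c \<xi>) \<le> B" by blast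
qed

definition vhat :: "'n::finite vdistr \<Rightarrow> int^'n \<Rightarrow> complex^'n"
  where "vhat u \<xi> = (\<chi> k. fourier (u $ k) \<xi>)"

lemma vhat_nth [simp]: "vhat u \<xi> $ k = fourier (u $ k) \<xi>"
  by (simp add: vhat_def)

lemma vhat_linear [simp]:
  "vhat (u + v) \<xi> = vhat u \<xi> + vhat v \<xi>" "vhat (u - v) \<xi> = vhat u \<xi> - vhat v \<xi>"
  "vhat (- u) \<xi> = - vhat u \<xi>" "vhat (a *\<^sub>R u) \<xi> = a *\<^sub>R vhat u \<xi>" "vhat 0 \<xi> = 0"
  by (simp_all add: vec_eq_iff)

lemma vhat_inject: "(\<And>\<xi>. vhat u \<xi> = vhat v \<xi>) \<Longrightarrow> u = v"
  by (auto simp: vec_eq_iff intro!: fourier_inject)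

lemma norm_vec_squared: "(norm (v :: complex^'n::finite))\<^sup>2 = (\<Sum>k\<in>UNIV. (cmod (v $ k))\<^sup>2)"
  by (simp add: norm_vec_def L2_set_def sum_nonneg)

lemma norm_vec_weight_squared:
  "(jb \<xi> powr (s / 2) * norm (v :: complex^'n::finite))\<^sup>2 = (\<Sum>k\<in>UNIV. (jb \<xi> powr (s / 2) * cmod (v $ k))\<^sup>2)"
  by (simp add: power_mult_distrib norm_vec_squared sum_distrib_left)

lemma hs_nth: "hs s c \<Longrightarrow> hs s (\<lambda>\<xi>. (c \<xi> :: complex^'n::finite) $ k)"
  by (rule hs_le(1)[of s c _ 1]) (auto simp: Finite_Cartesian_Product.norm_nth_le)

lemma hs_vec_iff: "hs s (c :: int^'n::finite \<Rightarrow> complex^'m::finite) \<longleftrightarrow> (\<forall>k. hs s (\<lambda>\<xi>. c \<xi> $ k))"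
proof
  assume "\<forall>k. hs s (\<lambda>\<xi>. c \<xi> $ k)"
  then show "hs s c"
    unfolding hs_def l2_def norm_vec_weight_squared by (intro summable_on_finite_sum(1)) auto
qed (auto intro: hs_nth)

lemma hnorm_vec_squared:
  assumes "hs s (c :: int^'n::finite \<Rightarrow> complex^'m::finite)"
  shows "(hnorm s c)\<^sup>2 = (\<Sum>k\<in>UNIV. (hnorm s (\<lambda>\<xi>. c \<xi> $ k))\<^sup>2)"
  unfolding hnorm_def l2norm_squared norm_vec_weight_squared
  by (rule summable_on_finite_sum(2)) (use hs_nth[OF assms] in \<open>simp add: hs_def l2_def\<close>)

lemma components_in_Hs_dot: "u \<in> components_in (Hs_dot s) \<longleftrightarrow> hs s (vhat u) \<and> vhat u 0 = 0"
  by (auto simp: components_in_def Hs_dot_iff hs_vec_iff vec_eq_iff)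

lemma Hs_norm_vec_eq:
  assumes "hs s (vhat u)"
  shows "Hs_norm_vec s u = hnorm s (vhat u)"
proof -
  have "(\<Sum>k\<in>UNIV. (hnorm s (fourier (u $ k)))\<^sup>2) = (hnorm s (vhat u))\<^sup>2"
    using hnorm_vec_squared[OF assms] by simp
  then show ?thesis by (simp add: Hs_norm_vec_def Hs_norm_eq)
qed

lemma Hs_dot_pair_iff:
  "(u, p) \<in> Hs_dot_pair s t \<longleftrightarrow> hs s (vhat u) \<and> vhat u 0 = 0 \<and> hs t (fourier p) \<and> fourier p 0 = 0"
  by (auto simp: Hs_dot_pair_def components_in_Hs_dot Hs_dot_iff)

lemma Hs_norm_pair_eq:
  "(u, p) \<in> Hs_dot_pair s t \<Longrightarrow> Hs_norm_pair s t (u, p) = hnorm s (vhat u) + hnorm t (fourier p)"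
  by (simp add: Hs_dot_pair_iff Hs_norm_pair_def Hs_norm_vec_eq Hs_norm_eq)

subsection \<open>Completeness\<close>

lemma Hs_dot_complete:
  fixes T :: "nat \<Rightarrow> 'n::finite pdistr"
  assumes T: "\<And>m. T m \<in> Hs_dot s" and K: "\<And>m. Hs_norm s (T m) \<le> K * (1/2) ^ m"
  shows "\<exists>S\<in>Hs_dot s. \<forall>M. Hs_norm s (S - (\<Sum>m<M. T m)) \<le> 2 * K * (1/2) ^ M"
proof -
  let ?w = "\<lambda>\<xi>. jb \<xi> powr (s / 2)"
  have h: "hs s (fourier (T m))" "fourier (T m) 0 = 0" for m using T[of m] by (auto simp: Hs_dot_iff)
  have K': "hnorm s (fourier (T m)) \<le> K * (1/2) ^ m" for m using K[of m] by (simp add: Hs_norm_eq)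
  have K0: "K \<ge> 0" using order_trans[OF hnorm_nonneg K'[of 0]] by simp
  have b: "cmod (fourier (T m) \<xi>) \<le> (K / ?w \<xi>) * (1/2) ^ m" for m \<xi>
    using order_trans[OF hs_component_le[OF h(1)] K', of \<xi> m] by (simp add: field_simps)
  have sm: "summable (\<lambda>m. fourier (T m) \<xi>)" for \<xi>
  proof (rule summable_comparison_test'[where N = 0])
    show "summable (\<lambda>m. (K / ?w \<xi>) * (1/2) ^ m)" by (intro summable_mult summable_geometric) simp
  qed (rule b)
  define c where "c \<xi> = (\<Sum>m. fourier (T m) \<xi>)" for \<xi>
  have part: "L2_set (\<lambda>\<xi>. ?w \<xi> * cmod (\<Sum>m=M..<N. fourier (T m) \<xi>)) F \<le> 2 * K * (1/2) ^ M" if F: "finite F" for M N F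
  proof -
    have "hs s (\<lambda>\<xi>. \<Sum>m=M..<N. fourier (T m) \<xi>) \<and>
        hnorm s (\<lambda>\<xi>. \<Sum>m=M..<N. fourier (T m) \<xi>) \<le> (\<Sum>m=M..<N. hnorm s (fourier (T m)))"
      by (rule hs_finite_sum) (auto simp: h)
    moreover have "(\<Sum>m=M..<N. hnorm s (fourier (T m))) \<le> (\<Sum>m=M..<N. K * (1/2) ^ m)"
      by (intro sum_mono K')
    moreover have "(\<Sum>m=M..<N. K * (1/2) ^ m) \<le> 2 * K * (1/2) ^ M"
    proof (cases "M \<le> N")
      case True
      have "(\<Sum>m=M..<N. (1/2::real) ^ m) = 2 * ((1/2) ^ M - (1/2) ^ N)"
        using True by (induction N rule: dec_induct) auto
      also have "\<dots> \<le> 2 * (1/2) ^ M" by simp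
      finally have "K * (\<Sum>m=M..<N. (1/2::real) ^ m) \<le> K * (2 * (1/2) ^ M)" by (intro mult_left_mono K0)
      then show ?thesis by (simp add: sum_distrib_left mult_ac)
    qed (use K0 in auto)
    ultimately show ?thesis
      using L2_set_le_l2norm[OF _ F, of "\<lambda>\<xi>. ?w \<xi> * cmod (\<Sum>m=M..<N. fourier (T m) \<xi>)"]
      by (simp add: hs_def hnorm_def)
  qed
  have rem: "hs s (\<lambda>\<xi>. c \<xi> - (\<Sum>m<M. fourier (T m) \<xi>)) \<and>
      hnorm s (\<lambda>\<xi>. c \<xi> - (\<Sum>m<M. fourier (T m) \<xi>)) \<le> 2 * K * (1/2) ^ M" for M
  proof -
    have "L2_set (\<lambda>\<xi>. ?w \<xi> * cmod (c \<xi> - (\<Sum>m<M. fourier (T m) \<xi>))) F \<le> 2 * K * (1/2) ^ M" if F: "finite F" for F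
    proof (rule LIMSEQ_le_const2)
      have "(\<lambda>N. \<Sum>m<N. fourier (T m) \<xi>) \<longlonglongrightarrow> c \<xi>" for \<xi>
        unfolding c_def using summable_LIMSEQ[OF sm] .
      then show "(\<lambda>N. L2_set (\<lambda>\<xi>. ?w \<xi> * cmod ((\<Sum>m<N. fourier (T m) \<xi>) - (\<Sum>m<M. fourier (T m) \<xi>))) F) \<longlonglongrightarrow>
          L2_set (\<lambda>\<xi>. ?w \<xi> * cmod (c \<xi> - (\<Sum>m<M. fourier (T m) \<xi>))) F"
        unfolding L2_set_def by (intro tendsto_intros)
      have "(\<Sum>m<N. fourier (T m) \<xi>) - (\<Sum>m<M. fourier (T m) \<xi>) = (\<Sum>m=M..<N. fourier (T m) \<xi>)" if "N \<ge> M" for N \<xi>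
        using sum_diff_nat_ivl[of 0 M N "\<lambda>m. fourier (T m) \<xi>"] that by (simp add: lessThan_atLeast0)
      then show "\<exists>N0. \<forall>N\<ge>N0. L2_set (\<lambda>\<xi>. ?w \<xi> * cmod ((\<Sum>m<N. fourier (T m) \<xi>) - (\<Sum>m<M. fourier (T m) \<xi>))) F \<le> 2 * K * (1/2) ^ M"
        using part[OF F] by (intro exI[of _ M]) simp
    qed
    from l2I[OF this] show ?thesis by (simp add: hs_def hnorm_def)
  qed
  have hc: "hs s c" using rem[of 0] by simp
  have sym: "c (- \<xi>) = cnj (c \<xi>)" for \<xi>
  proof -
    have "(\<lambda>m. cnj (fourier (T m) \<xi>)) sums cnj (c \<xi>)"
      unfolding c_def sums_cnj using summable_sums[OF sm] .
    then show ?thesis unfolding c_def by (simp add: fourier_reflect sums_iff)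
  qed
  have fc: "fourier (dsyn c) \<xi> = c \<xi>" for \<xi> by (rule fourier_dsyn[OF tempered_hs[OF hc] sym])
  have "fourier (dsyn c) = c" using fc by (rule ext)
  moreover have "c 0 = 0" by (simp add: c_def h)
  ultimately have "dsyn c \<in> Hs_dot s" using hc by (simp add: Hs_dot_iff)
  moreover have "Hs_norm s (dsyn c - (\<Sum>m<M. T m)) \<le> 2 * K * (1/2) ^ M" for M
  proof -
    have "fourier (dsyn c - (\<Sum>m<M. T m)) = (\<lambda>\<xi>. c \<xi> - (\<Sum>m<M. fourier (T m) \<xi>))" by (rule ext) (simp add: fc)
    then show ?thesis using rem[of M] by (simp add: Hs_norm_eq)
  qed
  ultimately show ?thesis by blast
qed

lemma Hs_norm_vec_component: "Hs_norm s (u $ k) \<le> Hs_norm_vec s u"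
  unfolding Hs_norm_vec_def L2_set_def[symmetric] by (rule member_le_L2_set) auto

lemma Hs_norm_vec_le_sum: "Hs_norm_vec s u \<le> (\<Sum>k\<in>UNIV. Hs_norm s (u $ k))"
  unfolding Hs_norm_vec_def L2_set_def[symmetric] by (rule L2_set_le_sum) (simp add: Hs_norm_eq)

lemma Hs_dot_pair_complete:
  fixes x :: "nat \<Rightarrow> 'n::finite vdistr \<times> 'n pdistr"
  assumes x: "\<And>m. x m \<in> Hs_dot_pair s t" and K: "\<And>m. Hs_norm_pair s t (x m) \<le> K * (1/2) ^ m"
  shows "\<exists>y\<in>Hs_dot_pair s t. (\<lambda>M. Hs_norm_pair s t (y - (\<Sum>m<M. x m))) \<longlonglongrightarrow> 0"
proof -
  have n: "Hs_norm_vec s (fst (x m)) \<le> K * (1/2) ^ m" "Hs_norm t (snd (x m)) \<le> K * (1/2) ^ m" for m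
  proof -
    have "Hs_norm_vec s (fst (x m)) + Hs_norm t (snd (x m)) \<le> K * (1/2) ^ m"
      using K[of m] by (simp add: Hs_norm_pair_def split_beta)
    moreover have "Hs_norm_vec s (fst (x m)) \<ge> 0" "Hs_norm t (snd (x m)) \<ge> 0"
      by (auto simp: Hs_norm_vec_def Hs_norm_eq intro!: sum_nonneg)
    ultimately show "Hs_norm_vec s (fst (x m)) \<le> K * (1/2) ^ m" "Hs_norm t (snd (x m)) \<le> K * (1/2) ^ m" by auto
  qed
  have i: "fst (x m) $ k \<in> Hs_dot s" "snd (x m) \<in> Hs_dot t" for m k
    using x[of m] by (auto simp: Hs_dot_pair_def components_in_def mem_Times_iff)
  have "\<exists>S\<in>Hs_dot s. \<forall>M. Hs_norm s (S - (\<Sum>m<M. fst (x m) $ k)) \<le> 2 * K * (1/2) ^ M" for k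
    by (rule Hs_dot_complete) (use i order_trans[OF Hs_norm_vec_component n(1)] in auto)
  then obtain S where S: "\<And>k. S k \<in> Hs_dot s" "\<And>k M. Hs_norm s (S k - (\<Sum>m<M. fst (x m) $ k)) \<le> 2 * K * (1/2) ^ M"
    by metis
  obtain q where q: "q \<in> Hs_dot t" "\<And>M. Hs_norm t (q - (\<Sum>m<M. snd (x m))) \<le> 2 * K * (1/2) ^ M"
    using Hs_dot_complete[of "\<lambda>m. snd (x m)" t K] i n by auto
  let ?y = "(vec_lambda S, q)"
  have y: "?y \<in> Hs_dot_pair s t" using S q by (simp add: Hs_dot_pair_def components_in_def)
  have le: "Hs_norm_pair s t (?y - (\<Sum>m<M. x m)) \<le> (CARD('n) + 1) * (2 * K) * (1/2) ^ M" for M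
  proof -
    have e: "?y - (\<Sum>m<M. x m) = (vec_lambda S - (\<Sum>m<M. fst (x m)), q - (\<Sum>m<M. snd (x m)))"
      by (simp add: prod_eq_iff fst_sum snd_sum)
    have "Hs_norm_vec s (vec_lambda S - (\<Sum>m<M. fst (x m))) \<le> (\<Sum>k\<in>(UNIV::'n set). 2 * K * (1/2) ^ M)"
      by (rule order_trans[OF Hs_norm_vec_le_sum sum_mono]) (use S in \<open>simp add: sum_component\<close>)
    then show ?thesis using q(2)[of M] unfolding e by (simp add: Hs_norm_pair_def algebra_simps)
  qed
  have nn: "0 \<le> Hs_norm_pair s t (?y - (\<Sum>m<M. x m))" for M
    by (simp add: Hs_norm_pair_def split_beta Hs_norm_vec_def Hs_norm_eq sum_nonneg)
  have "(\<lambda>M. (CARD('n) + 1) * (2 * K) * (1/2) ^ M) \<longlonglongrightarrow> (CARD('n) + 1) * (2 * K) * 0"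
    by (intro tendsto_mult tendsto_const LIMSEQ_realpow_zero) auto
  hence "(\<lambda>M. (CARD('n) + 1) * (2 * K) * (1/2) ^ M) \<longlonglongrightarrow> 0" by (simp only: mult_zero_right)
  hence "(\<lambda>M. Hs_norm_pair s t (?y - (\<Sum>m<M. x m))) \<longlonglongrightarrow> 0"
    by (rule Lim_null_comparison[rotated]) (use le nn in \<open>auto intro!: always_eventually\<close>)
  with y show ?thesis by blast
qed

section \<open>The advection term\<close>

lemma jb_powr_half: "jb \<xi> powr (1 / 2) = sqrt (jb \<xi>)"
  by (simp add: powr_half_sqrt)

lemma norm_wv_le: "norm (wv \<xi>) \<le> 2 * pi * jb \<xi> powr (1 / 2)"
proof -
  have "norm (freq \<xi>) \<le> sqrt (jb \<xi>)" by (rule real_le_rsqrt) (simp add: jb_def)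
  then show ?thesis by (simp add: wv_def jb_powr_half)
qed

lemma jb_peetre: "jb \<xi> \<le> 2 * jb (\<xi> - \<eta>) * jb \<eta>"
proof -
  let ?a = "norm (freq (\<xi> - \<eta>))" and ?b = "norm (freq \<eta>)"
  have "norm (freq \<xi>) \<le> ?a + ?b" using norm_triangle_ineq[of "freq (\<xi> - \<eta>)" "freq \<eta>"] by simp
  hence "(norm (freq \<xi>))\<^sup>2 \<le> (?a + ?b)\<^sup>2" by (intro power_mono) auto
  also have "\<dots> \<le> 2 * ?a\<^sup>2 + 2 * ?b\<^sup>2"
    using sum_squares_bound[of ?a ?b] by (simp add: power2_sum)
  finally have "(norm (freq \<xi>))\<^sup>2 \<le> 2 * ?a\<^sup>2 + 2 * ?b\<^sup>2" .
  moreover have "2 * (1 + ?a\<^sup>2) * (1 + ?b\<^sup>2) = 2 + 2 * ?a\<^sup>2 + 2 * ?b\<^sup>2 + 2 * (?a\<^sup>2 * ?b\<^sup>2)"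
    by (simp add: algebra_simps)
  moreover have "0 \<le> ?a\<^sup>2 * ?b\<^sup>2" by simp
  ultimately have "1 + (norm (freq \<xi>))\<^sup>2 \<le> 2 * (1 + ?a\<^sup>2) * (1 + ?b\<^sup>2)" by linarith
  then show ?thesis by (simp add: jb_def)
qed

lemma jb_minus_commute: "jb (\<xi> - \<eta>) = jb (\<eta> - \<xi>)"
  by (simp add: jb_def norm_minus_commute)

lemma jb_powr_peetre: "jb \<xi> powr r \<le> 2 powr \<bar>r\<bar> * jb (\<xi> - \<eta>) powr \<bar>r\<bar> * jb \<eta> powr r"
proof (cases "r \<ge> 0")
  case True
  have "jb \<xi> powr r \<le> (2 * jb (\<xi> - \<eta>) * jb \<eta>) powr r"
    using True by (intro powr_mono2 jb_peetre) auto
  then show ?thesis using True by (simp add: powr_mult)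
next
  case False
  define q where "q = - r"
  have q: "q > 0" "r = - q" using False by (auto simp: q_def)
  have "jb \<eta> powr q \<le> (2 * jb (\<xi> - \<eta>) * jb \<xi>) powr q"
    using q jb_peetre[of \<eta> \<xi>] by (intro powr_mono2) (auto simp: jb_minus_commute[of \<xi>])
  hence "jb \<eta> powr q \<le> 2 powr q * jb (\<xi> - \<eta>) powr q * jb \<xi> powr q" by (simp add: powr_mult)
  then show ?thesis using q by (simp add: powr_minus field_simps)
qed

definition adv_symbol :: "(int^'n::finite \<Rightarrow> complex^'n) \<Rightarrow> int^'n \<Rightarrow> int^'n \<Rightarrow> complex"
  where "adv_symbol V \<xi> \<eta> = (\<Sum>j\<in>UNIV. V (\<xi> - \<eta>) $ j * (\<i> * of_real (wv \<eta> $ j)))"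

definition adv :: "(int^'n::finite \<Rightarrow> complex^'n) \<Rightarrow> (int^'n \<Rightarrow> complex^'n) \<Rightarrow> int^'n \<Rightarrow> complex^'n"
  where "adv V u \<xi> = (\<chi> k. \<Sum>\<^sub>\<infinity>\<eta>. adv_symbol V \<xi> \<eta> * u \<eta> $ k)"

definition l1_size :: "(int^'n::finite \<Rightarrow> complex^'n) \<Rightarrow> int^'n \<Rightarrow> real"
  where "l1_size V \<zeta> = (\<Sum>j\<in>UNIV. cmod (V \<zeta> $ j))"

lemma l1_size_nonneg [simp]: "0 \<le> l1_size V \<zeta>"
  by (simp add: l1_size_def sum_nonneg)

lemma adv_symbol_le: "cmod (adv_symbol V \<xi> \<eta>) \<le> l1_size V (\<xi> - \<eta>) * norm (wv \<eta>)"
  unfolding adv_symbol_def l1_size_def sum_distrib_right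
  by (rule sum_norm_le) (simp add: norm_mult mult_left_mono component_le_norm_cart)

definition rapid_vec :: "(int^'n::finite \<Rightarrow> complex^'n) \<Rightarrow> bool"
  where "rapid_vec V \<longleftrightarrow> (\<forall>j. rapid (\<lambda>\<xi>. V \<xi> $ j))"

lemma l1_size_summable:
  assumes "rapid_vec V"
  shows "(\<lambda>\<zeta>. jb \<zeta> powr r * l1_size V \<zeta>) summable_on UNIV"
proof -
  define k where "k = nat \<lceil>\<bar>r\<bar>\<rceil>"
  have s: "(\<lambda>\<zeta>. jb \<zeta> ^ k * l1_size V \<zeta>) summable_on UNIV"
    unfolding l1_size_def sum_distrib_left
    using assms by (intro summable_on_finite_sum(1) rapid_summable) (simp add: rapid_vec_def)
  show ?thesis
  proof (rule summable_on_dominated(1)[OF s])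
    fix \<zeta> :: "int^'a"
    have "jb \<zeta> powr r \<le> jb \<zeta> powr real k" unfolding k_def by (intro powr_mono) (auto, linarith)
    then show "norm (jb \<zeta> powr r * l1_size V \<zeta>) \<le> jb \<zeta> ^ k * l1_size V \<zeta>"
      by (simp add: powr_realpow abs_mult mult_right_mono)
  qed
qed

definition adv_kernel :: "(int^'n::finite \<Rightarrow> complex^'n) \<Rightarrow> real \<Rightarrow> int^'n \<Rightarrow> real"
  where "adv_kernel V r \<zeta> = 2 * pi * 2 powr \<bar>r / 2\<bar> * (jb \<zeta> powr \<bar>r / 2\<bar> * l1_size V \<zeta>)"

lemma adv_kernel_nonneg [simp]: "0 \<le> adv_kernel V r \<zeta>"
  by (simp add: adv_kernel_def)

lemma adv_kernel_summable: "rapid_vec V \<Longrightarrow> adv_kernel V r summable_on UNIV"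
  unfolding adv_kernel_def by (intro summable_on_cmult_right l1_size_summable)

lemma adv_term_le:
  "jb \<xi> powr (r / 2) * cmod (adv_symbol V \<xi> \<eta> * u \<eta> $ k) \<le>
    adv_kernel V r (\<xi> - \<eta>) * (jb \<eta> powr ((r + 1) / 2) * norm (u \<eta>))"
proof -
  have "cmod (adv_symbol V \<xi> \<eta> * u \<eta> $ k) \<le> (l1_size V (\<xi> - \<eta>) * (2 * pi * jb \<eta> powr (1 / 2))) * norm (u \<eta>)"
    unfolding norm_mult
    by (intro mult_mono order_trans[OF adv_symbol_le] mult_left_mono norm_wv_le Finite_Cartesian_Product.norm_nth_le) auto
  hence "jb \<xi> powr (r / 2) * cmod (adv_symbol V \<xi> \<eta> * u \<eta> $ k) \<le>
      (2 powr \<bar>r / 2\<bar> * jb (\<xi> - \<eta>) powr \<bar>r / 2\<bar> * jb \<eta> powr (r / 2)) *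
      ((l1_size V (\<xi> - \<eta>) * (2 * pi * jb \<eta> powr (1 / 2))) * norm (u \<eta>))"
    by (intro mult_mono jb_powr_peetre) auto
  also have "\<dots> = adv_kernel V r (\<xi> - \<eta>) * ((jb \<eta> powr (r / 2) * jb \<eta> powr (1 / 2)) * norm (u \<eta>))"
    by (simp add: adv_kernel_def)
  also have "jb \<eta> powr (r / 2) * jb \<eta> powr (1 / 2) = jb \<eta> powr ((r + 1) / 2)"
    by (simp add: add_divide_distrib flip: powr_add)
  finally show ?thesis .
qed

lemma adv_bounded:
  fixes u :: "int^'n::finite \<Rightarrow> complex^'n"
  assumes V: "rapid_vec V" and u: "hs (r + 1) u"
  shows "(\<lambda>\<eta>. adv_symbol V \<xi> \<eta> * u \<eta> $ k) summable_on UNIV"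
    and "hs r (adv V u)"
    and "hnorm r (adv V u) \<le> (CARD('n) * infsum (adv_kernel V r) UNIV) * hnorm (r + 1) u"
proof -
  let ?b = "\<lambda>\<eta>. jb \<eta> powr ((r + 1) / 2) * norm (u \<eta>)"
  have b: "l2 ?b" using u by (simp add: hs_def)
  note conv = l2_convolution[OF adv_kernel_summable[OF V, of r] adv_kernel_nonneg b]
  have dom: "norm (jb \<xi> powr (r / 2) *\<^sub>R (adv_symbol V \<xi> \<eta> * u \<eta> $ k)) \<le> adv_kernel V r (\<xi> - \<eta>) * ?b \<eta>" for \<xi> \<eta> k
    using adv_term_le[of \<xi> r V \<eta> u k] by simp
  have s: "(\<lambda>\<eta>. jb \<xi> powr (r / 2) *\<^sub>R (adv_symbol V \<xi> \<eta> * u \<eta> $ k)) summable_on UNIV" for \<xi> k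
    by (rule summable_on_dominated(1)[OF conv(1) dom])
  have "(\<lambda>\<eta>. inverse (jb \<xi> powr (r / 2)) *\<^sub>R (jb \<xi> powr (r / 2) *\<^sub>R (adv_symbol V \<xi> \<eta> * u \<eta> $ k))) summable_on UNIV" for \<xi> k
    by (intro summable_on_scaleR_right s)
  then show sum: "(\<lambda>\<eta>. adv_symbol V \<xi> \<eta> * u \<eta> $ k) summable_on UNIV" for \<xi> k
    by simp
  let ?c = "\<lambda>\<xi>. \<Sum>\<^sub>\<infinity>\<eta>. adv_kernel V r (\<xi> - \<eta>) * ?b \<eta>"
  have le: "jb \<xi> powr (r / 2) * norm (adv V u \<xi>) \<le> CARD('n) * ?c \<xi>" for \<xi>
  proof -
    have "jb \<xi> powr (r / 2) * cmod (adv V u \<xi> $ k) \<le> ?c \<xi>" for k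
    proof -
      have "norm (\<Sum>\<^sub>\<infinity>\<eta>. jb \<xi> powr (r / 2) *\<^sub>R (adv_symbol V \<xi> \<eta> * u \<eta> $ k)) \<le> ?c \<xi>"
        by (rule summable_on_dominated(2)[OF conv(1) dom])
      then show ?thesis by (simp add: infsum_scaleR_right adv_def)
    qed
    hence "(\<Sum>k\<in>UNIV. jb \<xi> powr (r / 2) * cmod (adv V u \<xi> $ k)) \<le> (\<Sum>k\<in>(UNIV :: 'n set). ?c \<xi>)"
      by (intro sum_mono)
    moreover have "norm (adv V u \<xi>) \<le> (\<Sum>k\<in>UNIV. cmod (adv V u \<xi> $ k))"
      unfolding norm_vec_def by (rule L2_set_le_sum) simp
    hence "jb \<xi> powr (r / 2) * norm (adv V u \<xi>) \<le> jb \<xi> powr (r / 2) * (\<Sum>k\<in>UNIV. cmod (adv V u \<xi> $ k))"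
      by (intro mult_left_mono) auto
    ultimately show ?thesis by (simp add: sum_distrib_left)
  qed
  have c: "l2 (\<lambda>\<xi>. CARD('n) * ?c \<xi>)" "l2norm (\<lambda>\<xi>. CARD('n) * ?c \<xi>) = CARD('n) * l2norm ?c"
    using l2_cmult[OF conv(2), of "real CARD('n)"] by simp_all
  have le': "\<bar>jb \<xi> powr (r / 2) * norm (adv V u \<xi>)\<bar> \<le> \<bar>CARD('n) * ?c \<xi>\<bar>" for \<xi>
    using le[of \<xi>] by simp
  show "hs r (adv V u)" using l2_le(1)[OF c(1) le'] by (simp add: hs_def)
  have "hnorm r (adv V u) \<le> CARD('n) * l2norm ?c"
    using l2_le(2)[OF c(1) le'] c(2) by (simp add: hnorm_def)
  also have "\<dots> \<le> CARD('n) * (infsum (adv_kernel V r) UNIV * l2norm ?b)"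
    by (intro mult_left_mono conv(3)) auto
  finally show "hnorm r (adv V u) \<le> (CARD('n) * infsum (adv_kernel V r) UNIV) * hnorm (r + 1) u"
    by (simp add: hnorm_def)
qed

lemma adv_add:
  assumes "rapid_vec V" "hs r u" "hs r v"
  shows "adv V (\<lambda>\<xi>. u \<xi> + v \<xi>) \<xi> = adv V u \<xi> + adv V v \<xi>"
  using adv_bounded(1)[of V "r - 1" u] adv_bounded(1)[of V "r - 1" v] assms
  by (simp add: adv_def vec_eq_iff ring_distribs infsum_add)

lemma inner_mult_complex: "w \<bullet> (- (cnj m) * z) = - (z \<bullet> (m * (w :: complex)))"
  by (simp add: inner_complex_expand algebra_simps)

text \<open>
  Integration by parts in \<open>((U \<cdot> \<nabla>) v, v)\<close>: for a real divergence-free field the kernel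
  \<open>adv_symbol V \<xi> \<eta>\<close> is skew-Hermitian.
\<close>

lemma adv_energy:
  fixes v :: "int^'n::finite \<Rightarrow> complex^'n"
  assumes V: "rapid_vec V" and sym: "\<And>\<zeta> j. V (- \<zeta>) $ j = cnj (V \<zeta> $ j)"
    and div: "\<And>\<zeta>. (\<Sum>j\<in>UNIV. of_real (wv \<zeta> $ j) * V \<zeta> $ j) = 0" and v: "hs 1 v"
  shows "((\<lambda>\<xi>. v \<xi> \<bullet> adv V v \<xi>) has_sum 0) UNIV"
proof -
  define R where "R \<xi> \<eta> = (\<Sum>k\<in>UNIV. v \<xi> $ k \<bullet> (adv_symbol V \<xi> \<eta> * v \<eta> $ k))" for \<xi> \<eta>
  have skew: "adv_symbol V \<eta> \<xi> = - cnj (adv_symbol V \<xi> \<eta>)" for \<xi> \<eta>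
  proof -
    have "(\<Sum>j\<in>UNIV. V (\<xi> - \<eta>) $ j * (\<i> * of_real (wv \<xi> $ j))) - adv_symbol V \<xi> \<eta> =
        \<i> * (\<Sum>j\<in>UNIV. of_real (wv (\<xi> - \<eta>) $ j) * V (\<xi> - \<eta>) $ j)"
      by (simp add: adv_symbol_def sum_distrib_left algebra_simps flip: sum_subtractf)
    hence e: "adv_symbol V \<xi> \<eta> = (\<Sum>j\<in>UNIV. V (\<xi> - \<eta>) $ j * (\<i> * of_real (wv \<xi> $ j)))"
      unfolding div by simp
    have "V (\<eta> - \<xi>) $ j = cnj (V (\<xi> - \<eta>) $ j)" for j using sym[of "\<xi> - \<eta>" j] by simp
    then show ?thesis unfolding e by (simp add: adv_symbol_def cnj_sum flip: sum_negf)
  qed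
  have R: "R \<eta> \<xi> = - R \<xi> \<eta>" for \<xi> \<eta>
    unfolding R_def skew[of \<eta> \<xi>] inner_mult_complex by (simp add: sum_negf)
  have Rle: "norm (R \<xi> \<eta>) \<le> norm (v \<xi>) * (CARD('n) * l1_size V (\<xi> - \<eta>) * (norm (wv \<eta>) * norm (v \<eta>)))" for \<xi> \<eta>
  proof -
    have "norm (R \<xi> \<eta>) \<le> (\<Sum>k\<in>(UNIV :: 'n set). norm (v \<xi>) * ((l1_size V (\<xi> - \<eta>) * norm (wv \<eta>)) * norm (v \<eta>)))"
      unfolding R_def
    proof (rule sum_norm_le)
      fix k
      have "norm (v \<xi> $ k \<bullet> (adv_symbol V \<xi> \<eta> * v \<eta> $ k)) \<le> cmod (v \<xi> $ k) * (cmod (adv_symbol V \<xi> \<eta>) * cmod (v \<eta> $ k))"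
        using cmod_inner_le[of "v \<xi> $ k" "adv_symbol V \<xi> \<eta> * v \<eta> $ k"] by (simp add: norm_mult)
      also have "\<dots> \<le> norm (v \<xi>) * ((l1_size V (\<xi> - \<eta>) * norm (wv \<eta>)) * norm (v \<eta>))"
        by (intro mult_mono adv_symbol_le Finite_Cartesian_Product.norm_nth_le) auto
      finally show "norm (v \<xi> $ k \<bullet> (adv_symbol V \<xi> \<eta> * v \<eta> $ k)) \<le> norm (v \<xi>) * ((l1_size V (\<xi> - \<eta>) * norm (wv \<eta>)) * norm (v \<eta>))" .
    qed
    then show ?thesis by (simp add: mult_ac)
  qed
  have Rs: "(\<lambda>(\<xi>, \<eta>). R \<xi> \<eta>) summable_on UNIV \<times> UNIV"
  proof (rule summable_on_dominated(1))
    show "(\<lambda>(\<xi>, \<eta>). norm (v \<xi>) * ((CARD('n) * l1_size V (\<xi> - \<eta>)) * (norm (wv \<eta>) * norm (v \<eta>)))) summable_on UNIV \<times> UNIV"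
    proof (rule summable_on_trilinear)
      show "(\<lambda>\<zeta>. CARD('n) * l1_size V \<zeta>) summable_on UNIV"
        using l1_size_summable[OF V, of 0] by (intro summable_on_cmult_right) simp
      have "hs 0 v" by (rule hs_mono(1)[OF v]) simp
      then show "l2 (\<lambda>\<xi>. norm (v \<xi>))" by (simp add: hs_def)
      have "l2 (\<lambda>\<eta>. 2 * pi * (jb \<eta> powr (1 / 2) * norm (v \<eta>)))"
        using v by (intro l2_cmult) (simp add: hs_def)
      then show "l2 (\<lambda>\<eta>. norm (wv \<eta>) * norm (v \<eta>))"
      proof (rule l2_le(1))
        show "\<bar>norm (wv \<eta>) * norm (v \<eta>)\<bar> \<le> \<bar>2 * pi * (jb \<eta> powr (1 / 2) * norm (v \<eta>))\<bar>" for \<eta>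
          using mult_right_mono[OF norm_wv_le, of "norm (v \<eta>)" \<eta>] by (simp add: abs_mult mult.assoc)
      qed
    qed auto
  qed (use Rle in auto)
  have inner: "((\<lambda>\<eta>. R \<xi> \<eta>) has_sum (v \<xi> \<bullet> adv V v \<xi>)) UNIV" for \<xi>
    unfolding R_def inner_vec_def
  proof (rule has_sum_finite_sum)
    fix k
    have "((\<lambda>\<eta>. adv_symbol V \<xi> \<eta> * v \<eta> $ k) has_sum adv V v \<xi> $ k) UNIV"
      unfolding adv_def vec_lambda_beta
      by (rule has_sum_infsum) (use adv_bounded(1)[OF V, of 0 v] v in simp)
    then show "((\<lambda>\<eta>. v \<xi> $ k \<bullet> (adv_symbol V \<xi> \<eta> * v \<eta> $ k)) has_sum v \<xi> $ k \<bullet> adv V v \<xi> $ k) UNIV"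
      by (rule has_sum_bounded_linear[OF bounded_linear_inner_right])
  qed
  have eq: "v \<xi> \<bullet> adv V v \<xi> = (\<Sum>\<^sub>\<infinity>\<eta>. R \<xi> \<eta>)" for \<xi> using infsumI[OF inner] by simp
  have "(\<Sum>\<^sub>\<infinity>\<xi>. \<Sum>\<^sub>\<infinity>\<eta>. R \<xi> \<eta>) = (\<Sum>\<^sub>\<infinity>\<eta>. \<Sum>\<^sub>\<infinity>\<xi>. R \<xi> \<eta>)" by (rule infsum_swap_banach[OF Rs])
  also have "\<dots> = (\<Sum>\<^sub>\<infinity>\<eta>. \<Sum>\<^sub>\<infinity>\<xi>. - R \<eta> \<xi>)" by (subst R) simp
  also have "\<dots> = - (\<Sum>\<^sub>\<infinity>\<xi>. \<Sum>\<^sub>\<infinity>\<eta>. R \<xi> \<eta>)" by (simp add: infsum_uminus)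
  finally have "(\<Sum>\<^sub>\<infinity>\<xi>. v \<xi> \<bullet> adv V v \<xi>) = 0" by (simp add: eq)
  moreover have "(\<lambda>\<xi>. v \<xi> \<bullet> adv V v \<xi>) summable_on UNIV"
    unfolding eq by (rule summable_on_Sigma_banach[OF Rs])
  ultimately show ?thesis by (simp add: has_sum_iff)
qed

section \<open>The Stokes symbol\<close>

definition visc_symbol :: "'n::finite tensor \<Rightarrow> real^'n \<Rightarrow> complex^'n \<Rightarrow> complex^'n"
  where "visc_symbol A \<kappa> w = (\<chi> k. \<Sum>j\<in>UNIV. \<Sum>\<alpha>\<in>UNIV. \<Sum>\<beta>\<in>UNIV. (A k j \<alpha> \<beta> * \<kappa> $ \<alpha> * \<kappa> $ \<beta>) *\<^sub>R w $ j)"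

definition cdot :: "real^'n::finite \<Rightarrow> complex^'n \<Rightarrow> complex"
  where "cdot \<kappa> w = (\<Sum>k\<in>UNIV. \<kappa> $ k *\<^sub>R w $ k)"

definition cvec :: "real^'n::finite \<Rightarrow> complex \<Rightarrow> complex^'n"
  where "cvec \<kappa> q = (\<chi> k. \<kappa> $ k *\<^sub>R q)"

lemma visc_symbol_linear:
  "visc_symbol A \<kappa> (v + w) = visc_symbol A \<kappa> v + visc_symbol A \<kappa> w"
  "visc_symbol A \<kappa> (v - w) = visc_symbol A \<kappa> v - visc_symbol A \<kappa> w"
  "visc_symbol A \<kappa> (a *\<^sub>R v) = a *\<^sub>R visc_symbol A \<kappa> v"
  "visc_symbol A 0 v = 0" "visc_symbol A \<kappa> 0 = 0"
  by (simp_all add: visc_symbol_def vec_eq_iff algebra_simps sum.distrib sum_subtractf scaleR_sum_right)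

lemma cdot_linear:
  "cdot \<kappa> (v + w) = cdot \<kappa> v + cdot \<kappa> w" "cdot \<kappa> (v - w) = cdot \<kappa> v - cdot \<kappa> w"
  "cdot \<kappa> (a *\<^sub>R v) = a *\<^sub>R cdot \<kappa> v" "cdot 0 v = 0" "cdot \<kappa> 0 = 0"
  by (simp_all add: cdot_def algebra_simps sum.distrib sum_subtractf scaleR_sum_right)

lemma cvec_linear:
  "cvec \<kappa> (p + q) = cvec \<kappa> p + cvec \<kappa> q" "cvec \<kappa> (a *\<^sub>R q) = a *\<^sub>R cvec \<kappa> q" "cvec 0 q = 0" "cvec \<kappa> 0 = 0"
  by (simp_all add: cvec_def vec_eq_iff algebra_simps)

lemma inner_cvec: "v \<bullet> cvec \<kappa> q = cdot \<kappa> v \<bullet> q"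
  by (simp add: inner_vec_def cvec_def cdot_def inner_sum_left)

lemma norm_vec_real_squared: "(norm (x :: real^'n::finite))\<^sup>2 = (\<Sum>k\<in>UNIV. (x $ k)\<^sup>2)"
  unfolding power2_norm_eq_inner inner_vec_def by (simp add: power2_eq_square)

lemma cdot_cvec: "cdot \<kappa> (cvec \<kappa> q) = (norm \<kappa>)\<^sup>2 *\<^sub>R q"
  unfolding norm_vec_real_squared scaleR_sum_left by (simp add: power2_eq_square cdot_def cvec_def)

lemma norm_cvec: "norm (cvec \<kappa> q) = norm \<kappa> * cmod q"
proof -
  have "(norm (cvec \<kappa> q))\<^sup>2 = (norm \<kappa> * cmod q)\<^sup>2"
    by (simp add: norm_vec_squared cvec_def norm_vec_real_squared power_mult_distrib sum_distrib_right)
  then show ?thesis by (rule power2_eq_imp_eq) auto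
qed

lemma norm_cdot_le: "cmod (cdot \<kappa> w) \<le> CARD('n) * norm \<kappa> * norm (w :: complex^'n::finite)"
proof -
  have "cmod (cdot \<kappa> w) \<le> (\<Sum>k\<in>(UNIV :: 'n set). norm \<kappa> * norm w)"
    unfolding cdot_def
    by (rule sum_norm_le)
      (simp add: mult_mono component_le_norm_cart Finite_Cartesian_Product.norm_nth_le)
  then show ?thesis by (simp add: mult.assoc)
qed

lemma tensor_entry_le: "\<bar>A k j \<alpha> \<beta>\<bar> \<le> tensor_norm (A :: 'n::finite tensor)"
proof -
  have e: "{\<bar>A k j \<alpha> \<beta>\<bar> |k j \<alpha> \<beta>. True} = (\<lambda>(k, j, \<alpha>, \<beta>). \<bar>A k j \<alpha> \<beta>\<bar>) ` UNIV"
    by (auto simp: image_iff; blast)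
  have "finite {\<bar>A k j \<alpha> \<beta>\<bar> |k j \<alpha> \<beta>. True}" unfolding e by simp
  then show ?thesis unfolding tensor_norm_def by (rule Max_ge) blast
qed

lemma norm_visc_symbol_le:
  fixes w :: "complex^'n::finite"
  shows "norm (visc_symbol A \<kappa> w) \<le> CARD('n) ^ 4 * tensor_norm A * (norm \<kappa>)\<^sup>2 * norm w"
proof -
  have entry: "norm ((A k j \<alpha> \<beta> * \<kappa> $ \<alpha> * \<kappa> $ \<beta>) *\<^sub>R w $ j) \<le> tensor_norm A * norm \<kappa> * norm \<kappa> * norm w" for k j \<alpha> \<beta>
  proof -
    have "\<bar>A k j \<alpha> \<beta>\<bar> * \<bar>\<kappa> $ \<alpha>\<bar> * \<bar>\<kappa> $ \<beta>\<bar> * cmod (w $ j) \<le> tensor_norm A * norm \<kappa> * norm \<kappa> * norm w"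
      using order_trans[OF abs_ge_zero tensor_entry_le[of A k j \<alpha> \<beta>]]
      by (intro mult_mono tensor_entry_le component_le_norm_cart Finite_Cartesian_Product.norm_nth_le) auto
    then show ?thesis by (simp add: abs_mult)
  qed
  have "norm (visc_symbol A \<kappa> w) \<le> (\<Sum>k\<in>UNIV. cmod (visc_symbol A \<kappa> w $ k))"
    unfolding norm_vec_def by (rule L2_set_le_sum) simp
  also have "\<dots> \<le> (\<Sum>k\<in>(UNIV :: 'n set). \<Sum>j\<in>(UNIV :: 'n set). \<Sum>\<alpha>\<in>(UNIV :: 'n set). \<Sum>\<beta>\<in>(UNIV :: 'n set).
      tensor_norm A * norm \<kappa> * norm \<kappa> * norm w)"
    unfolding visc_symbol_def vec_lambda_beta
    by (intro sum_mono sum_norm_le entry)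
  also have "\<dots> = CARD('n) ^ 4 * tensor_norm A * (norm \<kappa>)\<^sup>2 * norm w"
    by (simp add: power2_eq_square power4_eq_xxxx)
  finally show ?thesis .
qed

lemma sum4_swap:
  "(\<Sum>k\<in>K. \<Sum>j\<in>J. \<Sum>\<alpha>\<in>L. \<Sum>\<beta>\<in>M. G k j \<alpha> \<beta>) = (\<Sum>j\<in>J. \<Sum>\<beta>\<in>M. \<Sum>k\<in>K. \<Sum>\<alpha>\<in>L. G k j \<alpha> \<beta>)"
proof -
  have "(\<Sum>k\<in>K. \<Sum>j\<in>J. \<Sum>\<alpha>\<in>L. \<Sum>\<beta>\<in>M. G k j \<alpha> \<beta>) = (\<Sum>j\<in>J. \<Sum>k\<in>K. \<Sum>\<alpha>\<in>L. \<Sum>\<beta>\<in>M. G k j \<alpha> \<beta>)"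
    by (rule sum.swap)
  also have "\<dots> = (\<Sum>j\<in>J. \<Sum>k\<in>K. \<Sum>\<beta>\<in>M. \<Sum>\<alpha>\<in>L. G k j \<alpha> \<beta>)"
    by (rule sum.cong[OF refl], rule sum.cong[OF refl], rule sum.swap)
  also have "\<dots> = (\<Sum>j\<in>J. \<Sum>\<beta>\<in>M. \<Sum>k\<in>K. \<Sum>\<alpha>\<in>L. G k j \<alpha> \<beta>)"
    by (rule sum.cong[OF refl], rule sum.swap)
  finally show ?thesis .
qed

text \<open>
  The quadratic form of a symmetric tensor only sees the symmetric part of \<open>x \<otimes> \<kappa>\<close>, which is
  trace free when \<open>x\<close> is orthogonal to \<open>\<kappa>\<close>; this is why relaxed ellipticity suffices.
\<close>

lemma elliptic_real:
  fixes x \<kappa> :: "real^'n::finite"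
  assumes A: "tensor_symmetric A" "relaxed_elliptic A C" and orth: "(\<Sum>k\<in>UNIV. \<kappa> $ k * x $ k) = 0"
  shows "(norm \<kappa>)\<^sup>2 * (norm x)\<^sup>2 \<le> 2 * C * (\<Sum>k\<in>UNIV. \<Sum>j\<in>UNIV. \<Sum>\<alpha>\<in>UNIV. \<Sum>\<beta>\<in>UNIV.
    A k j \<alpha> \<beta> * (x $ k * \<kappa> $ \<alpha>) * (x $ j * \<kappa> $ \<beta>))"
proof -
  define z :: "real^'n^'n" where "z = (\<chi> k \<alpha>. (x $ k * \<kappa> $ \<alpha> + x $ \<alpha> * \<kappa> $ k) / 2)"
  have zn: "z $ k $ \<alpha> = (x $ k * \<kappa> $ \<alpha> + x $ \<alpha> * \<kappa> $ k) / 2" for k \<alpha> by (simp add: z_def)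
  have "z = transpose z" by (simp add: vec_eq_iff transpose_def zn add.commute)
  moreover have "trace z = 0" using orth by (simp add: trace_def zn mult.commute)
  ultimately have ell: "(\<Sum>k\<in>UNIV. \<Sum>\<alpha>\<in>UNIV. z $ k $ \<alpha> * z $ k $ \<alpha>) \<le>
      C * (\<Sum>k\<in>UNIV. \<Sum>j\<in>UNIV. \<Sum>\<alpha>\<in>UNIV. \<Sum>\<beta>\<in>UNIV. A k j \<alpha> \<beta> * z $ k $ \<alpha> * z $ j $ \<beta>)"
    using A(2) unfolding relaxed_elliptic_def by blast
  have "(\<Sum>k\<in>UNIV. \<Sum>\<alpha>\<in>UNIV. z $ k $ \<alpha> * z $ k $ \<alpha>) =
      (\<Sum>k\<in>UNIV. \<Sum>\<alpha>\<in>UNIV. (x $ k)\<^sup>2 * (\<kappa> $ \<alpha>)\<^sup>2 / 4 + (\<kappa> $ k)\<^sup>2 * (x $ \<alpha>)\<^sup>2 / 4 + (\<kappa> $ k * x $ k) * (\<kappa> $ \<alpha> * x $ \<alpha>) / 2)"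
    by (intro sum.cong refl) (simp add: zn power2_eq_square field_simps)
  also have "\<dots> = (\<Sum>k\<in>UNIV. (x $ k)\<^sup>2) * (\<Sum>\<alpha>\<in>UNIV. (\<kappa> $ \<alpha>)\<^sup>2) / 4 + (\<Sum>k\<in>UNIV. (\<kappa> $ k)\<^sup>2) * (\<Sum>\<alpha>\<in>UNIV. (x $ \<alpha>)\<^sup>2) / 4
      + (\<Sum>k\<in>UNIV. \<kappa> $ k * x $ k) * (\<Sum>\<alpha>\<in>UNIV. \<kappa> $ \<alpha> * x $ \<alpha>) / 2"
    by (simp only: sum.distrib sum_product sum_divide_distrib)
  also have "\<dots> = (norm \<kappa>)\<^sup>2 * (norm x)\<^sup>2 / 2"
    unfolding orth by (simp add: norm_vec_real_squared)
  finally have lhs: "(\<Sum>k\<in>UNIV. \<Sum>\<alpha>\<in>UNIV. z $ k $ \<alpha> * z $ k $ \<alpha>) = (norm \<kappa>)\<^sup>2 * (norm x)\<^sup>2 / 2" .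
  have s1: "A k j \<alpha> \<beta> = A \<alpha> j k \<beta>" and s2: "A k j \<alpha> \<beta> = A k \<beta> \<alpha> j" for k j \<alpha> \<beta>
    using A(1) unfolding tensor_symmetric_def by blast+
  have half: "(\<Sum>k\<in>UNIV. \<Sum>\<alpha>\<in>UNIV. B k \<alpha> * z $ k $ \<alpha>) = (\<Sum>k\<in>UNIV. \<Sum>\<alpha>\<in>UNIV. B k \<alpha> * (x $ k * \<kappa> $ \<alpha>))"
    if B: "\<And>k \<alpha>. B k \<alpha> = B \<alpha> k" for B :: "'n \<Rightarrow> 'n \<Rightarrow> real"
  proof -
    have "(\<Sum>k\<in>UNIV. \<Sum>\<alpha>\<in>UNIV. B k \<alpha> * z $ k $ \<alpha>) =
        (\<Sum>k\<in>UNIV. \<Sum>\<alpha>\<in>UNIV. B k \<alpha> * (x $ k * \<kappa> $ \<alpha>) / 2) + (\<Sum>k\<in>UNIV. \<Sum>\<alpha>\<in>UNIV. B k \<alpha> * (x $ \<alpha> * \<kappa> $ k) / 2)"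
      by (simp add: zn sum.distrib[symmetric] field_simps)
    also have "(\<Sum>k\<in>UNIV. \<Sum>\<alpha>\<in>UNIV. B k \<alpha> * (x $ \<alpha> * \<kappa> $ k) / 2) = (\<Sum>k\<in>UNIV. \<Sum>\<alpha>\<in>UNIV. B k \<alpha> * (x $ k * \<kappa> $ \<alpha>) / 2)"
      by (subst sum.swap) (intro sum.cong refl, subst B, rule refl)
    finally show ?thesis by (simp only: sum.distrib[symmetric] field_sum_of_halves)
  qed
  have "(\<Sum>k\<in>UNIV. \<Sum>j\<in>UNIV. \<Sum>\<alpha>\<in>UNIV. \<Sum>\<beta>\<in>UNIV. A k j \<alpha> \<beta> * z $ k $ \<alpha> * z $ j $ \<beta>) =
      (\<Sum>j\<in>UNIV. \<Sum>\<beta>\<in>UNIV. (\<Sum>k\<in>UNIV. \<Sum>\<alpha>\<in>UNIV. A k j \<alpha> \<beta> * z $ k $ \<alpha>) * z $ j $ \<beta>)"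
    unfolding sum_distrib_right by (rule sum4_swap)
  also have "\<dots> = (\<Sum>j\<in>UNIV. \<Sum>\<beta>\<in>UNIV. (\<Sum>k\<in>UNIV. \<Sum>\<alpha>\<in>UNIV. A k j \<alpha> \<beta> * (x $ k * \<kappa> $ \<alpha>)) * z $ j $ \<beta>)"
    by (subst half) (auto intro: s1)
  also have "\<dots> = (\<Sum>j\<in>UNIV. \<Sum>\<beta>\<in>UNIV. (\<Sum>k\<in>UNIV. \<Sum>\<alpha>\<in>UNIV. A k j \<alpha> \<beta> * (x $ k * \<kappa> $ \<alpha>)) * (x $ j * \<kappa> $ \<beta>))"
    by (rule half) (intro sum.cong refl, subst s2, rule refl)
  also have "\<dots> = (\<Sum>k\<in>UNIV. \<Sum>j\<in>UNIV. \<Sum>\<alpha>\<in>UNIV. \<Sum>\<beta>\<in>UNIV. A k j \<alpha> \<beta> * (x $ k * \<kappa> $ \<alpha>) * (x $ j * \<kappa> $ \<beta>))"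
    unfolding sum_distrib_right by (rule sum4_swap[symmetric])
  finally show ?thesis using ell unfolding lhs by simp
qed

lemma coercive:
  fixes w :: "complex^'n::finite"
  assumes A: "tensor_symmetric A" "relaxed_elliptic A C" and orth: "cdot \<kappa> w = 0"
  shows "(norm \<kappa>)\<^sup>2 * (norm w)\<^sup>2 \<le> 2 * C * (w \<bullet> visc_symbol A \<kappa> w)"
proof -
  define x y :: "real^'n" where "x = (\<chi> k. Re (w $ k))" and "y = (\<chi> k. Im (w $ k))"
  have o: "(\<Sum>k\<in>UNIV. \<kappa> $ k * x $ k) = 0" "(\<Sum>k\<in>UNIV. \<kappa> $ k * y $ k) = 0"
    using orth by (simp_all add: cdot_def x_def y_def complex_eq_iff)
  let ?q = "\<lambda>x. \<Sum>k\<in>UNIV. \<Sum>j\<in>UNIV. \<Sum>\<alpha>\<in>UNIV. \<Sum>\<beta>\<in>UNIV. A k j \<alpha> \<beta> * (x $ k * \<kappa> $ \<alpha>) * (x $ j * \<kappa> $ \<beta>)"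
  have "w \<bullet> visc_symbol A \<kappa> w = (\<Sum>k\<in>UNIV. \<Sum>j\<in>UNIV. \<Sum>\<alpha>\<in>UNIV. \<Sum>\<beta>\<in>UNIV.
      A k j \<alpha> \<beta> * (x $ k * \<kappa> $ \<alpha>) * (x $ j * \<kappa> $ \<beta>) + A k j \<alpha> \<beta> * (y $ k * \<kappa> $ \<alpha>) * (y $ j * \<kappa> $ \<beta>))"
    unfolding inner_vec_def visc_symbol_def vec_lambda_beta inner_sum_right
    by (intro sum.cong refl) (simp add: inner_complex_expand x_def y_def algebra_simps)
  also have "\<dots> = ?q x + ?q y" by (simp only: sum.distrib)
  finally have e: "w \<bullet> visc_symbol A \<kappa> w = ?q x + ?q y" .
  have "(norm w)\<^sup>2 = (norm x)\<^sup>2 + (norm y)\<^sup>2"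
    by (simp add: norm_vec_squared norm_vec_real_squared x_def y_def cmod_power2 sum.distrib)
  hence "(norm \<kappa>)\<^sup>2 * (norm w)\<^sup>2 = (norm \<kappa>)\<^sup>2 * (norm x)\<^sup>2 + (norm \<kappa>)\<^sup>2 * (norm y)\<^sup>2"
    by (simp add: distrib_left)
  also have "\<dots> \<le> 2 * C * ?q x + 2 * C * ?q y"
    by (intro add_mono elliptic_real A o)
  also have "\<dots> = 2 * C * (w \<bullet> visc_symbol A \<kappa> w)" unfolding e by (simp only: distrib_left)
  finally show ?thesis .
qed

text \<open>At \<open>\<kappa> = 0\<close> this is \<open>0\<close>, as \<open>cvec 0\<close> vanishes.\<close>

definition longitudinal :: "real^'n::finite \<Rightarrow> complex^'n \<Rightarrow> complex^'n"
  where "longitudinal \<kappa> u = cvec \<kappa> (cdot \<kappa> u /\<^sub>R (norm \<kappa>)\<^sup>2)"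

lemma cdot_longitudinal: "cdot \<kappa> (longitudinal \<kappa> u) = cdot \<kappa> u"
  by (cases "\<kappa> = 0") (simp_all add: longitudinal_def cdot_cvec cdot_linear)

lemma norm_longitudinal: "norm \<kappa> * norm (longitudinal \<kappa> u) = cmod (cdot \<kappa> u)"
  by (cases "\<kappa> = 0") (simp_all add: longitudinal_def norm_cvec cdot_linear power2_eq_square field_simps)

lemma transversal_bound:
  fixes v h :: "complex^'n::finite"
  assumes A: "tensor_symmetric A" "relaxed_elliptic A C" and orth: "cdot \<kappa> v = 0"
    and eq: "visc_symbol A \<kappa> v + cvec \<kappa> q = h"
  shows "(norm \<kappa>)\<^sup>2 * (norm v)\<^sup>2 \<le> 2 * C * (v \<bullet> h)"
proof -
  have "v \<bullet> h = v \<bullet> visc_symbol A \<kappa> v"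
    unfolding eq[symmetric] inner_add_right inner_cvec orth by simp
  then show ?thesis using coercive[OF A orth] by simp
qed

definition stokes_const :: "real \<Rightarrow> real \<Rightarrow> real \<Rightarrow> real"
  where "stokes_const C a n = 1 + (1 + n ^ 4 * a) * (2 * C * (1 + n ^ 4 * a) + 1)"

lemma stokes_pointwise:
  fixes u f :: "complex^'n::finite"
  assumes A: "tensor_symmetric A" "relaxed_elliptic A C" "tensor_norm A = a" and \<kappa>: "\<kappa> \<noteq> 0"
    and eq: "visc_symbol A \<kappa> u + cvec \<kappa> (\<i> * p) = f" "\<i> * cdot \<kappa> u = g"
  shows "(norm \<kappa>)\<^sup>2 * norm u \<le> stokes_const C a CARD('n) * (norm f + norm \<kappa> * cmod g)"
    and "norm \<kappa> * cmod p \<le> stokes_const C a CARD('n) * (norm f + norm \<kappa> * cmod g)"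
proof -
  define m where "m = CARD('n) ^ 4 * a"
  have a: "a \<ge> 0" using tensor_entry_le[of A undefined undefined undefined undefined] A(3) by linarith
  have m: "m \<ge> 0" using a by (simp add: m_def)
  have C: "C > 0" using A(2) by (simp add: relaxed_elliptic_def)
  define w v where "w = longitudinal \<kappa> u" and "v = u - w"
  let ?k = "norm \<kappa>" and ?E = "norm f + norm \<kappa> * cmod g"
  have k: "?k > 0" using \<kappa> by simp
  have g: "cmod (cdot \<kappa> u) = cmod g" by (simp add: eq(2)[symmetric] norm_mult)
  have w: "?k * norm w = cmod g" by (simp add: w_def norm_longitudinal g)
  have Mle: "norm (visc_symbol A \<kappa> x) \<le> m * ?k\<^sup>2 * norm x" for x
    using norm_visc_symbol_le[of A \<kappa> x] by (simp add: m_def A(3))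
  have vo: "cdot \<kappa> v = 0" by (simp add: v_def w_def cdot_linear cdot_longitudinal)
  have "visc_symbol A \<kappa> v + cvec \<kappa> (\<i> * p) = f - visc_symbol A \<kappa> w"
    by (simp add: v_def visc_symbol_linear eq(1)[symmetric])
  from transversal_bound[OF A(1,2) vo this]
  have "?k\<^sup>2 * (norm v)\<^sup>2 \<le> 2 * C * (v \<bullet> (f - visc_symbol A \<kappa> w))" .
  also have "\<dots> \<le> 2 * C * (norm v * (norm f + m * ?k\<^sup>2 * norm w))"
  proof (intro mult_left_mono)
    have "v \<bullet> (f - visc_symbol A \<kappa> w) \<le> norm v * norm (f - visc_symbol A \<kappa> w)" by (rule norm_cauchy_schwarz)
    also have "\<dots> \<le> norm v * (norm f + m * ?k\<^sup>2 * norm w)"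
      using norm_triangle_ineq4[of f "visc_symbol A \<kappa> w"] Mle[of w] by (intro mult_left_mono) auto
    finally show "v \<bullet> (f - visc_symbol A \<kappa> w) \<le> norm v * (norm f + m * ?k\<^sup>2 * norm w)" .
  qed (use C in auto)
  finally have "norm v * (?k\<^sup>2 * norm v) \<le> norm v * (2 * C * (norm f + m * ?k\<^sup>2 * norm w))"
    by (simp add: power2_eq_square mult_ac)
  hence v1: "?k\<^sup>2 * norm v \<le> 2 * C * (norm f + m * ?k\<^sup>2 * norm w)"
  proof (cases "v = 0")
    case False
    then show ?thesis using \<open>norm v * _ \<le> _\<close> by (simp add: mult_le_cancel_left)
  qed (use C m in simp)
  have kw: "?k\<^sup>2 * norm w = ?k * cmod g" by (simp add: power2_eq_square mult.assoc w)
  have "norm f + m * ?k\<^sup>2 * norm w \<le> (1 + m) * ?E"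
  proof -
    have "(1 + m) * ?E = norm f + ?k * cmod g + m * norm f + m * (?k * cmod g)" by (simp add: algebra_simps)
    moreover have "m * ?k\<^sup>2 * norm w = m * (?k * cmod g)" by (simp add: mult.assoc kw)
    moreover have "0 \<le> m * norm f" "0 \<le> ?k * cmod g" using m by simp_all
    ultimately show ?thesis by linarith
  qed
  hence v2: "?k\<^sup>2 * norm v \<le> 2 * C * ((1 + m) * ?E)"
    using v1 C by (meson mult_left_mono order_trans less_imp_le mult_nonneg_nonneg zero_le_numeral)
  have "norm u \<le> norm v + norm w" using norm_triangle_ineq[of v w] by (simp add: v_def)
  hence "?k\<^sup>2 * norm u \<le> ?k\<^sup>2 * norm v + ?k\<^sup>2 * norm w"
    by (simp add: mult_left_mono flip: distrib_left)
  also have "\<dots> \<le> 2 * C * ((1 + m) * ?E) + ?E" using v2 norm_ge_zero[of f] unfolding kw by linarith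
  finally have u': "?k\<^sup>2 * norm u \<le> (2 * C * (1 + m) + 1) * ?E" by (simp add: algebra_simps)
  define D where "D = 2 * C * (1 + m) + 1"
  have u: "?k\<^sup>2 * norm u \<le> D * ?E" using u' by (simp add: D_def)
  have DE: "0 \<le> D * ?E" "0 \<le> m * (D * ?E)" "0 \<le> ?E" using m C by (simp_all add: D_def)
  have K: "stokes_const C a CARD('n) * ?E = ?E + D * ?E + m * (D * ?E)"
    by (simp add: stokes_const_def m_def D_def algebra_simps)
  show "?k\<^sup>2 * norm u \<le> stokes_const C a CARD('n) * ?E" unfolding K using u DE by linarith
  have "?k * cmod p = norm (cvec \<kappa> (\<i> * p))" by (simp add: norm_cvec norm_mult)
  also have "cvec \<kappa> (\<i> * p) = f - visc_symbol A \<kappa> u" by (simp add: eq(1)[symmetric])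
  also have "norm \<dots> \<le> norm f + m * (?k\<^sup>2 * norm u)"
    using norm_triangle_ineq4[of f "visc_symbol A \<kappa> u"] Mle[of u] by (simp add: mult.assoc)
  also have "\<dots> \<le> ?E + m * (D * ?E)"
    using u m by (intro add_mono mult_left_mono) auto
  also have "\<dots> \<le> stokes_const C a CARD('n) * ?E"
    unfolding K using DE by linarith
  finally show "?k * cmod p \<le> stokes_const C a CARD('n) * ?E" .
qed

lemma stokes_solvable:
  fixes f :: "complex^'n::finite"
  assumes A: "tensor_symmetric A" "relaxed_elliptic A C" and \<kappa>: "\<kappa> \<noteq> 0"
  shows "\<exists>u p. visc_symbol A \<kappa> u + cvec \<kappa> (\<i> * p) = f \<and> \<i> * cdot \<kappa> u = g"
proof -
  let ?\<Phi> = "\<lambda>x :: (complex^'n) \<times> complex. (visc_symbol A \<kappa> (fst x) + cvec \<kappa> (\<i> * snd x), \<i> * cdot \<kappa> (fst x))"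
  have lin: "linear ?\<Phi>"
    by (rule linearI) (simp_all add: visc_symbol_linear cvec_linear cdot_linear distrib_left scaleR_add_right)
  have "inj ?\<Phi>"
    unfolding linear_injective_0[OF lin]
  proof (intro allI impI)
    fix x :: "(complex^'n) \<times> complex" assume "?\<Phi> x = 0"
    hence "visc_symbol A \<kappa> (fst x) + cvec \<kappa> (\<i> * snd x) = 0" "\<i> * cdot \<kappa> (fst x) = 0"
      by (simp_all add: zero_prod_def)
    from stokes_pointwise[OF A refl \<kappa> this] \<kappa> show "x = 0"
      by (simp add: mult_le_0_iff prod_eq_iff)
  qed
  from linear_injective_imp_surjective[OF lin this]
  obtain x where "(f, g) = ?\<Phi> x" using surjD by blast
  then show ?thesis by (intro exI[of _ "fst x"] exI[of _ "snd x"]) simp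
qed

section \<open>A priori estimates\<close>

lemma jb_le_wv_squared:
  assumes "\<xi> \<noteq> 0"
  shows "jb \<xi> \<le> (norm (wv \<xi>))\<^sup>2"
proof -
  obtain i where "\<xi> $ i \<noteq> 0" using assms by (auto simp: vec_eq_iff)
  hence "1 \<le> \<bar>freq \<xi> $ i\<bar>" by (simp add: freq_def flip: of_int_abs)
  also have "\<dots> \<le> norm (freq \<xi>)" by (rule component_le_norm_cart)
  finally have "1 \<le> (norm (freq \<xi>))\<^sup>2" by (simp add: one_le_power)
  moreover have "2 * (norm (freq \<xi>))\<^sup>2 \<le> (2 * pi)\<^sup>2 * (norm (freq \<xi>))\<^sup>2"
  proof (rule mult_right_mono)
    have "(2::real)\<^sup>2 \<le> (2 * pi)\<^sup>2" using pi_gt3 by (intro power_mono) auto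
    then show "2 \<le> (2 * pi)\<^sup>2" by simp
  qed simp
  ultimately show ?thesis by (simp add: jb_def wv_def power_mult_distrib)
qed

lemma jb_half_le_wv:
  assumes "\<xi> \<noteq> 0"
  shows "jb \<xi> powr (1 / 2) \<le> norm (wv \<xi>)"
  unfolding jb_powr_half using jb_le_wv_squared[OF assms] by (simp add: real_le_lsqrt)

lemma jb_powr_split: "jb \<xi> powr (s / 2) = jb \<xi> powr ((s - 2) / 2) * jb \<xi>"
  "jb \<xi> powr ((s - 1) / 2) = jb \<xi> powr ((s - 2) / 2) * jb \<xi> powr (1 / 2)"
proof -
  have "s / 2 = (s - 2) / 2 + 1" "(s - 1) / 2 = (s - 2) / 2 + 1 / 2" by (simp_all add: field_simps)
  then show "jb \<xi> powr (s / 2) = jb \<xi> powr ((s - 2) / 2) * jb \<xi>"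
    "jb \<xi> powr ((s - 1) / 2) = jb \<xi> powr ((s - 2) / 2) * jb \<xi> powr (1 / 2)"
    by (simp_all only: powr_add) simp
qed

definition admissible :: "real \<Rightarrow> real \<Rightarrow> 'n::finite tensor \<Rightarrow> bool"
  where "admissible C a A \<longleftrightarrow> tensor_symmetric A \<and> relaxed_elliptic A C \<and> tensor_norm A = a"

lemma admissible_pos:
  assumes "admissible C a (A :: 'n::finite tensor)"
  shows "C > 0" "a \<ge> 0" "stokes_const C a CARD('n) \<ge> 1"
proof -
  show C: "C > 0" using assms by (simp add: admissible_def relaxed_elliptic_def)
  have "\<bar>A undefined undefined undefined undefined\<bar> \<le> a"
    using tensor_entry_le[of A] assms by (auto simp: admissible_def)
  then show a: "a \<ge> 0" by linarith
  show "stokes_const C a CARD('n) \<ge> 1" using C a by (simp add: stokes_const_def)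
qed

lemma stokes_hs:
  fixes u F :: "int^'n::finite \<Rightarrow> complex^'n"
  assumes A: "admissible C a A"
    and eq: "\<And>\<xi>. visc_symbol A (wv \<xi>) (u \<xi>) + cvec (wv \<xi>) (\<i> * p \<xi>) = F \<xi>" "\<And>\<xi>. \<i> * cdot (wv \<xi>) (u \<xi>) = g \<xi>"
    and 0: "u 0 = 0" "p 0 = 0" and F: "hs (s - 2) F" and g: "hs (s - 1) g"
  defines "K \<equiv> 2 * pi * stokes_const C a CARD('n)"
  shows "hs s u" "hnorm s u \<le> K * (hnorm (s - 2) F + hnorm (s - 1) g)"
    and "hs (s - 1) p" "hnorm (s - 1) p \<le> K * (hnorm (s - 2) F + hnorm (s - 1) g)"
proof -
  let ?S = "stokes_const C a CARD('n)"
  have S: "?S \<ge> 1" by (rule admissible_pos(3)[OF A])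
  have K: "K \<ge> 0" using S by (simp add: K_def)
  have E: "?S * (norm (F \<xi>) + norm (wv \<xi>) * cmod (g \<xi>)) \<le> K * norm (F \<xi>) + K * (jb \<xi> powr (1 / 2) * cmod (g \<xi>))" for \<xi>
  proof -
    have "norm (F \<xi>) \<le> 2 * pi * norm (F \<xi>)" using pi_gt3 by (intro mult_le_cancel_right1[THEN iffD2]) auto
    moreover have "norm (wv \<xi>) * cmod (g \<xi>) \<le> 2 * pi * jb \<xi> powr (1 / 2) * cmod (g \<xi>)"
      by (intro mult_right_mono norm_wv_le) auto
    ultimately have "?S * (norm (F \<xi>) + norm (wv \<xi>) * cmod (g \<xi>)) \<le> ?S * (2 * pi * norm (F \<xi>) + 2 * pi * jb \<xi> powr (1 / 2) * cmod (g \<xi>))"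
      using S by (intro mult_left_mono add_mono) auto
    then show ?thesis by (simp add: K_def algebra_simps)
  qed
  have pt: "jb \<xi> * norm (u \<xi>) \<le> K * norm (F \<xi>) + K * (jb \<xi> powr (1 / 2) * cmod (g \<xi>))"
    "jb \<xi> powr (1 / 2) * cmod (p \<xi>) \<le> K * norm (F \<xi>) + K * (jb \<xi> powr (1 / 2) * cmod (g \<xi>))" for \<xi>
  proof -
    have "jb \<xi> * norm (u \<xi>) \<le> ?S * (norm (F \<xi>) + norm (wv \<xi>) * cmod (g \<xi>)) \<and>
        jb \<xi> powr (1 / 2) * cmod (p \<xi>) \<le> ?S * (norm (F \<xi>) + norm (wv \<xi>) * cmod (g \<xi>))"
    proof (cases "\<xi> = 0")
      case True
      then show ?thesis using 0 S by simp
    next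
      case False
      hence w: "wv \<xi> \<noteq> 0" by simp
      have A': "tensor_symmetric A" "relaxed_elliptic A C" "tensor_norm A = a"
        using A by (auto simp: admissible_def)
      note st = stokes_pointwise[OF A' w eq(1) eq(2)]
      have "jb \<xi> * norm (u \<xi>) \<le> (norm (wv \<xi>))\<^sup>2 * norm (u \<xi>)"
        by (intro mult_right_mono jb_le_wv_squared False) auto
      moreover have "jb \<xi> powr (1 / 2) * cmod (p \<xi>) \<le> norm (wv \<xi>) * cmod (p \<xi>)"
        by (intro mult_right_mono jb_half_le_wv False) auto
      ultimately show ?thesis using st by linarith
    qed
    then show "jb \<xi> * norm (u \<xi>) \<le> K * norm (F \<xi>) + K * (jb \<xi> powr (1 / 2) * cmod (g \<xi>))"
      "jb \<xi> powr (1 / 2) * cmod (p \<xi>) \<le> K * norm (F \<xi>) + K * (jb \<xi> powr (1 / 2) * cmod (g \<xi>))"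
      using E[of \<xi>] by linarith+
  qed
  have le: "jb \<xi> powr (s / 2) * norm (u \<xi>) \<le> jb \<xi> powr ((s - 2) / 2) * norm (K *\<^sub>R F \<xi>) + jb \<xi> powr ((s - 1) / 2) * norm (K *\<^sub>R g \<xi>)"
    "jb \<xi> powr ((s - 1) / 2) * norm (p \<xi>) \<le> jb \<xi> powr ((s - 2) / 2) * norm (K *\<^sub>R F \<xi>) + jb \<xi> powr ((s - 1) / 2) * norm (K *\<^sub>R g \<xi>)" for \<xi>
    using mult_left_mono[OF pt(1)[of \<xi>], of "jb \<xi> powr ((s - 2) / 2)"]
      mult_left_mono[OF pt(2)[of \<xi>], of "jb \<xi> powr ((s - 2) / 2)"] K
    unfolding jb_powr_split[of \<xi> s] by (simp_all add: algebra_simps)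
  have h: "hs (s - 2) (\<lambda>\<xi>. K *\<^sub>R F \<xi>)" "hs (s - 1) (\<lambda>\<xi>. K *\<^sub>R g \<xi>)"
    by (intro hs_scaleR F g)+
  have n: "hnorm (s - 2) (\<lambda>\<xi>. K *\<^sub>R F \<xi>) + hnorm (s - 1) (\<lambda>\<xi>. K *\<^sub>R g \<xi>) = K * (hnorm (s - 2) F + hnorm (s - 1) g)"
    using hs_scaleR(2)[OF F, of K] hs_scaleR(2)[OF g, of K] K by (simp add: algebra_simps)
  show "hs s u" "hnorm s u \<le> K * (hnorm (s - 2) F + hnorm (s - 1) g)"
    using hs_add_weighted[OF h le(1)] n by simp_all
  show "hs (s - 1) p" "hnorm (s - 1) p \<le> K * (hnorm (s - 2) F + hnorm (s - 1) g)"
    using hs_add_weighted[OF h le(2)] n by simp_all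
qed

definition div_free :: "(int^'n::finite \<Rightarrow> complex^'n) \<Rightarrow> bool"
  where "div_free V \<longleftrightarrow> rapid_vec V \<and> (\<forall>\<zeta> j. V (- \<zeta>) $ j = cnj (V \<zeta> $ j)) \<and>
    (\<forall>\<zeta>. (\<Sum>j\<in>UNIV. of_real (wv \<zeta> $ j) * V \<zeta> $ j) = 0)"

definition oseen_eq :: "'n::finite tensor \<Rightarrow> (int^'n \<Rightarrow> complex^'n) \<Rightarrow> real \<Rightarrow> (int^'n \<Rightarrow> complex^'n) \<Rightarrow>
    (int^'n \<Rightarrow> complex) \<Rightarrow> (int^'n \<Rightarrow> complex^'n) \<Rightarrow> (int^'n \<Rightarrow> complex) \<Rightarrow> bool"
  where "oseen_eq A V t u p f g \<longleftrightarrow> (\<forall>\<xi>.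
    visc_symbol A (wv \<xi>) (u \<xi>) + cvec (wv \<xi>) (\<i> * p \<xi>) + t *\<^sub>R adv V u \<xi> = f \<xi> \<and>
    \<i> * cdot (wv \<xi>) (u \<xi>) = g \<xi>)"

lemma hnorm_pairing:
  assumes "hs r f" "hs (- r) h"
  shows "(\<lambda>\<xi>. f \<xi> \<bullet> h \<xi>) summable_on UNIV" "(\<Sum>\<^sub>\<infinity>\<xi>. f \<xi> \<bullet> h \<xi>) \<le> hnorm r f * hnorm (- r) h"
proof -
  let ?F = "\<lambda>\<xi>. jb \<xi> powr (r / 2) * norm (f \<xi>)" and ?H = "\<lambda>\<xi>. jb \<xi> powr (- r / 2) * norm (h \<xi>)"
  have l: "l2 ?F" "l2 ?H" using assms by (simp_all add: hs_def)
  have le: "norm (f \<xi> \<bullet> h \<xi>) \<le> ?F \<xi> * ?H \<xi>" for \<xi>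
  proof -
    have "?F \<xi> * ?H \<xi> = (jb \<xi> powr (r / 2) * jb \<xi> powr (- r / 2)) * (norm (f \<xi>) * norm (h \<xi>))" by simp
    also have "\<dots> = norm (f \<xi>) * norm (h \<xi>)" by (simp flip: powr_add)
    finally show ?thesis using Cauchy_Schwarz_ineq2[of "f \<xi>" "h \<xi>"] by (simp only: real_norm_def)
  qed
  show "(\<lambda>\<xi>. f \<xi> \<bullet> h \<xi>) summable_on UNIV" by (rule summable_on_dominated(1)[OF l2_mult(1)[OF l] le])
  have "(\<Sum>\<^sub>\<infinity>\<xi>. f \<xi> \<bullet> h \<xi>) \<le> (\<Sum>\<^sub>\<infinity>\<xi>. ?F \<xi> * ?H \<xi>)"
    using summable_on_dominated(2)[OF l2_mult(1)[OF l] le] by simp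
  also have "\<dots> \<le> hnorm r f * hnorm (- r) h" using l2_mult(2)[OF l] by (simp add: hnorm_def)
  finally show "(\<Sum>\<^sub>\<infinity>\<xi>. f \<xi> \<bullet> h \<xi>) \<le> hnorm r f * hnorm (- r) h" .
qed

lemma energy_estimate:
  fixes V :: "int^'n::finite \<Rightarrow> complex^'n"
  assumes V: "div_free V"
  shows "\<exists>K\<ge>0. \<forall>A t u p f g. admissible C a A \<longrightarrow> 0 \<le> t \<longrightarrow> t \<le> 1 \<longrightarrow> oseen_eq A V t u p f g \<longrightarrow> u 0 = 0 \<longrightarrow>
    hs 1 u \<longrightarrow> hs (-1) f \<longrightarrow> hs 0 g \<longrightarrow> hnorm 1 u \<le> K * (hnorm (-1) f + hnorm 0 g)"
proof -
  define b where "b = CARD('n) * infsum (adv_kernel V 0) UNIV"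
  define m where "m = CARD('n) ^ 4 * a * (2 * pi)"
  define K where "K = 2 * C * (1 + (m + b)) + 1"
  have b: "b \<ge> 0" unfolding b_def by (intro mult_nonneg_nonneg infsum_nonneg) auto
  have Vr: "rapid_vec V" using V by (simp add: div_free_def)
  have main: "hnorm 1 u \<le> K * (hnorm (-1) f + hnorm 0 g) \<and> 0 \<le> K"
    if A: "admissible C a A" and t: "0 \<le> t" "t \<le> 1" and eq: "oseen_eq A V t u p f g" and u0: "u 0 = 0"
      and u: "hs 1 u" and f: "hs (-1) f" and g: "hs 0 g" for A t u p f g
  proof -
    note pos = admissible_pos[OF A]
    have m: "m \<ge> 0" using pos by (simp add: m_def)
    define w v where "w \<xi> = longitudinal (wv \<xi>) (u \<xi>)" and "v \<xi> = u \<xi> - w \<xi>" for \<xi>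
    have gn: "cmod (cdot (wv \<xi>) (u \<xi>)) = cmod (g \<xi>)" for \<xi>
    proof -
      have "g \<xi> = \<i> * cdot (wv \<xi>) (u \<xi>)" using eq by (simp add: oseen_eq_def)
      then show ?thesis by (simp add: norm_mult)
    qed
    have kw: "norm (wv \<xi>) * norm (w \<xi>) = cmod (g \<xi>)" for \<xi> by (simp add: w_def norm_longitudinal gn)
    have w0: "w 0 = 0" by (simp add: w_def longitudinal_def cvec_linear)
    have jw: "jb \<xi> powr (1 / 2) * norm (w \<xi>) \<le> 1 * (jb \<xi> powr (0 / 2) * norm (g \<xi>))" for \<xi>
    proof (cases "\<xi> = 0")
      case False
      have "jb \<xi> powr (1 / 2) * norm (w \<xi>) \<le> norm (wv \<xi>) * norm (w \<xi>)"
        by (intro mult_right_mono jb_half_le_wv False) auto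
      then show ?thesis by (simp add: kw)
    qed (simp add: w0)
    have w: "hs 1 w" "hnorm 1 w \<le> hnorm 0 g" using hs_weighted_le[OF g jw] by simp_all
    have v: "hs 1 v" unfolding v_def by (intro hs_diff u w)
    have advw: "hs (-1) (adv V w)" "hnorm (-1) (adv V w) \<le> b * hnorm 0 g"
    proof -
      have w': "hs (0 + 1) w" using w by simp
      note bd = adv_bounded(2,3)[OF Vr w']
      show "hs (-1) (adv V w)" by (rule hs_mono(1)[OF bd(1)]) simp
      have "hnorm (-1) (adv V w) \<le> hnorm 0 (adv V w)" by (rule hs_mono(2)[OF bd(1)]) simp
      also have "\<dots> \<le> b * hnorm 1 w" using bd(2) by (simp add: b_def)
      also have "\<dots> \<le> b * hnorm 0 g" by (intro mult_left_mono w b)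
      finally show "hnorm (-1) (adv V w) \<le> b * hnorm 0 g" .
    qed
    define Mw where "Mw \<xi> = visc_symbol A (wv \<xi>) (w \<xi>)" for \<xi>
    have Mw: "hs (-1) Mw" "hnorm (-1) Mw \<le> m * hnorm 0 g"
    proof -
      have "jb \<xi> powr (-1 / 2) * norm (Mw \<xi>) \<le> m * (jb \<xi> powr (0 / 2) * norm (g \<xi>))" for \<xi>
      proof -
        have "norm (Mw \<xi>) \<le> CARD('n) ^ 4 * a * (norm (wv \<xi>))\<^sup>2 * norm (w \<xi>)"
          using norm_visc_symbol_le[of A "wv \<xi>" "w \<xi>"] A by (simp add: Mw_def admissible_def)
        also have "\<dots> = CARD('n) ^ 4 * a * (norm (wv \<xi>) * cmod (g \<xi>))" by (simp add: power2_eq_square mult.assoc kw)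
        also have "\<dots> \<le> CARD('n) ^ 4 * a * ((2 * pi * jb \<xi> powr (1 / 2)) * cmod (g \<xi>))"
          using pos by (intro mult_left_mono mult_right_mono norm_wv_le) auto
        finally have "jb \<xi> powr (-1 / 2) * norm (Mw \<xi>) \<le> jb \<xi> powr (-1 / 2) * (m * (jb \<xi> powr (1 / 2) * cmod (g \<xi>)))"
          by (intro mult_left_mono) (auto simp: m_def mult_ac)
        also have "\<dots> = (jb \<xi> powr (-1 / 2) * jb \<xi> powr (1 / 2)) * (m * cmod (g \<xi>))" by simp
        also have "\<dots> = m * cmod (g \<xi>)" by (simp flip: powr_add)
        finally show ?thesis by simp
      qed
      from hs_weighted_le[OF g this m] show "hs (-1) Mw" "hnorm (-1) Mw \<le> m * hnorm 0 g" by auto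
    qed
    define h where "h \<xi> = (f \<xi> - Mw \<xi>) - t *\<^sub>R adv V w \<xi>" for \<xi>
    have h: "hs (-1) h" "hnorm (-1) h \<le> hnorm (-1) f + (m + b) * hnorm 0 g"
    proof -
      have d: "hs (-1) (\<lambda>\<xi>. f \<xi> - Mw \<xi>)" by (intro hs_diff f Mw)
      have tw: "hs (-1) (\<lambda>\<xi>. t *\<^sub>R adv V w \<xi>)" by (intro hs_scaleR advw)
      show "hs (-1) h" unfolding h_def by (intro hs_diff d tw)
      have "hnorm (-1) h \<le> hnorm (-1) (\<lambda>\<xi>. f \<xi> - Mw \<xi>) + hnorm (-1) (\<lambda>\<xi>. t *\<^sub>R adv V w \<xi>)"
        unfolding h_def by (rule hs_diff(2)[OF d tw])
      moreover have "hnorm (-1) (\<lambda>\<xi>. f \<xi> - Mw \<xi>) \<le> hnorm (-1) f + hnorm (-1) Mw" by (rule hs_diff(2)[OF f Mw(1)])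
      moreover have "hnorm (-1) (\<lambda>\<xi>. t *\<^sub>R adv V w \<xi>) \<le> 1 * hnorm (-1) (adv V w)"
        unfolding hs_scaleR(2)[OF advw(1)] using t by (intro mult_right_mono) auto
      ultimately show "hnorm (-1) h \<le> hnorm (-1) f + (m + b) * hnorm 0 g"
        using Mw(2) advw(2) by (simp add: algebra_simps)
    qed
    have pt: "jb \<xi> * (norm (v \<xi>))\<^sup>2 \<le> 2 * C * (v \<xi> \<bullet> h \<xi> - t * (v \<xi> \<bullet> adv V v \<xi>))" for \<xi>
    proof (cases "\<xi> = 0")
      case True
      then show ?thesis by (simp add: v_def u0 w0)
    next
      case False
      have "adv V u \<xi> = adv V (\<lambda>\<xi>. v \<xi> + w \<xi>) \<xi>" by (simp add: v_def)
      also have "\<dots> = adv V v \<xi> + adv V w \<xi>" by (rule adv_add[OF Vr v w(1)])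
      finally have au: "adv V u \<xi> = adv V v \<xi> + adv V w \<xi>" .
      have "f \<xi> = visc_symbol A (wv \<xi>) (u \<xi>) + cvec (wv \<xi>) (\<i> * p \<xi>) + t *\<^sub>R adv V u \<xi>"
        using eq by (simp add: oseen_eq_def)
      hence e: "visc_symbol A (wv \<xi>) (v \<xi>) + cvec (wv \<xi>) (\<i> * p \<xi>) = h \<xi> - t *\<^sub>R adv V v \<xi>"
        by (simp add: v_def visc_symbol_linear h_def Mw_def au algebra_simps) 
      have o: "cdot (wv \<xi>) (v \<xi>) = 0" by (simp add: v_def w_def cdot_linear cdot_longitudinal)
      have "jb \<xi> * (norm (v \<xi>))\<^sup>2 \<le> (norm (wv \<xi>))\<^sup>2 * (norm (v \<xi>))\<^sup>2"
        by (intro mult_right_mono jb_le_wv_squared False) auto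
      also have "\<dots> \<le> 2 * C * (v \<xi> \<bullet> (h \<xi> - t *\<^sub>R adv V v \<xi>))"
        using transversal_bound[OF _ _ o e] A by (simp add: admissible_def)
      finally show ?thesis by (simp add: inner_diff_right)
    qed
    have en: "((\<lambda>\<xi>. v \<xi> \<bullet> adv V v \<xi>) has_sum 0) UNIV"
      by (rule adv_energy) (use V v in \<open>auto simp: div_free_def\<close>)
    have vh: "(\<lambda>\<xi>. v \<xi> \<bullet> h \<xi>) summable_on UNIV" "(\<Sum>\<^sub>\<infinity>\<xi>. v \<xi> \<bullet> h \<xi>) \<le> hnorm 1 v * hnorm (-1) h"
      using hnorm_pairing[OF v h(1)] by auto
    have "((\<lambda>\<xi>. 2 * C * (v \<xi> \<bullet> h \<xi> + (- t) * (v \<xi> \<bullet> adv V v \<xi>))) has_sum 2 * C * ((\<Sum>\<^sub>\<infinity>\<xi>. v \<xi> \<bullet> h \<xi>) + (- t) * 0)) UNIV"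
      by (intro has_sum_cmult_right has_sum_add has_sum_infsum vh en)
    hence rhs: "((\<lambda>\<xi>. 2 * C * (v \<xi> \<bullet> h \<xi> - t * (v \<xi> \<bullet> adv V v \<xi>))) has_sum 2 * C * (\<Sum>\<^sub>\<infinity>\<xi>. v \<xi> \<bullet> h \<xi>)) UNIV"
      by simp
    have sq: "(jb \<xi> powr (1 / 2) * norm (v \<xi>))\<^sup>2 = jb \<xi> * (norm (v \<xi>))\<^sup>2" for \<xi>
      by (simp add: weight_squared)
    have "((\<lambda>\<xi>. jb \<xi> * (norm (v \<xi>))\<^sup>2) has_sum (hnorm 1 v)\<^sup>2) UNIV"
      using v unfolding hs_def l2_def hnorm_def l2norm_squared sq by (rule has_sum_infsum)
    from has_sum_mono[OF this rhs pt] have "(hnorm 1 v)\<^sup>2 \<le> 2 * C * (\<Sum>\<^sub>\<infinity>\<xi>. v \<xi> \<bullet> h \<xi>)" by simp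
    also have "\<dots> \<le> 2 * C * (hnorm 1 v * hnorm (-1) h)" using vh(2) pos by (intro mult_left_mono) auto
    finally have "hnorm 1 v * hnorm 1 v \<le> hnorm 1 v * (2 * C * hnorm (-1) h)" by (simp add: power2_eq_square mult_ac)
    hence v1: "hnorm 1 v \<le> 2 * C * hnorm (-1) h"
      using hnorm_nonneg[of 1 v] pos by (cases "hnorm 1 v = 0") (auto simp: mult_le_cancel_left)
    have "hnorm 1 u \<le> hnorm 1 v + hnorm 1 w"
      using hs_add(2)[OF v w(1)] by (simp add: v_def)
    also have "\<dots> \<le> 2 * C * (hnorm (-1) f + (m + b) * hnorm 0 g) + hnorm 0 g"
      using v1 w(2) h(2) pos by (intro add_mono order_trans[OF v1] mult_left_mono) auto
    also have "\<dots> \<le> K * (hnorm (-1) f + hnorm 0 g)"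
    proof -
      have "0 \<le> C * ((m + b) * hnorm (-1) f)" "0 \<le> hnorm (-1) f" "0 \<le> C * hnorm 0 g"
        using m b pos by simp_all
      moreover have "K * (hnorm (-1) f + hnorm 0 g) = 2 * C * (hnorm (-1) f + (m + b) * hnorm 0 g) + hnorm 0 g
          + 2 * (C * ((m + b) * hnorm (-1) f)) + hnorm (-1) f + 2 * (C * hnorm 0 g)"
        by (simp add: K_def algebra_simps)
      ultimately show ?thesis by linarith
    qed
    finally show ?thesis using m b pos by (simp add: K_def)
  qed
  show ?thesis
    by (rule exI[of _ "max 0 K"]) (use main in \<open>fastforce simp: max_def\<close>)
qed

lemma interpolation:
  assumes s: "s \<ge> 1" and e: "e > 0"
  shows "\<exists>D\<ge>0. \<forall>u :: int^'n::finite \<Rightarrow> 'v::real_normed_vector. hs s u \<longrightarrow> hnorm (s - 1) u \<le> e * hnorm s u + D * hnorm 1 u"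
proof -
  define R where "R = e powr (- 2)"
  define D where "D = R powr ((s - 1) / 2)"
  have R: "R > 0" using e by (simp add: R_def)
  have w: "jb \<xi> powr ((s - 1) / 2) \<le> e * jb \<xi> powr (s / 2) + D * jb \<xi> powr (1 / 2)" for \<xi> :: "int^'n"
  proof (cases "jb \<xi> \<ge> R")
    case True
    have "jb \<xi> powr (- 1 / 2) \<le> R powr (- 1 / 2)" using True R by (intro powr_mono2') auto
    also have "\<dots> = e" using e by (simp add: R_def powr_powr)
    finally have "jb \<xi> powr (- 1 / 2) * jb \<xi> powr (s / 2) \<le> e * jb \<xi> powr (s / 2)" by (intro mult_right_mono) auto
    moreover have "jb \<xi> powr (- 1 / 2) * jb \<xi> powr (s / 2) = jb \<xi> powr ((s - 1) / 2)"
      by (simp add: diff_divide_distrib flip: powr_add)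
    moreover have "0 \<le> D * jb \<xi> powr (1 / 2)" by (simp add: D_def)
    ultimately show ?thesis by linarith
  next
    case False
    have "jb \<xi> powr ((s - 1) / 2) \<le> D" unfolding D_def using False s by (intro powr_mono2) auto
    also have "D * 1 \<le> D * jb \<xi> powr (1 / 2)" by (intro mult_left_mono ge_one_powr_ge_zero) (auto simp: D_def)
    finally have "jb \<xi> powr ((s - 1) / 2) \<le> D * jb \<xi> powr (1 / 2)" by simp
    moreover have "0 \<le> e * jb \<xi> powr (s / 2)" using e by simp
    ultimately show ?thesis by linarith
  qed
  have D: "D \<ge> 0" by (simp add: D_def)
  have "hnorm (s - 1) u \<le> e * hnorm s u + D * hnorm 1 u" if u: "hs s u" for u :: "int^'n \<Rightarrow> 'v"
  proof -
    have u1: "hs 1 u" by (rule hs_mono(1)[OF u s])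
    have le: "jb \<xi> powr ((s - 1) / 2) * norm (u \<xi>) \<le> jb \<xi> powr (s / 2) * norm (e *\<^sub>R u \<xi>) + jb \<xi> powr (1 / 2) * norm (D *\<^sub>R u \<xi>)" for \<xi>
      using mult_right_mono[OF w[of \<xi>], of "norm (u \<xi>)"] e D by (simp add: algebra_simps)
    have "hnorm (s - 1) u \<le> hnorm s (\<lambda>\<xi>. e *\<^sub>R u \<xi>) + hnorm 1 (\<lambda>\<xi>. D *\<^sub>R u \<xi>)"
      by (rule hs_add_weighted(2)[OF hs_scaleR(1)[OF u] hs_scaleR(1)[OF u1] le])
    also have "\<dots> = e * hnorm s u + D * hnorm 1 u"
      using e D by (simp add: hs_scaleR(2)[OF u] hs_scaleR(2)[OF u1])
    finally show ?thesis .
  qed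
  with D show ?thesis by blast
qed

lemma apriori_estimate:
  fixes V :: "int^'n::finite \<Rightarrow> complex^'n"
  assumes V: "div_free V" and s: "s \<ge> 1"
  shows "\<exists>K>0. \<forall>A t u p f g. admissible C a A \<longrightarrow> 0 \<le> t \<longrightarrow> t \<le> 1 \<longrightarrow> oseen_eq A V t u p f g \<longrightarrow>
    u 0 = 0 \<longrightarrow> p 0 = 0 \<longrightarrow> hs s u \<longrightarrow> hs (s - 2) f \<longrightarrow> hs (s - 1) g \<longrightarrow>
    hnorm s u + hnorm (s - 1) p \<le> K * (hnorm (s - 2) f + hnorm (s - 1) g)"
proof (cases "\<exists>A :: 'n tensor. admissible C a A")
  case False
  then show ?thesis by (intro exI[of _ 1]) auto
next
  case True
  then obtain A0 :: "'n tensor" where A0: "admissible C a A0" by blast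
  define S where "S = 2 * pi * stokes_const C a CARD('n)"
  define b where "b = CARD('n) * infsum (adv_kernel V (s - 2)) UNIV"
  have S: "S > 0" using admissible_pos(3)[OF A0] by (simp add: S_def)
  have b: "b \<ge> 0" unfolding b_def by (intro mult_nonneg_nonneg infsum_nonneg) auto
  have Vr: "rapid_vec V" using V by (simp add: div_free_def)
  obtain K1 where K1: "K1 \<ge> 0" and energy: "\<And>(A :: 'n tensor) t u p f g. admissible C a A \<Longrightarrow> 0 \<le> t \<Longrightarrow> t \<le> 1 \<Longrightarrow>
      oseen_eq A V t u p f g \<Longrightarrow> u 0 = 0 \<Longrightarrow> hs 1 u \<Longrightarrow> hs (-1) f \<Longrightarrow> hs 0 g \<Longrightarrow> hnorm 1 u \<le> K1 * (hnorm (-1) f + hnorm 0 g)"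
    using energy_estimate[OF V, of C a] by blast
  define e where "e = 1 / (4 * S * (b + 1))"
  have e: "e > 0" using S b by (simp add: e_def)
  obtain D where D: "D \<ge> 0" "\<And>u :: int^'n \<Rightarrow> complex^'n. hs s u \<Longrightarrow> hnorm (s - 1) u \<le> e * hnorm s u + D * hnorm 1 u"
    using interpolation[OF s e] by blast
  define K where "K = 4 * S * (1 + b * D * K1)"
  have K: "K > 0" using S b D K1 by (simp add: K_def add_pos_nonneg)
  have "hnorm s u + hnorm (s - 1) p \<le> K * (hnorm (s - 2) f + hnorm (s - 1) g)"
    if A: "admissible C a A" and t: "0 \<le> t" "t \<le> 1" and eq: "oseen_eq A V t u p f g" and 0: "u 0 = 0" "p 0 = 0"
      and u: "hs s u" and f: "hs (s - 2) f" and g: "hs (s - 1) g" for A t u p f g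
  proof -
    let ?E = "hnorm (s - 2) f + hnorm (s - 1) g"
    have us: "hs (s - 2 + 1) u" by (rule hs_mono(1)[OF u]) simp
    note adv = adv_bounded(2,3)[OF Vr us]
    have tadv: "hs (s - 2) (\<lambda>\<xi>. t *\<^sub>R adv V u \<xi>)" by (rule hs_scaleR(1)[OF adv(1)])
    have F: "hs (s - 2) (\<lambda>\<xi>. f \<xi> - t *\<^sub>R adv V u \<xi>)" by (rule hs_diff(1)[OF f tadv])
    have "hnorm (s - 2) (\<lambda>\<xi>. t *\<^sub>R adv V u \<xi>) \<le> 1 * hnorm (s - 2) (adv V u)"
      unfolding hs_scaleR(2)[OF adv(1)] using t by (intro mult_right_mono) auto
    also have "\<dots> \<le> b * hnorm (s - 1) u" using adv(2) by (simp add: b_def)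
    also have "\<dots> \<le> b * (e * hnorm s u + D * hnorm 1 u)" by (intro mult_left_mono D(2) u b)
    finally have "hnorm (s - 2) (\<lambda>\<xi>. t *\<^sub>R adv V u \<xi>) \<le> b * (e * hnorm s u + D * hnorm 1 u)" .
    hence Fn: "hnorm (s - 2) (\<lambda>\<xi>. f \<xi> - t *\<^sub>R adv V u \<xi>) \<le> hnorm (s - 2) f + b * (e * hnorm s u + D * hnorm 1 u)"
      using hs_diff(2)[OF f tadv] by linarith
    have e1: "visc_symbol A (wv \<xi>) (u \<xi>) + cvec (wv \<xi>) (\<i> * p \<xi>) = f \<xi> - t *\<^sub>R adv V u \<xi>"
      and e2: "\<i> * cdot (wv \<xi>) (u \<xi>) = g \<xi>" for \<xi>
      using eq unfolding oseen_eq_def eq_diff_eq by auto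
    note st = stokes_hs[OF A e1 e2 0 F g, folded S_def]
    have u1: "hs 1 u" "hs (-1) f" "hs 0 g"
      using s by (auto intro: hs_mono(1)[OF u] hs_mono(1)[OF f] hs_mono(1)[OF g])
    have "hnorm 1 u \<le> K1 * (hnorm (-1) f + hnorm 0 g)" by (rule energy[OF A t eq 0(1) u1])
    also have "\<dots> \<le> K1 * ?E"
      using s by (intro mult_left_mono add_mono hs_mono(2)[OF f] hs_mono(2)[OF g] K1) auto
    finally have h1: "hnorm 1 u \<le> K1 * ?E" .
    let ?n = "hnorm s u + hnorm (s - 1) p"
    have "4 * S * (b * e) = b / (b + 1)" using S by (simp add: e_def)
    hence be: "4 * S * (b * e) \<le> 1" using b by simp
    have "?n \<le> 2 * (S * (hnorm (s - 2) (\<lambda>\<xi>. f \<xi> - t *\<^sub>R adv V u \<xi>) + hnorm (s - 1) g))"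
      using st(2,4) by simp
    also have "\<dots> \<le> 2 * (S * ((hnorm (s - 2) f + b * (e * hnorm s u + D * (K1 * ?E))) + hnorm (s - 1) g))"
    proof -
      have "b * (e * hnorm s u + D * hnorm 1 u) \<le> b * (e * hnorm s u + D * (K1 * ?E))"
        by (intro mult_left_mono add_left_mono h1 D b)
      then show ?thesis using Fn S by simp
    qed
    also have "\<dots> = 2 * S * (1 + b * D * K1) * ?E + (4 * S * (b * e)) * hnorm s u / 2"
      by (simp add: algebra_simps)
    also have "\<dots> \<le> 2 * S * (1 + b * D * K1) * ?E + 1 * hnorm s u / 2"
      by (intro add_left_mono divide_right_mono mult_right_mono be) auto
    also have "\<dots> \<le> 2 * S * (1 + b * D * K1) * ?E + ?n / 2" by simp
    finally have "?n \<le> 2 * S * (1 + b * D * K1) * ?E + ?n / 2" .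
    moreover have "x \<le> z + x / 2 \<Longrightarrow> x \<le> 2 * z" for x z :: real by linarith
    ultimately have "?n \<le> 2 * (2 * S * (1 + b * D * K1) * ?E)" by blast
    then show ?thesis by (simp add: K_def mult.assoc)
  qed
  with K show ?thesis by blast
qed

section \<open>The method of continuity\<close>

locale continuity_method =
  fixes X :: "'a::real_vector set" and NX :: "'a \<Rightarrow> real"
    and Y :: "'b::real_vector set" and NY :: "'b \<Rightarrow> real"
    and S B :: "'a \<Rightarrow> 'b" and C :: real
  assumes X: "subspace X" and Y: "subspace Y"
    and NX: "\<And>x. x \<in> X \<Longrightarrow> 0 \<le> NX x"
      "\<And>x y. x \<in> X \<Longrightarrow> y \<in> X \<Longrightarrow> NX (x + y) \<le> NX x + NX y"
    and NY: "\<And>y. y \<in> Y \<Longrightarrow> 0 \<le> NY y" "\<And>y. y \<in> Y \<Longrightarrow> NY y = 0 \<Longrightarrow> y = 0"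
      "\<And>y z. y \<in> Y \<Longrightarrow> z \<in> Y \<Longrightarrow> NY (y + z) \<le> NY y + NY z"
      "\<And>y a. y \<in> Y \<Longrightarrow> NY (a *\<^sub>R y) = \<bar>a\<bar> * NY y"
    and S: "linear S" "\<And>x. x \<in> X \<Longrightarrow> S x \<in> Y" and B: "linear B" "\<And>x. x \<in> X \<Longrightarrow> B x \<in> Y"
    and complete: "\<And>x K. (\<And>m :: nat. x m \<in> X) \<Longrightarrow> (\<And>m. NX (x m) \<le> K * (1/2) ^ m) \<Longrightarrow>
      \<exists>y\<in>X. (\<lambda>M. NX (y - (\<Sum>m<M. x m))) \<longlonglongrightarrow> 0"
    and S_bound: "\<exists>K\<ge>0. \<forall>x\<in>X. NY (S x) \<le> K * NX x"
    and B_bound: "\<exists>K\<ge>0. \<forall>x\<in>X. NY (B x) \<le> K * NX x"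
    and apriori: "C > 0" "\<And>t x. 0 \<le> t \<Longrightarrow> t \<le> 1 \<Longrightarrow> x \<in> X \<Longrightarrow> NX x \<le> C * NY (S x + t *\<^sub>R B x)"
    and S_onto: "\<And>y. y \<in> Y \<Longrightarrow> \<exists>x\<in>X. S x = y"
begin

lemma onto_step:
  assumes onto: "\<And>y. y \<in> Y \<Longrightarrow> \<exists>x\<in>X. S x + t *\<^sub>R B x = y" and t: "0 \<le> t" "t \<le> 1"
    and b: "\<And>x. x \<in> X \<Longrightarrow> NY (B x) \<le> b * NX x" "b \<ge> 0" and d: "0 \<le> d" "C * (d * b) \<le> 1/2" and y: "y \<in> Y"
  shows "\<exists>x\<in>X. S x + (t + d) *\<^sub>R B x = y"
proof -
  define T where "T x = S x + t *\<^sub>R B x" for x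
  have T: "linear T" unfolding T_def
    using S(1) B(1) by (intro linear_compose_add linear_compose_scale_right)
  obtain R where R: "\<And>y. y \<in> Y \<Longrightarrow> R y \<in> X" "\<And>y. y \<in> Y \<Longrightarrow> T (R y) = y"
    using onto unfolding T_def by metis
  define x where "x = rec_nat (R y) (\<lambda>_ z. R ((- d) *\<^sub>R B z))"
  have x0: "x 0 = R y" and xS: "x (Suc m) = R ((- d) *\<^sub>R B (x m))" for m by (simp_all add: x_def)
  have xX: "x m \<in> X" for m
  proof (induction m)
    case (Suc m)
    then show ?case unfolding xS by (intro R(1) subspace_scale[OF Y] B(2))
  qed (simp add: x0 R y)
  have TS: "T (x (Suc m)) = (- d) *\<^sub>R B (x m)" for m
    unfolding xS by (intro R(2) subspace_scale[OF Y] B(2) xX)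
  have step: "NX (x (Suc m)) \<le> NX (x m) / 2" for m
  proof -
    have "NX (x (Suc m)) \<le> C * NY (T (x (Suc m)))" unfolding T_def by (rule apriori(2)[OF t xX])
    also have "\<dots> = C * (d * NY (B (x m)))" unfolding TS NY(4)[OF B(2)[OF xX]] using d by simp
    also have "\<dots> \<le> C * (d * (b * NX (x m)))" using apriori(1) d by (intro mult_left_mono b xX) auto
    also have "\<dots> = (C * (d * b)) * NX (x m)" by simp
    also have "\<dots> \<le> (1/2) * NX (x m)" by (intro mult_right_mono d NX xX)
    finally show ?thesis by simp
  qed
  have "NX (x m) \<le> NX (x 0) * (1/2) ^ m" for m
  proof (induction m)
    case (Suc m)
    then show ?case using step[of m] by simp
  qed simp
  then obtain z where z: "z \<in> X" "(\<lambda>M. NX (z - (\<Sum>m<M. x m))) \<longlonglongrightarrow> 0"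
    using complete[of x "NX (x 0)", OF xX] by blast
  let ?s = "\<lambda>M. \<Sum>m<M. x m"
  have sX: "?s M \<in> X" for M by (intro subspace_sum[OF X] xX)
  have Ts: "T (?s (Suc M)) = y - d *\<^sub>R B (?s M)" for M
  proof (induction M)
    case 0
    then show ?case by (simp add: x0 R y linear_0[OF B(1)])
  next
    case (Suc M)
    have "T (?s (Suc (Suc M))) = T (?s (Suc M)) + T (x (Suc M))" by (simp add: linear_add[OF T])
    then show ?case unfolding Suc.IH TS by (simp add: linear_add[OF B(1)] scaleR_add_right)
  qed
  obtain K where K: "K \<ge> 0" "\<And>x. x \<in> X \<Longrightarrow> NY (S x) \<le> K * NX x" using S_bound by blast
  define e where "e = T z + d *\<^sub>R B z - y"
  have TY: "T x \<in> Y" if "x \<in> X" for x unfolding T_def using that by (intro subspace_add[OF Y] subspace_scale[OF Y] S B)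
  have eY: "e \<in> Y" unfolding e_def by (intro subspace_diff[OF Y] subspace_add[OF Y] subspace_scale[OF Y] TY B z y)
  have eb: "NY e \<le> (K + t * b) * NX (z - ?s (Suc M)) + d * (b * NX (z - ?s M))" for M
  proof -
    let ?a = "z - ?s (Suc M)" and ?c = "z - ?s M"
    have aX: "?a \<in> X" "?c \<in> X" by (intro subspace_diff[OF X] z sX)+
    have "e = T ?a + d *\<^sub>R B ?c"
      unfolding e_def linear_diff[OF T] linear_diff[OF B(1)] Ts by (simp add: algebra_simps)
    hence "NY e \<le> NY (T ?a) + NY (d *\<^sub>R B ?c)" using NY(3)[of "T ?a" "d *\<^sub>R B ?c"] TY aX B(2) subspace_scale[OF Y] by auto
    moreover have "NY (T ?a) \<le> NY (S ?a) + NY (t *\<^sub>R B ?a)"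
      unfolding T_def by (intro NY(3) S B aX subspace_scale[OF Y])
    moreover have "NY (t *\<^sub>R B ?a) \<le> t * (b * NX ?a)"
      unfolding NY(4)[OF B(2)[OF aX(1)]] using t b(1)[OF aX(1)] by (simp add: mult_left_mono)
    moreover have "NY (d *\<^sub>R B ?c) \<le> d * (b * NX ?c)"
      unfolding NY(4)[OF B(2)[OF aX(2)]] using d b(1)[OF aX(2)] by (simp add: mult_left_mono)
    moreover have "NY (S ?a) \<le> K * NX ?a" by (rule K(2)[OF aX(1)])
    ultimately show ?thesis by (simp add: distrib_right)
  qed
  have "(\<lambda>M. (K + t * b) * NX (z - ?s (Suc M)) + d * (b * NX (z - ?s M))) \<longlonglongrightarrow> (K + t * b) * 0 + d * (b * 0)"
    by (intro tendsto_add tendsto_mult tendsto_const z(2) LIMSEQ_Suc[OF z(2)])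
  hence "NY e \<le> (K + t * b) * 0 + d * (b * 0)" by (rule LIMSEQ_le_const) (use eb in blast)
  hence "NY e = 0" using NY(1)[OF eY] by simp
  hence "e = 0" by (rule NY(2)[OF eY])
  hence "S z + (t + d) *\<^sub>R B z = y" by (simp add: e_def T_def scaleR_add_left add.assoc)
  with z(1) show ?thesis by blast
qed

lemma onto:
  assumes "y \<in> Y"
  shows "\<exists>x\<in>X. S x + B x = y"
proof -
  obtain b where b: "b \<ge> 0" "\<And>x. x \<in> X \<Longrightarrow> NY (B x) \<le> b * NX x" using B_bound by blast
  obtain N :: nat where N: "2 * C * b + 1 < real N" using reals_Archimedean2 by blast
  have "2 * C * b \<ge> 0" using b apriori(1) by simp
  hence N0: "N > 0" using N by (cases N) auto
  define d where "d = 1 / real N"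
  have d: "0 \<le> d" "C * (d * b) \<le> 1/2" using N N0 by (auto simp: d_def field_simps)
  have "\<forall>y\<in>Y. \<exists>x\<in>X. S x + (real k * d) *\<^sub>R B x = y" if "k \<le> N" for k
    using that
  proof (induction k)
    case 0
    then show ?case using S_onto by simp
  next
    case (Suc k)
    have t: "0 \<le> real k * d" "real k * d \<le> 1" using Suc.prems N0 by (auto simp: d_def)
    have eq: "real (Suc k) * d = real k * d + d" by (simp add: algebra_simps)
    show ?case unfolding eq
    proof
      fix y assume y: "y \<in> Y"
      show "\<exists>x\<in>X. S x + (real k * d + d) *\<^sub>R B x = y"
        by (rule onto_step[OF _ t b(2) b(1) d y]) (use Suc in auto)
    qed
  qed
  from this[of N] assms N0 show ?thesis by (simp add: d_def)
qed

end

section \<open>The Oseen operator on Fourier coefficients\<close>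

lemma dpartial_linear: "dpartial j (S + T) = dpartial j S + dpartial j T" "dpartial j (a *\<^sub>R T) = a *\<^sub>R dpartial j T"
  by (rule fourier_inject; simp add: fourier_dpartial distrib_left)+

lemma dmult_linear: "dmult f (S + T) = dmult f S + dmult f T" "dmult f (a *\<^sub>R T) = a *\<^sub>R dmult f T"
  by (rule pdistr_eqI; simp add: dmult.rep_eq plus_pdistr.rep_eq scaleR_pdistr.rep_eq)+

lemma vhat_aniso_op:
  assumes A: "tensor_symmetric A"
  shows "vhat (aniso_op A u) \<xi> = - visc_symbol A (wv \<xi>) (vhat u \<xi>)"
proof -
  have s2: "A k j \<alpha> \<beta> = A k \<beta> \<alpha> j" for k j \<alpha> \<beta>
    using A unfolding tensor_symmetric_def by blast
  let ?\<kappa> = "wv \<xi>"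
  have "fourier (aniso_op A u $ k) \<xi> = - (visc_symbol A (wv \<xi>) (vhat u \<xi>) $ k)" for k
  proof -
    have inner: "(\<Sum>j\<in>UNIV. \<Sum>\<beta>\<in>UNIV. A k j \<alpha> \<beta> *\<^sub>R fourier (strain u j \<beta>) \<xi>) =
        (\<Sum>j\<in>UNIV. \<Sum>\<beta>\<in>UNIV. (A k j \<alpha> \<beta> * ?\<kappa> $ \<beta>) *\<^sub>R (\<i> * fourier (u $ j) \<xi>))" for \<alpha>
    proof -
      let ?G = "\<lambda>j \<beta>. (A k j \<alpha> \<beta> * ?\<kappa> $ \<beta>) *\<^sub>R (\<i> * fourier (u $ j) \<xi>) /\<^sub>R 2"
      have "(\<Sum>j\<in>UNIV. \<Sum>\<beta>\<in>UNIV. A k j \<alpha> \<beta> *\<^sub>R fourier (strain u j \<beta>) \<xi>) =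
          (\<Sum>j\<in>UNIV. \<Sum>\<beta>\<in>UNIV. (A k j \<alpha> \<beta> * ?\<kappa> $ j) *\<^sub>R (\<i> * fourier (u $ \<beta>) \<xi>) /\<^sub>R 2 + ?G j \<beta>)"
        by (intro sum.cong refl) (simp add: strain_def fourier_dpartial scaleR_conv_of_real field_simps)
      also have "\<dots> = (\<Sum>j\<in>UNIV. \<Sum>\<beta>\<in>UNIV. (A k j \<alpha> \<beta> * ?\<kappa> $ j) *\<^sub>R (\<i> * fourier (u $ \<beta>) \<xi>) /\<^sub>R 2) + (\<Sum>j\<in>UNIV. \<Sum>\<beta>\<in>UNIV. ?G j \<beta>)"
        by (simp only: sum.distrib)
      also have "(\<Sum>j\<in>UNIV. \<Sum>\<beta>\<in>UNIV. (A k j \<alpha> \<beta> * ?\<kappa> $ j) *\<^sub>R (\<i> * fourier (u $ \<beta>) \<xi>) /\<^sub>R 2) = (\<Sum>j\<in>UNIV. \<Sum>\<beta>\<in>UNIV. ?G j \<beta>)"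
        by (subst sum.swap) (intro sum.cong refl, subst s2, rule refl)
      also have "(\<Sum>j\<in>UNIV. \<Sum>\<beta>\<in>UNIV. ?G j \<beta>) + (\<Sum>j\<in>UNIV. \<Sum>\<beta>\<in>UNIV. ?G j \<beta>) = (\<Sum>j\<in>UNIV. \<Sum>\<beta>\<in>UNIV. ?G j \<beta> + ?G j \<beta>)"
        by (simp only: sum.distrib)
      finally show ?thesis by (simp flip: scaleR_2)
    qed
    have "fourier (aniso_op A u $ k) \<xi> = (\<Sum>\<alpha>\<in>UNIV. \<i> * of_real (?\<kappa> $ \<alpha>) *
        (\<Sum>j\<in>UNIV. \<Sum>\<beta>\<in>UNIV. A k j \<alpha> \<beta> *\<^sub>R fourier (strain u j \<beta>) \<xi>))"
      by (simp add: aniso_op_def fourier_dpartial)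
    also have "\<dots> = (\<Sum>\<alpha>\<in>UNIV. \<Sum>j\<in>UNIV. \<Sum>\<beta>\<in>UNIV. - ((A k j \<alpha> \<beta> * ?\<kappa> $ \<alpha> * ?\<kappa> $ \<beta>) *\<^sub>R fourier (u $ j) \<xi>))"
      unfolding inner sum_distrib_left
      by (intro sum.cong refl) (simp add: scaleR_conv_of_real algebra_simps)
    also have "\<dots> = (\<Sum>j\<in>UNIV. \<Sum>\<alpha>\<in>UNIV. \<Sum>\<beta>\<in>UNIV. - ((A k j \<alpha> \<beta> * ?\<kappa> $ \<alpha> * ?\<kappa> $ \<beta>) *\<^sub>R fourier (u $ j) \<xi>))"
      by (rule sum.swap)
    also have "\<dots> = - (visc_symbol A ?\<kappa> (vhat u \<xi>) $ k)" by (simp add: visc_symbol_def sum_negf)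
    finally show ?thesis .
  qed
  then show ?thesis by (simp add: vec_eq_iff)
qed

lemma vhat_grad: "vhat (grad p) \<xi> = cvec (wv \<xi>) (\<i> * fourier p \<xi>)"
  by (simp add: vec_eq_iff grad_def cvec_def fourier_dpartial scaleR_conv_of_real)

lemma fourier_divergence: "fourier (divergence u) \<xi> = \<i> * cdot (wv \<xi>) (vhat u \<xi>)"
  by (simp add: divergence_def cdot_def fourier_dpartial scaleR_conv_of_real sum_distrib_left mult_ac)

definition Uhat :: "(real^'n::finite \<Rightarrow> real^'n) \<Rightarrow> int^'n \<Rightarrow> complex^'n"
  where "Uhat U \<xi> = (\<chi> j. coeff (\<lambda>x. U x $ j) \<xi>)"

lemma div_free_Uhat:
  assumes U: "U \<in> Cinf_per_sigma"
  shows "div_free (Uhat U)"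
  unfolding div_free_def
proof (intro conjI allI)
  have c: "(\<lambda>x. U x $ j) \<in> Cinf_per" for j using U by (simp add: Cinf_per_sigma_def)
  show "rapid_vec (Uhat U)" using c by (simp add: rapid_vec_def Uhat_def rapid_coeff)
  show "Uhat U (- \<zeta>) $ j = cnj (Uhat U \<zeta> $ j)" for \<zeta> j by (simp add: Uhat_def fourier_reflect)
  fix \<zeta>
  have "(\<lambda>x. \<Sum>k\<in>UNIV. partial k (\<lambda>y. U y $ k) x) = (\<lambda>x. 0 * 0 + 0 * 0)"
    using U by (simp add: Cinf_per_sigma_def fun_eq_iff)
  moreover have "coeff (\<lambda>x. \<Sum>k\<in>UNIV. partial k (\<lambda>y. U y $ k) x) \<zeta> = \<i> * (\<Sum>j\<in>UNIV. of_real (wv \<zeta> $ j) * Uhat U \<zeta> $ j)"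
    by (simp add: coeff_sum Cinf_per_partial c coeff_partial Uhat_def sum_distrib_left mult.assoc)
  ultimately show "(\<Sum>j\<in>UNIV. of_real (wv \<zeta> $ j) * Uhat U \<zeta> $ j) = 0"
    using coeff_lincomb[OF zero_Cinf_per zero_Cinf_per, of 0 0 \<zeta>] by simp
qed

lemma vhat_advect:
  assumes U: "U \<in> Cinf_per_sigma" and u: "hs s (vhat u)"
  shows "vhat (advect U u) \<xi> = adv (Uhat U) (vhat u) \<xi>"
proof -
  have c: "(\<lambda>x. U x $ j) \<in> Cinf_per" for j using U by (simp add: Cinf_per_sigma_def)
  have "((\<lambda>\<eta>. adv_symbol (Uhat U) \<xi> \<eta> * fourier (u $ k) \<eta>) has_sum fourier (advect U u $ k) \<xi>) UNIV" for k
  proof -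
    have uk: "hs s (fourier (u $ k))" using hs_nth[OF u, of k] by simp
    have "tempered (fourier (dpartial j (u $ k)))" for j
    proof (rule tempered_hs)
      show "hs (s - 1) (fourier (dpartial j (u $ k)))"
      proof (rule hs_weighted_le(1)[OF uk])
        fix \<eta>
        have "jb \<eta> powr ((s - 1) / 2) * cmod (fourier (dpartial j (u $ k)) \<eta>) =
            jb \<eta> powr ((s - 1) / 2) * (\<bar>wv \<eta> $ j\<bar> * cmod (fourier (u $ k) \<eta>))"
          by (simp add: fourier_dpartial norm_mult)
        also have "\<dots> \<le> jb \<eta> powr ((s - 1) / 2) * ((2 * pi * jb \<eta> powr (1 / 2)) * cmod (fourier (u $ k) \<eta>))"
          by (intro mult_left_mono mult_right_mono order_trans[OF component_le_norm_cart norm_wv_le]) auto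
        also have "\<dots> = 2 * pi * ((jb \<eta> powr ((s - 1) / 2) * jb \<eta> powr (1 / 2)) * cmod (fourier (u $ k) \<eta>))" by simp
        also have "jb \<eta> powr ((s - 1) / 2) * jb \<eta> powr (1 / 2) = jb \<eta> powr (s / 2)"
          by (simp add: diff_divide_distrib flip: powr_add)
        finally show "jb \<eta> powr ((s - 1) / 2) * cmod (fourier (dpartial j (u $ k)) \<eta>) \<le>
            (2 * pi) * (jb \<eta> powr (s / 2) * cmod (fourier (u $ k) \<eta>))" by simp
      qed simp
    qed
    from has_sum_finite_sum[OF fourier_dmult[OF this c]]
    have "((\<lambda>\<eta>. \<Sum>j\<in>UNIV. coeff (\<lambda>x. U x $ j) (\<xi> - \<eta>) * fourier (dpartial j (u $ k)) \<eta>) has_sum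
        (\<Sum>j\<in>UNIV. fourier (dmult (\<lambda>x. U x $ j) (dpartial j (u $ k))) \<xi>)) UNIV" .
    moreover have "(\<Sum>j\<in>UNIV. coeff (\<lambda>x. U x $ j) (\<xi> - \<eta>) * fourier (dpartial j (u $ k)) \<eta>) =
        adv_symbol (Uhat U) \<xi> \<eta> * fourier (u $ k) \<eta>" for \<eta>
      by (simp add: adv_symbol_def Uhat_def fourier_dpartial sum_distrib_right mult.assoc)
    ultimately show ?thesis by (simp add: advect_def)
  qed
  from infsumI[OF this] show ?thesis by (simp add: vec_eq_iff adv_def)
qed

definition stokes :: "'n::finite tensor \<Rightarrow> 'n vdistr \<times> 'n pdistr \<Rightarrow> 'n vdistr \<times> 'n pdistr"
  where "stokes A = (\<lambda>(u, p). (- aniso_op A u + grad p, divergence u))"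

definition advection :: "(real^'n::finite \<Rightarrow> real^'n) \<Rightarrow> 'n vdistr \<times> 'n pdistr \<Rightarrow> 'n vdistr \<times> 'n pdistr"
  where "advection U = (\<lambda>(u, p). (advect U u, 0))"

lemma oseen_split: "oseen A U x = stokes A x + advection U x"
  by (simp add: oseen_def stokes_def advection_def split_beta)

lemma linear_stokes:
  assumes "tensor_symmetric A"
  shows "linear (stokes A)"
proof (rule linearI)
  show "stokes A (x + y) = stokes A x + stokes A y" for x y
    by (auto simp: stokes_def split_beta prod_eq_iff vhat_aniso_op[OF assms] vhat_grad fourier_divergence
        visc_symbol_linear cvec_linear cdot_linear distrib_left intro!: vhat_inject fourier_inject)
  show "stokes A (a *\<^sub>R x) = a *\<^sub>R stokes A x" for a x
    by (auto simp: stokes_def split_beta prod_eq_iff vhat_aniso_op[OF assms] vhat_grad fourier_divergence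
        visc_symbol_linear cvec_linear cdot_linear scaleR_add_right scaleR_diff_right intro!: vhat_inject fourier_inject)
qed

lemma linear_advection: "linear (advection U)"
  by (rule linearI)
    (simp_all add: advection_def split_beta prod_eq_iff advect_def vec_eq_iff dpartial_linear dmult_linear
      sum.distrib scaleR_sum_right)

lemma oseen_eq_Fourier:
  assumes A: "tensor_symmetric A" and U: "U \<in> Cinf_per_sigma" and u: "hs s (vhat u)"
    and eq: "stokes A (u, p) + t *\<^sub>R advection U (u, p) = (f, g)"
  shows "oseen_eq A (Uhat U) t (vhat u) (fourier p) (vhat f) (fourier g)"
proof -
  have "f = (- aniso_op A u + grad p) + t *\<^sub>R advect U u" "g = divergence u"
    using eq by (auto simp: stokes_def advection_def)
  then show ?thesis
    by (simp add: oseen_eq_def vhat_aniso_op[OF A] vhat_grad vhat_advect[OF U u] fourier_divergence)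
qed

lemma adv_zero_freq:
  assumes "div_free V"
  shows "adv V u 0 = 0"
proof -
  have "adv_symbol V 0 \<eta> = 0" for \<eta>
  proof -
    have "adv_symbol V 0 \<eta> = - \<i> * (\<Sum>j\<in>UNIV. of_real (wv (- \<eta>) $ j) * V (- \<eta>) $ j)"
      by (simp add: adv_symbol_def sum_distrib_left sum_negf mult_ac)
    also have "(\<Sum>j\<in>UNIV. of_real (wv (- \<eta>) $ j) * V (- \<eta>) $ j) = 0"
      using assms unfolding div_free_def by blast
    finally show ?thesis by simp
  qed
  then show ?thesis by (simp add: adv_def vec_eq_iff)
qed

lemma stokes_bound:
  fixes A :: "'n::finite tensor"
  assumes A: "admissible C a A"
  shows "\<exists>K\<ge>0. \<forall>x\<in>Hs_dot_pair s (s - 1). stokes A x \<in> Hs_dot_pair (s - 2) (s - 1) \<and>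
    Hs_norm_pair (s - 2) (s - 1) (stokes A x) \<le> K * Hs_norm_pair s (s - 1) x"
proof -
  define M where "M = CARD('n) ^ 4 * a * (2 * pi)\<^sup>2"
  define N where "N = CARD('n) * (2 * pi)"
  note pos = admissible_pos[OF A]
  have M: "M \<ge> 0" "N \<ge> 0" using pos by (auto simp: M_def N_def)
  have sym: "tensor_symmetric A" using A by (simp add: admissible_def)
  have "stokes A (u, p) \<in> Hs_dot_pair (s - 2) (s - 1) \<and>
    Hs_norm_pair (s - 2) (s - 1) (stokes A (u, p)) \<le> (M + 2 * pi + N) * Hs_norm_pair s (s - 1) (u, p)"
    if x: "(u, p) \<in> Hs_dot_pair s (s - 1)" for u p
  proof -
    have h: "hs s (vhat u)" "vhat u 0 = 0" "hs (s - 1) (fourier p)" "fourier p 0 = 0"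
      using x by (auto simp: Hs_dot_pair_iff)
    define f g where "f = - aniso_op A u + grad p" and "g = divergence u"
    have st: "stokes A (u, p) = (f, g)" by (simp add: stokes_def f_def g_def)
    have vf: "vhat f \<xi> = visc_symbol A (wv \<xi>) (vhat u \<xi>) + cvec (wv \<xi>) (\<i> * fourier p \<xi>)" for \<xi>
      by (simp add: f_def vhat_aniso_op[OF sym] vhat_grad)
    have fg: "fourier g \<xi> = \<i> * cdot (wv \<xi>) (vhat u \<xi>)" for \<xi> by (simp add: g_def fourier_divergence)
    have le1: "jb \<xi> powr ((s - 2) / 2) * norm (vhat f \<xi>) \<le>
        jb \<xi> powr (s / 2) * norm (M *\<^sub>R vhat u \<xi>) + jb \<xi> powr ((s - 1) / 2) * norm ((2 * pi) *\<^sub>R fourier p \<xi>)" for \<xi>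
    proof -
      have "norm (visc_symbol A (wv \<xi>) (vhat u \<xi>)) \<le> CARD('n) ^ 4 * a * (norm (wv \<xi>))\<^sup>2 * norm (vhat u \<xi>)"
        using norm_visc_symbol_le[of A "wv \<xi>" "vhat u \<xi>"] A by (simp add: admissible_def)
      also have "\<dots> \<le> CARD('n) ^ 4 * a * (2 * pi * jb \<xi> powr (1 / 2))\<^sup>2 * norm (vhat u \<xi>)"
        using pos by (intro mult_right_mono mult_left_mono power_mono norm_wv_le) auto
      also have "\<dots> = jb \<xi> * (M * norm (vhat u \<xi>))"
        by (simp add: M_def power_mult_distrib jb_powr_half)
      finally have 1: "norm (visc_symbol A (wv \<xi>) (vhat u \<xi>)) \<le> jb \<xi> * (M * norm (vhat u \<xi>))" .
      have 2: "norm (cvec (wv \<xi>) (\<i> * fourier p \<xi>)) \<le> (2 * pi * jb \<xi> powr (1 / 2)) * cmod (fourier p \<xi>)"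
        unfolding norm_cvec norm_mult by (simp add: mult_right_mono norm_wv_le)
      have "norm (vhat f \<xi>) \<le> jb \<xi> * (M * norm (vhat u \<xi>)) + (2 * pi * jb \<xi> powr (1 / 2)) * cmod (fourier p \<xi>)"
        unfolding vf using norm_triangle_ineq[of "visc_symbol A (wv \<xi>) (vhat u \<xi>)"] 1 2 by (meson add_mono order_trans)
      from mult_left_mono[OF this, of "jb \<xi> powr ((s - 2) / 2)"] M show ?thesis
        unfolding jb_powr_split[of \<xi> s] by (simp add: algebra_simps)
    qed
    have le2: "jb \<xi> powr ((s - 1) / 2) * norm (fourier g \<xi>) \<le> N * (jb \<xi> powr (s / 2) * norm (vhat u \<xi>))" for \<xi>
    proof -
      have "norm (fourier g \<xi>) \<le> CARD('n) * norm (wv \<xi>) * norm (vhat u \<xi>)"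
        unfolding fg using norm_cdot_le[of "wv \<xi>" "vhat u \<xi>"] by (simp add: norm_mult)
      also have "\<dots> \<le> CARD('n) * (2 * pi * jb \<xi> powr (1 / 2)) * norm (vhat u \<xi>)"
        by (intro mult_right_mono mult_left_mono norm_wv_le) auto
      finally have "jb \<xi> powr ((s - 1) / 2) * norm (fourier g \<xi>) \<le>
          jb \<xi> powr ((s - 1) / 2) * (CARD('n) * (2 * pi * jb \<xi> powr (1 / 2)) * norm (vhat u \<xi>))"
        by (intro mult_left_mono) auto
      also have "\<dots> = N * ((jb \<xi> powr ((s - 1) / 2) * jb \<xi> powr (1 / 2)) * norm (vhat u \<xi>))" by (simp add: N_def)
      also have "jb \<xi> powr ((s - 1) / 2) * jb \<xi> powr (1 / 2) = jb \<xi> powr (s / 2)"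
        by (simp add: diff_divide_distrib flip: powr_add)
      finally show ?thesis .
    qed
    have f: "hs (s - 2) (vhat f)" "hnorm (s - 2) (vhat f) \<le> M * hnorm s (vhat u) + 2 * pi * hnorm (s - 1) (fourier p)"
      using hs_add_weighted[OF hs_scaleR(1)[OF h(1)] hs_scaleR(1)[OF h(3)] le1]
        hs_scaleR(2)[OF h(1), of M] hs_scaleR(2)[OF h(3), of "2 * pi"] M by simp_all
    have g: "hs (s - 1) (fourier g)" "hnorm (s - 1) (fourier g) \<le> N * hnorm s (vhat u)"
      using hs_weighted_le[OF h(1) le2 M(2)] by auto
    have Y: "(f, g) \<in> Hs_dot_pair (s - 2) (s - 1)"
      unfolding Hs_dot_pair_iff using f(1) g(1) by (simp add: vf fg visc_symbol_linear cvec_linear cdot_linear)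
    have "hnorm (s - 2) (vhat f) + hnorm (s - 1) (fourier g) \<le> (M + 2 * pi + N) * (hnorm s (vhat u) + hnorm (s - 1) (fourier p))"
    proof -
      have "0 \<le> M * hnorm (s - 1) (fourier p)" "0 \<le> N * hnorm (s - 1) (fourier p)" "0 \<le> 2 * pi * hnorm s (vhat u)"
        using M by simp_all
      then show ?thesis using f(2) g(2) unfolding distrib_left distrib_right by linarith
    qed
    then show ?thesis using Y by (simp add: st Hs_norm_pair_eq[OF x] Hs_norm_pair_eq[OF Y])
  qed
  then show ?thesis using M by (intro exI[of _ "M + 2 * pi + N"]) auto
qed

lemma advection_bound:
  fixes U :: "real^'n::finite \<Rightarrow> real^'n"
  assumes U: "U \<in> Cinf_per_sigma"
  shows "\<exists>K\<ge>0. \<forall>x\<in>Hs_dot_pair s (s - 1). advection U x \<in> Hs_dot_pair (s - 2) (s - 1) \<and>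
    Hs_norm_pair (s - 2) (s - 1) (advection U x) \<le> K * Hs_norm_pair s (s - 1) x"
proof -
  define K where "K = CARD('n) * infsum (adv_kernel (Uhat U) (s - 2)) UNIV"
  have K: "K \<ge> 0" unfolding K_def by (intro mult_nonneg_nonneg infsum_nonneg) auto
  have V: "div_free (Uhat U)" "rapid_vec (Uhat U)" using div_free_Uhat[OF U] by (auto simp: div_free_def)
  have z: "fourier 0 = (\<lambda>_. 0)" by (rule ext) simp
  have "advection U (u, p) \<in> Hs_dot_pair (s - 2) (s - 1) \<and>
    Hs_norm_pair (s - 2) (s - 1) (advection U (u, p)) \<le> K * Hs_norm_pair s (s - 1) (u, p)"
    if x: "(u, p) \<in> Hs_dot_pair s (s - 1)" for u p
  proof -
    have h: "hs s (vhat u)" using x by (auto simp: Hs_dot_pair_iff)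
    have va: "vhat (advect U u) = adv (Uhat U) (vhat u)" by (rule ext) (rule vhat_advect[OF U h])
    have us: "hs (s - 2 + 1) (vhat u)" by (rule hs_mono(1)[OF h]) simp
    note bd = adv_bounded(2,3)[OF V(2) us]
    have Y: "(advect U u, 0) \<in> Hs_dot_pair (s - 2) (s - 1)"
      unfolding Hs_dot_pair_iff va using bd(1) adv_zero_freq[OF V(1)] by (simp add: z)
    have "hnorm (s - 2) (adv (Uhat U) (vhat u)) \<le> K * hnorm (s - 1) (vhat u)" using bd(2) by (simp add: K_def)
    also have "\<dots> \<le> K * (hnorm s (vhat u) + hnorm (s - 1) (fourier p))"
      by (intro mult_left_mono add_increasing2 hnorm_nonneg hs_mono(2)[OF h] K) simp
    finally show ?thesis using Y by (simp add: advection_def Hs_norm_pair_eq[OF x] Hs_norm_pair_eq[OF Y] va z)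
  qed
  with K show ?thesis by auto
qed

definition cnjv :: "complex^'n::finite \<Rightarrow> complex^'n"
  where "cnjv v = (\<chi> k. cnj (v $ k))"

lemma stokes_symbol_reflect:
  "visc_symbol A (- \<kappa>) (cnjv u) + cvec (- \<kappa>) (\<i> * cnj p) = cnjv (visc_symbol A \<kappa> u + cvec \<kappa> (\<i> * p))"
  "\<i> * cdot (- \<kappa>) (cnjv u) = cnj (\<i> * cdot \<kappa> u)"
  by (simp_all add: visc_symbol_def cvec_def cdot_def cnjv_def vec_eq_iff cnj_sum sum_negf scaleR_conv_of_real)

lemma stokes_symbol_unique:
  assumes A: "admissible C a A" and \<kappa>: "\<kappa> \<noteq> 0"
    and "visc_symbol A \<kappa> u + cvec \<kappa> (\<i> * p) = visc_symbol A \<kappa> v + cvec \<kappa> (\<i> * q)" "\<i> * cdot \<kappa> u = \<i> * cdot \<kappa> v"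
  shows "u = v" "p = q"
proof -
  have A': "tensor_symmetric A" "relaxed_elliptic A C" "tensor_norm A = a"
    using A by (auto simp: admissible_def)
  have c: "cvec \<kappa> (\<i> * (p - q)) = cvec \<kappa> (\<i> * p) - cvec \<kappa> (\<i> * q)"
    by (simp add: cvec_def vec_eq_iff algebra_simps)
  have "visc_symbol A \<kappa> (u - v) + cvec \<kappa> (\<i> * (p - q)) =
      (visc_symbol A \<kappa> u + cvec \<kappa> (\<i> * p)) - (visc_symbol A \<kappa> v + cvec \<kappa> (\<i> * q))"
    unfolding c visc_symbol_linear by simp
  hence "visc_symbol A \<kappa> (u - v) + cvec \<kappa> (\<i> * (p - q)) = 0" "\<i> * cdot \<kappa> (u - v) = 0"
    using assms(3,4) by (simp_all add: cdot_linear)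
  from stokes_pointwise[OF A' \<kappa> this] \<kappa> show "u = v" "p = q"
    by (simp_all add: mult_le_0_iff)
qed

lemma vhat_reflect: "vhat f (- \<xi>) = cnjv (vhat f \<xi>)"
  by (simp add: vec_eq_iff cnjv_def fourier_reflect)

lemma stokes_onto:
  fixes A :: "'n::finite tensor"
  assumes A: "admissible C a A" and y: "y \<in> Hs_dot_pair (s - 2) (s - 1)"
  shows "\<exists>x\<in>Hs_dot_pair s (s - 1). stokes A x = y"
proof -
  obtain f g where y_eq: "y = (f, g)" by (cases y)
  have sym: "tensor_symmetric A" "relaxed_elliptic A C" using A by (auto simp: admissible_def)
  have h: "hs (s - 2) (vhat f)" "vhat f 0 = 0" "hs (s - 1) (fourier g)" "fourier g 0 = 0"
    using y by (auto simp: y_eq Hs_dot_pair_iff)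
  have "\<exists>v q. visc_symbol A (wv \<xi>) v + cvec (wv \<xi>) (\<i> * q) = vhat f \<xi> \<and> \<i> * cdot (wv \<xi>) v = fourier g \<xi> \<and>
      (\<xi> = 0 \<longrightarrow> v = 0 \<and> q = 0)" for \<xi>
  proof (cases "\<xi> = 0")
    case True
    then show ?thesis by (intro exI[of _ 0]) (simp add: visc_symbol_linear cvec_linear cdot_linear h)
  next
    case False
    then show ?thesis using stokes_solvable[OF sym, of "wv \<xi>" "vhat f \<xi>" "fourier g \<xi>"] by simp
  qed
  then obtain v q where vq: "\<And>\<xi>. visc_symbol A (wv \<xi>) (v \<xi>) + cvec (wv \<xi>) (\<i> * q \<xi>) = vhat f \<xi>"
    "\<And>\<xi>. \<i> * cdot (wv \<xi>) (v \<xi>) = fourier g \<xi>" "v 0 = 0" "q 0 = 0" by metis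
  note st = stokes_hs[OF A vq h(1,3)]
  have "v (- \<xi>) = cnjv (v \<xi>) \<and> q (- \<xi>) = cnj (q \<xi>)" for \<xi>
  proof (cases "\<xi> = 0")
    case True
    moreover have "cnjv 0 = (0 :: complex^'n)" by (simp add: cnjv_def vec_eq_iff)
    ultimately show ?thesis by (simp add: vq)
  next
    case False
    hence w: "wv (- \<xi>) \<noteq> 0" by simp
    have "visc_symbol A (wv (- \<xi>)) (v (- \<xi>)) + cvec (wv (- \<xi>)) (\<i> * q (- \<xi>)) =
        visc_symbol A (wv (- \<xi>)) (cnjv (v \<xi>)) + cvec (wv (- \<xi>)) (\<i> * cnj (q \<xi>))"
      unfolding vq(1)[of "- \<xi>"] unfolding wv_simps(2) stokes_symbol_reflect vq(1) by (rule vhat_reflect)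
    moreover have "\<i> * cdot (wv (- \<xi>)) (v (- \<xi>)) = \<i> * cdot (wv (- \<xi>)) (cnjv (v \<xi>))"
      unfolding vq(2)[of "- \<xi>"] unfolding wv_simps(2) stokes_symbol_reflect vq(2) by (rule fourier_reflect)
    ultimately show ?thesis using stokes_symbol_unique[OF A w] by blast
  qed
  hence refl: "v (- \<xi>) $ k = cnj (v \<xi> $ k)" "q (- \<xi>) = cnj (q \<xi>)" for \<xi> k by (simp_all add: cnjv_def)
  define u :: "'n vdistr" where "u = (\<chi> k. dsyn (\<lambda>\<xi>. v \<xi> $ k))"
  define p where "p = dsyn q"
  have "fourier (dsyn (\<lambda>\<xi>. v \<xi> $ k)) \<xi> = v \<xi> $ k" for k \<xi>
    by (rule fourier_dsyn[OF tempered_hs[OF hs_nth[OF st(1)]] refl(1)])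
  hence u: "vhat u = v" by (simp add: fun_eq_iff vec_eq_iff u_def)
  have p: "fourier p = q" unfolding p_def by (rule ext) (rule fourier_dsyn[OF tempered_hs[OF st(3)] refl(2)])
  have "(u, p) \<in> Hs_dot_pair s (s - 1)" by (simp add: Hs_dot_pair_iff u p st vq)
  moreover have "- aniso_op A u + grad p = f"
    by (rule vhat_inject) (simp only: vhat_linear vhat_aniso_op[OF sym(1)] vhat_grad u p minus_minus vq)
  moreover have "divergence u = g" by (rule fourier_inject) (simp add: fourier_divergence u vq)
  ultimately show ?thesis by (intro bexI[of _ "(u, p)"]) (simp_all add: stokes_def y_eq)
qed

lemma vhat_eq_simps:
  "vhat (u + v) = (\<lambda>\<xi>. vhat u \<xi> + vhat v \<xi>)" "vhat (a *\<^sub>R u) = (\<lambda>\<xi>. a *\<^sub>R vhat u \<xi>)" "vhat 0 = (\<lambda>_. 0)"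
  "fourier (S + T) = (\<lambda>\<xi>. fourier S \<xi> + fourier T \<xi>)" "fourier (a *\<^sub>R S) = (\<lambda>\<xi>. a *\<^sub>R fourier S \<xi>)" "fourier 0 = (\<lambda>_. 0)"
  by (rule ext; simp)+

lemma subspace_Hs_dot_pair: "subspace (Hs_dot_pair s t)"
  unfolding subspace_def
  by (auto simp: zero_prod_def Hs_dot_pair_iff vhat_eq_simps intro!: hs_add hs_scaleR)

lemma Hs_norm_pair_nonneg: "x \<in> Hs_dot_pair s t \<Longrightarrow> 0 \<le> Hs_norm_pair s t x"
  by (cases x) (simp add: Hs_norm_pair_eq)

lemma Hs_norm_pair_eq_0:
  assumes "x \<in> Hs_dot_pair s t" "Hs_norm_pair s t x \<le> 0"
  shows "x = 0"
proof (cases x)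
  case (Pair u p)
  have h: "hs s (vhat u)" "hs t (fourier p)" using assms(1) by (auto simp: Pair Hs_dot_pair_iff)
  have "hnorm s (vhat u) + hnorm t (fourier p) \<le> 0"
    using assms Hs_norm_pair_eq[of u p s t] by (simp add: Pair)
  hence "hnorm s (vhat u) = 0" "hnorm t (fourier p) = 0"
    using hnorm_nonneg[of s "vhat u"] hnorm_nonneg[of t "fourier p"] by linarith+
  hence "vhat u \<xi> = 0" "fourier p \<xi> = 0" for \<xi> using hnorm_eq_0 h by blast+
  hence "u = 0" "p = 0" by (auto intro!: vhat_inject fourier_inject)
  then show ?thesis by (simp add: Pair zero_prod_def)
qed

lemma Hs_norm_pair_triangle:
  assumes "x \<in> Hs_dot_pair s t" "y \<in> Hs_dot_pair s t"
  shows "Hs_norm_pair s t (x + y) \<le> Hs_norm_pair s t x + Hs_norm_pair s t y"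
proof -
  obtain u p v q where e: "x = (u, p)" "y = (v, q)" by (cases x; cases y)
  have h: "hs s (vhat u)" "hs t (fourier p)" "hs s (vhat v)" "hs t (fourier q)"
    using assms by (auto simp: e Hs_dot_pair_iff)
  have "(u + v, p + q) \<in> Hs_dot_pair s t" using subspace_add[OF subspace_Hs_dot_pair assms] by (simp add: e)
  from Hs_norm_pair_eq[OF this] show ?thesis
    using assms hs_add(2)[OF h(1,3)] hs_add(2)[OF h(2,4)] by (simp add: e Hs_norm_pair_eq vhat_eq_simps)
qed

lemma Hs_norm_pair_scaleR:
  assumes "x \<in> Hs_dot_pair s t"
  shows "Hs_norm_pair s t (a *\<^sub>R x) = \<bar>a\<bar> * Hs_norm_pair s t x"
proof -
  obtain u p where e: "x = (u, p)" by (cases x)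
  have h: "hs s (vhat u)" "hs t (fourier p)" using assms by (auto simp: e Hs_dot_pair_iff)
  have "(a *\<^sub>R u, a *\<^sub>R p) \<in> Hs_dot_pair s t" using subspace_scale[OF subspace_Hs_dot_pair assms, of a] by (simp add: e)
  from Hs_norm_pair_eq[OF this] show ?thesis
    using assms by (simp add: e Hs_norm_pair_eq vhat_eq_simps hs_scaleR(2)[OF h(1)] hs_scaleR(2)[OF h(2)] distrib_left)
qed

lemma Hs_dot_pair_mono: "s \<le> s' \<Longrightarrow> t \<le> t' \<Longrightarrow> Hs_dot_pair s' t' \<subseteq> Hs_dot_pair s t"
  by (auto simp: Hs_dot_pair_iff intro: hs_mono)

section \<open>The Oseen system\<close>

lemma oseen_apriori:
  fixes U :: "real^'n::finite \<Rightarrow> real^'n"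
  assumes U: "U \<in> Cinf_per_sigma" and s: "s \<ge> 1"
  shows "\<exists>K>0. \<forall>A t x. admissible C a A \<longrightarrow> 0 \<le> t \<longrightarrow> t \<le> 1 \<longrightarrow> x \<in> Hs_dot_pair s (s - 1) \<longrightarrow>
    Hs_norm_pair s (s - 1) x \<le> K * Hs_norm_pair (s - 2) (s - 1) (stokes A x + t *\<^sub>R advection U x)"
proof -
  obtain K where K: "K > 0" "\<And>(A :: 'n tensor) t u p f g. admissible C a A \<Longrightarrow> 0 \<le> t \<Longrightarrow> t \<le> 1 \<Longrightarrow> oseen_eq A (Uhat U) t u p f g \<Longrightarrow>
      u 0 = 0 \<Longrightarrow> p 0 = 0 \<Longrightarrow> hs s u \<Longrightarrow> hs (s - 2) f \<Longrightarrow> hs (s - 1) g \<Longrightarrow>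
      hnorm s u + hnorm (s - 1) p \<le> K * (hnorm (s - 2) f + hnorm (s - 1) g)"
    using apriori_estimate[OF div_free_Uhat[OF U] s, of C a] by blast
  have "Hs_norm_pair s (s - 1) (u, p) \<le> K * Hs_norm_pair (s - 2) (s - 1) (stokes A (u, p) + t *\<^sub>R advection U (u, p))"
    if A: "admissible C a A" and t: "0 \<le> t" "t \<le> 1" and x: "(u, p) \<in> Hs_dot_pair s (s - 1)" for A t u p
  proof -
    obtain f g where fg: "stokes A (u, p) + t *\<^sub>R advection U (u, p) = (f, g)"
      by (cases "stokes A (u, p) + t *\<^sub>R advection U (u, p)")
    have "stokes A (u, p) \<in> Hs_dot_pair (s - 2) (s - 1)" "advection U (u, p) \<in> Hs_dot_pair (s - 2) (s - 1)"
      using stokes_bound[OF A, of s] advection_bound[OF U, of s] x by blast+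
    hence Y: "(f, g) \<in> Hs_dot_pair (s - 2) (s - 1)" unfolding fg[symmetric]
      by (intro subspace_add subspace_scale subspace_Hs_dot_pair)
    have h: "hs s (vhat u)" "vhat u 0 = 0" "fourier p 0 = 0" "hs (s - 2) (vhat f)" "hs (s - 1) (fourier g)"
      using x Y by (auto simp: Hs_dot_pair_iff)
    have sym: "tensor_symmetric A" using A by (simp add: admissible_def)
    show ?thesis unfolding fg Hs_norm_pair_eq[OF x] Hs_norm_pair_eq[OF Y]
      by (rule K(2)[OF A t oseen_eq_Fourier[OF sym U h(1) fg] h(2,3,1,4,5)])
  qed
  with K(1) show ?thesis by auto
qed

lemma oseen_solvable:
  fixes U :: "real^'n::finite \<Rightarrow> real^'n"
  assumes U: "U \<in> Cinf_per_sigma" and s: "s \<ge> 1" and A: "admissible C a A" and y: "y \<in> Hs_dot_pair (s - 2) (s - 1)"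
  shows "\<exists>x\<in>Hs_dot_pair s (s - 1). oseen A U x = y"
proof -
  obtain K where K: "K > 0" "\<And>t x. 0 \<le> t \<Longrightarrow> t \<le> 1 \<Longrightarrow> x \<in> Hs_dot_pair s (s - 1) \<Longrightarrow>
    Hs_norm_pair s (s - 1) x \<le> K * Hs_norm_pair (s - 2) (s - 1) (stokes A x + t *\<^sub>R advection U x)"
    using oseen_apriori[OF U s, of C a] A by blast
  have sym: "tensor_symmetric A" using A by (simp add: admissible_def)
  interpret continuity_method "Hs_dot_pair s (s - 1)" "Hs_norm_pair s (s - 1)"
    "Hs_dot_pair (s - 2) (s - 1)" "Hs_norm_pair (s - 2) (s - 1)" "stokes A" "advection U" K
  proof (rule continuity_method.intro)
    let ?X = "Hs_dot_pair s (s - 1) :: ('n vdistr \<times> 'n pdistr) set"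
      and ?Y = "Hs_dot_pair (s - 2) (s - 1) :: ('n vdistr \<times> 'n pdistr) set"
    let ?NX = "Hs_norm_pair s (s - 1) :: 'n vdistr \<times> 'n pdistr \<Rightarrow> real"
      and ?NY = "Hs_norm_pair (s - 2) (s - 1) :: 'n vdistr \<times> 'n pdistr \<Rightarrow> real"
    show "subspace ?X" "subspace ?Y" by (rule subspace_Hs_dot_pair)+
    show "0 \<le> ?NX x" if "x \<in> ?X" for x using that by (rule Hs_norm_pair_nonneg)
    show "?NX (x + y) \<le> ?NX x + ?NX y" if "x \<in> ?X" "y \<in> ?X" for x y using that by (rule Hs_norm_pair_triangle)
    show "0 \<le> ?NY x" if "x \<in> ?Y" for x using that by (rule Hs_norm_pair_nonneg)
    show "x = 0" if "x \<in> ?Y" "?NY x = 0" for x using that(1) by (rule Hs_norm_pair_eq_0) (simp add: that)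
    show "?NY (x + y) \<le> ?NY x + ?NY y" if "x \<in> ?Y" "y \<in> ?Y" for x y using that by (rule Hs_norm_pair_triangle)
    show "?NY (a *\<^sub>R x) = \<bar>a\<bar> * ?NY x" if "x \<in> ?Y" for x a using that by (rule Hs_norm_pair_scaleR)
    show "linear (stokes A)" by (rule linear_stokes[OF sym])
    show "linear (advection U)" by (rule linear_advection)
    show "stokes A x \<in> ?Y" if "x \<in> ?X" for x using stokes_bound[OF A, of s] that by blast
    show "advection U x \<in> ?Y" if "x \<in> ?X" for x using advection_bound[OF U, of s] that by blast
    show "\<exists>y\<in>?X. (\<lambda>M. ?NX (y - (\<Sum>m<M. x m))) \<longlonglongrightarrow> 0"
      if "\<And>m. x m \<in> ?X" "\<And>m. ?NX (x m) \<le> K * (1/2) ^ m" for x :: "nat \<Rightarrow> 'n vdistr \<times> 'n pdistr" and K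
      using that by (rule Hs_dot_pair_complete)
    show "\<exists>K\<ge>0. \<forall>x\<in>?X. ?NY (stokes A x) \<le> K * ?NX x" using stokes_bound[OF A, of s] by blast
    show "\<exists>K\<ge>0. \<forall>x\<in>?X. ?NY (advection U x) \<le> K * ?NX x" using advection_bound[OF U, of s] by blast
    show "0 < K" by (rule K(1))
    show "?NX x \<le> K * ?NY (stokes A x + t *\<^sub>R advection U x)" if "0 \<le> t" "t \<le> 1" "x \<in> ?X" for t x
      using that by (rule K(2))
    show "\<exists>x\<in>?X. stokes A x = y" if "y \<in> ?Y" for y using stokes_onto[OF A that] .
  qed
  from onto[OF y] show ?thesis by (simp add: oseen_split)
qed

lemma linear_oseen: "tensor_symmetric A \<Longrightarrow> linear (oseen A U)"
  unfolding oseen_split[abs_def] by (intro linear_compose_add linear_stokes linear_advection)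

lemma oseen_injective:
  fixes U :: "real^'n::finite \<Rightarrow> real^'n"
  assumes U: "U \<in> Cinf_per_sigma" and s: "s \<ge> 1" and A: "admissible C a A"
    and x: "x \<in> Hs_dot_pair s (s - 1)" and y: "y \<in> Hs_dot_pair s (s - 1)" and eq: "oseen A U x = oseen A U y"
  shows "x = y"
proof -
  obtain K where K: "K > 0" "\<And>t x. 0 \<le> t \<Longrightarrow> t \<le> 1 \<Longrightarrow> x \<in> Hs_dot_pair s (s - 1) \<Longrightarrow>
    Hs_norm_pair s (s - 1) x \<le> K * Hs_norm_pair (s - 2) (s - 1) (stokes A x + t *\<^sub>R advection U x)"
    using oseen_apriori[OF U s, of C a] A by blast
  have sym: "tensor_symmetric A" using A by (simp add: admissible_def)
  have d: "x - y \<in> Hs_dot_pair s (s - 1)" by (intro subspace_diff subspace_Hs_dot_pair x y)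
  have "stokes A (x - y) + 1 *\<^sub>R advection U (x - y) = 0"
    using linear_diff[OF linear_oseen[OF sym], of U x y] eq by (simp add: oseen_split)
  moreover have "Hs_norm_pair (s - 2) (s - 1) (0 :: 'n vdistr \<times> 'n pdistr) = 0"
    using Hs_norm_pair_scaleR[OF subspace_0[OF subspace_Hs_dot_pair], of "s - 2" "s - 1" 0] by simp
  ultimately have "Hs_norm_pair s (s - 1) (x - y) \<le> 0" using K(2)[of 1, OF _ _ d] by simp
  from Hs_norm_pair_eq_0[OF d this] show ?thesis by simp
qed

lemma of_fun_Cinf_per_dot:
  assumes "T \<in> of_fun ` Cinf_per_dot"
  shows "rapid (fourier T)" "fourier T 0 = 0"
proof -
  obtain f where f: "T = of_fun f" "f \<in> Cinf_per" "tint f = 0"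
    using assms by (auto simp: Cinf_per_dot_def)
  show "rapid (fourier T)" by (simp add: f rapid_coeff)
  have "tint (\<lambda>x::real^'a. 0) = 0" by (simp add: set_lebesgue_integral_def)
  then show "fourier T 0 = 0" by (simp add: f coeff_tint complex_eq_iff)
qed

lemma rapid_Cinf_per_dot:
  assumes r: "rapid (fourier T)" and 0: "fourier T 0 = 0"
  shows "T \<in> of_fun ` Cinf_per_dot"
proof
  let ?f = "syn (fourier T)"
  show T: "T = of_fun ?f" by (rule of_fun_syn[OF r])
  have c: "?f \<in> Cinf_per" by (rule syn_Cinf_per[OF r])
  have "coeff ?f 0 = 0" using 0 T by simp
  hence "tint ?f = 0" by (simp add: coeff_tint c complex_eq_iff)
  with c show "?f \<in> Cinf_per_dot" by (simp add: Cinf_per_dot_def)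
qed

lemma Cinf_dot_pair_subset: "Cinf_dot_pair \<subseteq> Hs_dot_pair s t"
  by (auto simp: Cinf_dot_pair_def Hs_dot_pair_def components_in_def Hs_dot_iff
      intro!: rapid_hs of_fun_Cinf_per_dot)

lemma oseen_smooth:
  fixes U :: "real^'n::finite \<Rightarrow> real^'n"
  assumes U: "U \<in> Cinf_per_sigma" and s: "s \<ge> 1" and A: "admissible C a A"
    and x: "x \<in> Hs_dot_pair s (s - 1)" and y: "oseen A U x \<in> Cinf_dot_pair"
  shows "x \<in> Cinf_dot_pair"
proof -
  obtain u p where up: "x = (u, p)" by (cases x)
  have all: "x \<in> Hs_dot_pair t (t - 1)" if t: "t \<ge> s" for t
  proof -
    obtain z where z: "z \<in> Hs_dot_pair t (t - 1)" "oseen A U z = oseen A U x"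
      using oseen_solvable[OF U _ A, of t "oseen A U x"] y s t Cinf_dot_pair_subset by fastforce
    have "z \<in> Hs_dot_pair s (s - 1)" using z(1) Hs_dot_pair_mono[of s t "s - 1" "t - 1"] t by auto
    from oseen_injective[OF U s A this x z(2)] z(1) show ?thesis by simp
  qed
  have h: "hs t (vhat u)" "hs (t - 1) (fourier p)" "vhat u 0 = 0" "fourier p 0 = 0" if "t \<ge> s" for t
    using all[OF that] by (auto simp: up Hs_dot_pair_iff)
  have "rapid (fourier (u $ k))" for k
    by (rule rapid_if_hs[of s]) (use hs_nth[OF h(1)] in simp)
  moreover have "rapid (fourier p)"
    by (rule rapid_if_hs[of "s - 1"]) (use h(2)[of "_ + 1"] in simp)
  moreover have "fourier (u $ k) 0 = 0" for k using h(3)[of s] by (simp add: vec_eq_iff)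
  ultimately show ?thesis using h(4)[of s]
    by (simp add: up Cinf_dot_pair_def components_in_def rapid_Cinf_per_dot)
qed

theorem theorem5p2:
  fixes U :: "real^'n::finite \<Rightarrow> real^'n" and C_A norm_A s :: real
  assumes "CARD('n) \<ge> 2" and "U \<in> Cinf_per_sigma" and "s \<ge> 1"
  shows "\<exists>C_s>0. \<forall>A :: 'n tensor.
    tensor_symmetric A \<and> relaxed_elliptic A C_A \<and> tensor_norm A = norm_A \<longrightarrow>
      (\<forall>fg \<in> Hs_dot_pair (s - 2) (s - 1).
         (\<exists>!up. up \<in> Hs_dot_pair s (s - 1) \<and> oseen A U up = fg) \<and>
         (\<forall>up \<in> Hs_dot_pair s (s - 1). oseen A U up = fg \<longrightarrow>
            Hs_norm_pair s (s - 1) up \<le> C_s * Hs_norm_pair (s - 2) (s - 1) fg)) \<and>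
      normed_isomorphism
        (Hs_dot_pair s (s - 1)) (Hs_norm_pair s (s - 1))
        (Hs_dot_pair (s - 2) (s - 1)) (Hs_norm_pair (s - 2) (s - 1))
        (oseen A U) \<and>
      (\<forall>fg \<in> Cinf_dot_pair. \<forall>up \<in> Hs_dot_pair s (s - 1).
         oseen A U up = fg \<longrightarrow> up \<in> Cinf_dot_pair)"
proof -
  let ?X = "Hs_dot_pair s (s - 1) :: ('n vdistr \<times> 'n pdistr) set" and ?Y = "Hs_dot_pair (s - 2) (s - 1) :: ('n vdistr \<times> 'n pdistr) set"
  let ?NX = "Hs_norm_pair s (s - 1) :: 'n vdistr \<times> 'n pdistr \<Rightarrow> real"
    and ?NY = "Hs_norm_pair (s - 2) (s - 1) :: 'n vdistr \<times> 'n pdistr \<Rightarrow> real"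
  note U = assms(2) and s = assms(3)
  obtain K where K: "K > 0" and est': "\<And>A t x. admissible C_A norm_A A \<Longrightarrow> 0 \<le> t \<Longrightarrow> t \<le> 1 \<Longrightarrow> x \<in> ?X \<Longrightarrow>
    ?NX x \<le> K * ?NY (stokes A x + t *\<^sub>R advection U x)"
    using oseen_apriori[OF U s, of C_A norm_A] by blast
  show ?thesis
  proof (intro exI[of _ K] conjI allI impI K)
    fix A :: "'n tensor"
    assume "tensor_symmetric A \<and> relaxed_elliptic A C_A \<and> tensor_norm A = norm_A"
    hence A: "admissible C_A norm_A A" and sym: "tensor_symmetric A" by (auto simp: admissible_def)
    have est: "?NX x \<le> K * ?NY (oseen A U x)" if "x \<in> ?X" for x
      using est'[OF A _ _ that, of 1] by (simp add: oseen_split)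
    have into: "oseen A U x \<in> ?Y" if "x \<in> ?X" for x
      unfolding oseen_split using stokes_bound[OF A, of s] advection_bound[OF U, of s] that
      by (intro subspace_add subspace_Hs_dot_pair) blast+
    have inj: "x = y" if "x \<in> ?X" "y \<in> ?X" "oseen A U x = oseen A U y" for x y
      by (rule oseen_injective[OF U s A that])
    have onto: "\<exists>x\<in>?X. oseen A U x = y" if "y \<in> ?Y" for y
      by (rule oseen_solvable[OF U s A that])
    show "\<forall>fg \<in> ?Y. (\<exists>!up. up \<in> ?X \<and> oseen A U up = fg) \<and>
        (\<forall>up \<in> ?X. oseen A U up = fg \<longrightarrow> ?NX up \<le> K * ?NY fg)"
      using onto inj est by blast
    show "\<forall>fg \<in> Cinf_dot_pair. \<forall>up \<in> ?X. oseen A U up = fg \<longrightarrow> up \<in> Cinf_dot_pair"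
      using oseen_smooth[OF U s A] by blast
    show "normed_isomorphism ?X ?NX ?Y ?NY (oseen A U)"
      unfolding normed_isomorphism_def
    proof (intro conjI)
      show bij: "bij_betw (oseen A U) ?X ?Y"
        unfolding bij_betw_def inj_on_def using inj into onto by blast
      show "\<forall>x\<in>?X. \<forall>y\<in>?X. \<forall>a b. oseen A U (a *\<^sub>R x + b *\<^sub>R y) = a *\<^sub>R oseen A U x + b *\<^sub>R oseen A U y"
        using linear_oseen[OF sym, of U] by (simp add: linear_add linear_scale)
      show "\<exists>C. \<forall>x\<in>?X. ?NY (oseen A U x) \<le> C * ?NX x"
      proof -
        obtain K1 where K1: "\<And>x. x \<in> ?X \<Longrightarrow> stokes A x \<in> ?Y \<and> ?NY (stokes A x) \<le> K1 * ?NX x"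
          using stokes_bound[OF A, of s] by blast
        obtain K2 where K2: "\<And>x. x \<in> ?X \<Longrightarrow> advection U x \<in> ?Y \<and> ?NY (advection U x) \<le> K2 * ?NX x"
          using advection_bound[OF U, of s] by blast
        have "?NY (oseen A U x) \<le> (K1 + K2) * ?NX x" if "x \<in> ?X" for x
          using Hs_norm_pair_triangle[of "stokes A x" "s - 2" "s - 1" "advection U x"] K1[OF that] K2[OF that]
          by (simp add: oseen_split distrib_right)
        then show ?thesis by blast
      qed
      show "\<exists>C. \<forall>y\<in>?Y. ?NX (inv_into ?X (oseen A U) y) \<le> C * ?NY y"
      proof (intro exI ballI)
        fix y assume y: "y \<in> ?Y"
        hence "inv_into ?X (oseen A U) y \<in> ?X" "oseen A U (inv_into ?X (oseen A U) y) = y"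
          using bij by (auto simp: bij_betw_def intro: inv_into_into f_inv_into_f)
        with est[of "inv_into ?X (oseen A U) y"] show "?NX (inv_into ?X (oseen A U) y) \<le> K * ?NY y" by simp
      qed
    qed
  qed
qed

end
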